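(* Let $Y$ be a finite-dimensional Yetter–Drinfeld module (over $\mathbb C$) for a group $G$, and let $\mathcal H_Y\cong\mathcal B(Y,\Psi)\otimes\mathbb CG\otimes\mathcal B(Y^*,\tau\Psi^*\tau)$ be its braided Heisenberg double. 1. The group $G$ acts on $\mathcal H_Y$ by conjugation, $g\triangleright x=gxg^{-1}$, which makes $\mathcal H_Y$ a $G$-algebra. 2. There is a $G$-grading on the algebra $\mathcal H_Y$ such that the $G$-degree of $g\in G$ is $g$, the $G$-degree of $v\in Y_g$ is $g$, and the $G$-degree of $Y^*$ is $1$. 3. The $G$-action in 1 and the $G$-grading in 2 make $\mathcal H_Y$ an algebra in the category of Yetter–Drinfeld modules for $G$.
   Context: All tensor products are over $\mathbb C$. A Yetter–Drinfeld module for $G$ is a $\mathbb CG$-module $Y$ (action $\triangleright$) with a grading $Y=\bigoplus_{g\in G}Y_g$ such that $g\triangleright Y_h=Y_{ghg^{-1}}$. An algebra in the category of Yetter–Drinfeld modules is a Yetter–Drinfeld module which is an algebra on which $G$ acts by algebra automorphisms and whose grading is an algebra grading ($A_gA_h\subset A_{gh}$, $1\in A_1$). The coaction is $\delta(v)=v^{(0)}\otimes v^{(1)}=v\otimes g$ for $v\in Y_g$. The braiding is $\Psi(y\otimes z)=(g\triangleright z)\otimes y$ for $y\in Y_g$. The dual $Y^*$ has the dual action and grading $(Y^* )_g=(Y_{g^{-1}})^*$; its braiding is $\Psi^*$. $\tau$ is the flip; $\langle\,,\rangle$ is evaluation of $Y^*$ on $Y$. For a braiding $\Psi$ on $V$,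 $\mathcal B(V,\Psi)=T(V)/I_\Psi$, $I_\Psi=\bigoplus_n\ker[n]!_\Psi$, $[n]!_\Psi=\sum_{\sigma\in S_n}\Psi_\sigma$, where $\Psi_\sigma=\Psi_{i_1,i_1+1}\cdots\Psi_{i_l,i_l+1}$ for a reduced expression $\sigma=s_{i_1}\cdots s_{i_l}$. The braided Heisenberg double $\mathcal H_Y$ is the quotient of $T(Y\oplus Y^* )\rtimes G$ (semidirect product relation $gx=(g\triangleright x)g$) by the two-sided ideal generated by $I_\Psi\subset T(Y)$, $I_{\tau\Psi^*\tau}\subset T(Y^* )$ and $f\otimes v-v\otimes f-\langle f,v^{(0)}\rangle v^{(1)}$ for $f\in Y^*$, $v\in Y$; multiplication gives a vector space isomorphism $\mathcal B(Y,\Psi)\otimes\mathbb CG\otimes\mathcal B(Y^*,\tau\Psi^*\tau)\cong\mathcal H_Y$. *)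

theory Defs
  imports
    Complex_Main
    "HOL-Algebra.Module"
    "HOL-Algebra.QuotRing"
    "HOL-Algebra.Algebraic_Closure_Type"
    "HOL-Combinatorics.Permutations"
begin

section \<open>Complex vector spaces and algebras\<close>

text \<open>
  A complex vector space is a module record \<open>V\<close> with \<open>module CC V\<close>; the multiplicative fields
  of the record only play a role for algebras.
\<close>

abbreviation CC :: "complex ring"
  where "CC \<equiv> ring_of_type_algebra"

definition finite_dim :: "(complex, 'v, 'm) module_scheme \<Rightarrow> bool" where
  "finite_dim V \<longleftrightarrow> (\<exists>B. finite B \<and> B \<subseteq> carrier V \<and>
     (\<forall>v\<in>carrier V. \<exists>c. v = (\<Oplus>\<^bsub>V\<^esub>b\<in>B. c b \<odot>\<^bsub>V\<^esub> b)))"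

definition clinear ::
  "(complex, 'v, 'm) module_scheme \<Rightarrow> (complex, 'w, 'n) module_scheme \<Rightarrow> ('v \<Rightarrow> 'w) \<Rightarrow> bool" where
  "clinear V W f \<longleftrightarrow> f \<in> carrier V \<rightarrow> carrier W \<and>
     (\<forall>u\<in>carrier V. \<forall>v\<in>carrier V. f (u \<oplus>\<^bsub>V\<^esub> v) = f u \<oplus>\<^bsub>W\<^esub> f v) \<and>
     (\<forall>c. \<forall>v\<in>carrier V. f (c \<odot>\<^bsub>V\<^esub> v) = c \<odot>\<^bsub>W\<^esub> f v)"

definition complex_algebra :: "(complex, 'b, 'm) module_scheme \<Rightarrow> bool" where
  "complex_algebra A \<longleftrightarrow> module CC A \<and> ring A \<and>
     (\<forall>c. \<forall>x\<in>carrier A. \<forall>y\<in>carrier A.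
        (c \<odot>\<^bsub>A\<^esub> x) \<otimes>\<^bsub>A\<^esub> y = c \<odot>\<^bsub>A\<^esub> (x \<otimes>\<^bsub>A\<^esub> y) \<and>
        x \<otimes>\<^bsub>A\<^esub> (c \<odot>\<^bsub>A\<^esub> y) = c \<odot>\<^bsub>A\<^esub> (x \<otimes>\<^bsub>A\<^esub> y))"

text \<open>The library's quotient by a two-sided ideal, with the induced scalar multiplication.\<close>

definition quot_alg ::
  "(complex, 'b, 'm) module_scheme \<Rightarrow> 'b set \<Rightarrow> (complex, 'b set) module" where
  "quot_alg A I = \<lparr>
     carrier = carrier (A Quot I), monoid.mult = monoid.mult (A Quot I), one = one (A Quot I),
     zero = zero (A Quot I), add = add (A Quot I),
     module.smult = (\<lambda>c U. \<Union>x\<in>U. I +>\<^bsub>A\<^esub> (c \<odot>\<^bsub>A\<^esub> x)) \<rparr>"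

definition direct_sum ::
  "(complex, 'v, 'm) module_scheme \<Rightarrow> (complex, 'w, 'n) module_scheme \<Rightarrow> (complex, 'v \<times> 'w) module" where
  "direct_sum V W = \<lparr>
     carrier = carrier V \<times> carrier W, monoid.mult = undefined, one = undefined,
     zero = (\<zero>\<^bsub>V\<^esub>, \<zero>\<^bsub>W\<^esub>),
     add = (\<lambda>x y. (fst x \<oplus>\<^bsub>V\<^esub> fst y, snd x \<oplus>\<^bsub>W\<^esub> snd y)),
     module.smult = (\<lambda>c x. (c \<odot>\<^bsub>V\<^esub> fst x, c \<odot>\<^bsub>W\<^esub> snd x)) \<rparr>"

text \<open>Linear functionals are normalised to vanish outside \<open>carrier V\<close>.\<close>

definition dual :: "(complex, 'v, 'm) module_scheme \<Rightarrow> (complex, 'v \<Rightarrow> complex) module" where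
  "dual V = \<lparr>
     carrier = {f. (\<forall>u\<in>carrier V. \<forall>v\<in>carrier V. f (u \<oplus>\<^bsub>V\<^esub> v) = f u + f v) \<and>
                   (\<forall>c. \<forall>v\<in>carrier V. f (c \<odot>\<^bsub>V\<^esub> v) = c * f v) \<and>
                   (\<forall>v. v \<notin> carrier V \<longrightarrow> f v = 0)},
     monoid.mult = undefined, one = undefined, zero = (\<lambda>_. 0),
     add = (\<lambda>f g v. f v + g v), module.smult = (\<lambda>c f v. c * f v) \<rparr>"


section \<open>Yetter--Drinfeld modules and algebras\<close>

definition representation ::
  "('g, 'a) monoid_scheme \<Rightarrow> (complex, 'v, 'm) module_scheme \<Rightarrow> ('g \<Rightarrow> 'v \<Rightarrow> 'v) \<Rightarrow> bool" where
  "representation G V act \<longleftrightarrow> group G \<and> module CC V \<and>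
     (\<forall>g\<in>carrier G. clinear V V (act g)) \<and>
     (\<forall>v\<in>carrier V. act \<one>\<^bsub>G\<^esub> v = v) \<and>
     (\<forall>g\<in>carrier G. \<forall>h\<in>carrier G. \<forall>v\<in>carrier V. act (g \<otimes>\<^bsub>G\<^esub> h) v = act g (act h v))"

definition homogeneous_decomp ::
  "('g, 'a) monoid_scheme \<Rightarrow> (complex, 'v, 'm) module_scheme \<Rightarrow> ('g \<Rightarrow> 'v set) \<Rightarrow> 'v \<Rightarrow> ('g \<Rightarrow> 'v) \<Rightarrow> bool" where
  "homogeneous_decomp G V gr v x \<longleftrightarrow>
     (\<forall>g\<in>carrier G. x g \<in> gr g) \<and> (\<forall>g. g \<notin> carrier G \<longrightarrow> x g = \<zero>\<^bsub>V\<^esub>) \<and>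
     finite {g. x g \<noteq> \<zero>\<^bsub>V\<^esub>} \<and> v = (\<Oplus>\<^bsub>V\<^esub>g\<in>{g. x g \<noteq> \<zero>\<^bsub>V\<^esub>}. x g)"

definition grading ::
  "('g, 'a) monoid_scheme \<Rightarrow> (complex, 'v, 'm) module_scheme \<Rightarrow> ('g \<Rightarrow> 'v set) \<Rightarrow> bool" where
  "grading G V gr \<longleftrightarrow> (\<forall>g\<in>carrier G. submodule (gr g) CC V) \<and>
     (\<forall>v\<in>carrier V. \<exists>!x. homogeneous_decomp G V gr v x)"

definition component ::
  "('g, 'a) monoid_scheme \<Rightarrow> (complex, 'v, 'm) module_scheme \<Rightarrow> ('g \<Rightarrow> 'v set) \<Rightarrow> 'v \<Rightarrow> 'g \<Rightarrow> 'v" where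
  "component G V gr v = (THE x. homogeneous_decomp G V gr v x)"

definition support ::
  "('g, 'a) monoid_scheme \<Rightarrow> (complex, 'v, 'm) module_scheme \<Rightarrow> ('g \<Rightarrow> 'v set) \<Rightarrow> 'v \<Rightarrow> 'g set" where
  "support G V gr v = {g. component G V gr v g \<noteq> \<zero>\<^bsub>V\<^esub>}"

definition yd_module ::
  "('g, 'a) monoid_scheme \<Rightarrow> (complex, 'v, 'm) module_scheme \<Rightarrow> ('g \<Rightarrow> 'v \<Rightarrow> 'v) \<Rightarrow> ('g \<Rightarrow> 'v set) \<Rightarrow> bool" where
  "yd_module G V act gr \<longleftrightarrow> representation G V act \<and> grading G V gr \<and>
     (\<forall>g\<in>carrier G. \<forall>h\<in>carrier G. act g ` gr h = gr (g \<otimes>\<^bsub>G\<^esub> h \<otimes>\<^bsub>G\<^esub> inv\<^bsub>G\<^esub> g))"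

definition G_algebra ::
  "('g, 'a) monoid_scheme \<Rightarrow> (complex, 'b, 'm) module_scheme \<Rightarrow> ('g \<Rightarrow> 'b \<Rightarrow> 'b) \<Rightarrow> bool" where
  "G_algebra G A act \<longleftrightarrow> complex_algebra A \<and> representation G A act \<and>
     (\<forall>g\<in>carrier G. act g \<in> ring_iso A A)"

definition algebra_grading ::
  "('g, 'a) monoid_scheme \<Rightarrow> (complex, 'b, 'm) module_scheme \<Rightarrow> ('g \<Rightarrow> 'b set) \<Rightarrow> bool" where
  "algebra_grading G A gr \<longleftrightarrow> complex_algebra A \<and> grading G A gr \<and> \<one>\<^bsub>A\<^esub> \<in> gr \<one>\<^bsub>G\<^esub> \<and>
     (\<forall>g\<in>carrier G. \<forall>h\<in>carrier G. \<forall>x\<in>gr g. \<forall>y\<in>gr h. x \<otimes>\<^bsub>A\<^esub> y \<in> gr (g \<otimes>\<^bsub>G\<^esub> h))"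

definition yd_algebra ::
  "('g, 'a) monoid_scheme \<Rightarrow> (complex, 'b, 'm) module_scheme \<Rightarrow> ('g \<Rightarrow> 'b \<Rightarrow> 'b) \<Rightarrow> ('g \<Rightarrow> 'b set) \<Rightarrow> bool" where
  "yd_algebra G A act gr \<longleftrightarrow>
     yd_module G A act gr \<and> G_algebra G A act \<and> algebra_grading G A gr"

definition dual_act ::
  "('g, 'a) monoid_scheme \<Rightarrow> (complex, 'v, 'm) module_scheme \<Rightarrow> ('g \<Rightarrow> 'v \<Rightarrow> 'v) \<Rightarrow>
   'g \<Rightarrow> ('v \<Rightarrow> complex) \<Rightarrow> ('v \<Rightarrow> complex)" where
  "dual_act G V act g f = (\<lambda>v. if v \<in> carrier V then f (act (inv\<^bsub>G\<^esub> g) v) else 0)"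

text \<open>\<open>(V\<^sup>*)\<^sub>g = (V\<^bsub>g\<^sup>-\<^sup>1\<^esub>)\<^sup>*\<close>, seen inside \<open>V\<^sup>*\<close> as the functionals killing all other components.\<close>

definition dual_grading ::
  "('g, 'a) monoid_scheme \<Rightarrow> (complex, 'v, 'm) module_scheme \<Rightarrow> ('g \<Rightarrow> 'v set) \<Rightarrow>
   'g \<Rightarrow> ('v \<Rightarrow> complex) set" where
  "dual_grading G V gr g =
     {f \<in> carrier (dual V). \<forall>h\<in>carrier G. h \<noteq> inv\<^bsub>G\<^esub> g \<longrightarrow> (\<forall>v\<in>gr h. f v = 0)}"


section \<open>The tensor algebra\<close>

text \<open>
  The free unital algebra on a set \<open>U\<close>: finitely supported functions on the words over \<open>U\<close> with
  the concatenation product.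
\<close>

definition free_alg :: "'x set \<Rightarrow> (complex, 'x list \<Rightarrow> complex) module" where
  "free_alg U = \<lparr>
     carrier = {p. finite {w. p w \<noteq> 0} \<and> (\<forall>w. p w \<noteq> 0 \<longrightarrow> set w \<subseteq> U)},
     monoid.mult = (\<lambda>p q w. \<Sum>i\<le>length w. p (take i w) * q (drop i w)),
     one = (\<lambda>w. if w = [] then 1 else 0),
     zero = (\<lambda>_. 0),
     add = (\<lambda>p q w. p w + q w),
     module.smult = (\<lambda>c p w. c * p w) \<rparr>"

definition word :: "'x list \<Rightarrow> 'x list \<Rightarrow> complex" where
  "word w = (\<lambda>u. if u = w then 1 else 0)"

text \<open>\<open>T(V)\<close> is the free algebra on the set \<open>V\<close> modulo the linearity relations of \<open>V\<close>.\<close>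

definition linearity_ideal :: "(complex, 'v, 'm) module_scheme \<Rightarrow> ('v list \<Rightarrow> complex) set" where
  "linearity_ideal V = (let F = free_alg (carrier V) in
     Idl\<^bsub>F\<^esub> ({word [u \<oplus>\<^bsub>V\<^esub> v] \<ominus>\<^bsub>F\<^esub> (word [u] \<oplus>\<^bsub>F\<^esub> word [v]) | u v. u \<in> carrier V \<and> v \<in> carrier V} \<union>
           {word [c \<odot>\<^bsub>V\<^esub> v] \<ominus>\<^bsub>F\<^esub> (c \<odot>\<^bsub>F\<^esub> word [v]) | c v. v \<in> carrier V}))"

definition tensor_alg ::
  "(complex, 'v, 'm) module_scheme \<Rightarrow> (complex, ('v list \<Rightarrow> complex) set) module" where
  "tensor_alg V = quot_alg (free_alg (carrier V)) (linearity_ideal V)"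

text \<open>\<open>pure_tensor V [v\<^sub>1, \<dots>, v\<^sub>n] = v\<^sub>1 \<otimes> \<dots> \<otimes> v\<^sub>n\<close>\<close>

definition pure_tensor :: "(complex, 'v, 'm) module_scheme \<Rightarrow> 'v list \<Rightarrow> ('v list \<Rightarrow> complex) set" where
  "pure_tensor V w = linearity_ideal V +>\<^bsub>free_alg (carrier V)\<^esub> word w"

definition tensor_power ::
  "(complex, 'v, 'm) module_scheme \<Rightarrow> nat \<Rightarrow> ('v list \<Rightarrow> complex) set set" where
  "tensor_power V n = {linearity_ideal V +>\<^bsub>free_alg (carrier V)\<^esub> p | p.
     p \<in> carrier (free_alg (carrier V)) \<and> (\<forall>w. p w \<noteq> 0 \<longrightarrow> length w = n)}"

text \<open>
  The linear map \<open>T(V) \<rightarrow> W\<close> with \<open>v\<^sub>1 \<otimes> \<dots> \<otimes> v\<^sub>n \<mapsto> \<phi> [v\<^sub>1, \<dots>, v\<^sub>n]\<close>, for \<open>\<phi>\<close> multilinear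
  on the words of each length; it is only used for such \<open>\<phi>\<close>, and then the value does not depend on
  the chosen representative.
\<close>

definition tensor_lift ::
  "(complex, 'w, 'm) module_scheme \<Rightarrow> ('v list \<Rightarrow> 'w) \<Rightarrow> ('v list \<Rightarrow> complex) set \<Rightarrow> 'w" where
  "tensor_lift W \<phi> U = (let p = (SOME p. p \<in> U) in \<Oplus>\<^bsub>W\<^esub>w\<in>{w. p w \<noteq> 0}. p w \<odot>\<^bsub>W\<^esub> \<phi> w)"

definition tensor_map ::
  "(complex, 'w, 'n) module_scheme \<Rightarrow> ('v \<Rightarrow> 'w) \<Rightarrow>
   ('v list \<Rightarrow> complex) set \<Rightarrow> ('w list \<Rightarrow> complex) set" where
  "tensor_map W f = tensor_lift (tensor_alg W) (\<lambda>w. pure_tensor W (map f w))"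


section \<open>Braidings and Nichols algebras\<close>

text \<open>
  Maps \<open>V \<otimes> V \<rightarrow> V \<otimes> V\<close> are represented by maps on \<open>T(V)\<close>, of which only the restriction to
  \<open>tensor_power V 2\<close> is used.
\<close>

definition tensor2_map ::
  "(complex, 'v, 'm) module_scheme \<Rightarrow> ('v \<Rightarrow> 'v \<Rightarrow> ('v list \<Rightarrow> complex) set) \<Rightarrow>
   ('v list \<Rightarrow> complex) set \<Rightarrow> ('v list \<Rightarrow> complex) set" where
  "tensor2_map V b = tensor_lift (tensor_alg V)
     (\<lambda>w. if length w = 2 then b (w ! 0) (w ! 1) else \<zero>\<^bsub>tensor_alg V\<^esub>)"

definition flip ::
  "(complex, 'v, 'm) module_scheme \<Rightarrow> ('v list \<Rightarrow> complex) set \<Rightarrow> ('v list \<Rightarrow> complex) set" where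
  "flip V = tensor2_map V (\<lambda>y z. pure_tensor V [z, y])"

text \<open>\<open>\<Psi>(y \<otimes> z) = (g \<triangleright> z) \<otimes> y\<close> for homogeneous \<open>y\<close> of degree \<open>g\<close>, extended linearly in \<open>y\<close>.\<close>

definition yd_braiding ::
  "('g, 'a) monoid_scheme \<Rightarrow> (complex, 'v, 'm) module_scheme \<Rightarrow> ('g \<Rightarrow> 'v \<Rightarrow> 'v) \<Rightarrow> ('g \<Rightarrow> 'v set) \<Rightarrow>
   ('v list \<Rightarrow> complex) set \<Rightarrow> ('v list \<Rightarrow> complex) set" where
  "yd_braiding G V act gr = tensor2_map V (\<lambda>y z.
     \<Oplus>\<^bsub>tensor_alg V\<^esub>g\<in>support G V gr y. pure_tensor V [act g z, component G V gr y g])"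

text \<open>
  \<open>\<Psi>\<close> applied to two neighbouring tensor factors. Factors are counted from 0, so \<open>braid_at V \<Psi> i\<close>
  is \<open>\<Psi>\<^bsub>i+1,i+2\<^esub>\<close>.
\<close>

definition braid_at ::
  "(complex, 'v, 'm) module_scheme \<Rightarrow> (('v list \<Rightarrow> complex) set \<Rightarrow> ('v list \<Rightarrow> complex) set) \<Rightarrow> nat \<Rightarrow>
   ('v list \<Rightarrow> complex) set \<Rightarrow> ('v list \<Rightarrow> complex) set" where
  "braid_at V \<Psi> i = tensor_lift (tensor_alg V) (\<lambda>w.
     if Suc i < length w
     then pure_tensor V (take i w) \<otimes>\<^bsub>tensor_alg V\<^esub> \<Psi> (pure_tensor V [w ! i, w ! Suc i])
            \<otimes>\<^bsub>tensor_alg V\<^esub> pure_tensor V (drop (i + 2) w)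
     else \<zero>\<^bsub>tensor_alg V\<^esub>)"

definition expression_for :: "nat \<Rightarrow> (nat \<Rightarrow> nat) \<Rightarrow> nat list \<Rightarrow> bool" where
  "expression_for n \<sigma> is \<longleftrightarrow> (\<forall>i\<in>set is. Suc i < n) \<and>
     \<sigma> = foldr (\<lambda>i \<rho>. transpose i (Suc i) \<circ> \<rho>) is id"

definition reduced_expression :: "nat \<Rightarrow> (nat \<Rightarrow> nat) \<Rightarrow> nat list \<Rightarrow> bool" where
  "reduced_expression n \<sigma> is \<longleftrightarrow> expression_for n \<sigma> is \<and>
     (\<forall>js. expression_for n \<sigma> js \<longrightarrow> length is \<le> length js)"

text \<open>By Matsumoto's theorem the choice is immaterial when \<open>\<Psi>\<close> satisfies the braid equation.\<close>

definition braid_perm ::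
  "(complex, 'v, 'm) module_scheme \<Rightarrow> (('v list \<Rightarrow> complex) set \<Rightarrow> ('v list \<Rightarrow> complex) set) \<Rightarrow> nat \<Rightarrow>
   (nat \<Rightarrow> nat) \<Rightarrow> ('v list \<Rightarrow> complex) set \<Rightarrow> ('v list \<Rightarrow> complex) set" where
  "braid_perm V \<Psi> n \<sigma> =
     foldr (\<lambda>i F. braid_at V \<Psi> i \<circ> F) (SOME is. reduced_expression n \<sigma> is) id"

definition braided_factorial ::
  "(complex, 'v, 'm) module_scheme \<Rightarrow> (('v list \<Rightarrow> complex) set \<Rightarrow> ('v list \<Rightarrow> complex) set) \<Rightarrow> nat \<Rightarrow>
   ('v list \<Rightarrow> complex) set \<Rightarrow> ('v list \<Rightarrow> complex) set" where
  "braided_factorial V \<Psi> n U =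
     (\<Oplus>\<^bsub>tensor_alg V\<^esub>\<sigma>\<in>{\<sigma>. \<sigma> permutes {..<n}}. braid_perm V \<Psi> n \<sigma> U)"

definition factorial_kernel ::
  "(complex, 'v, 'm) module_scheme \<Rightarrow> (('v list \<Rightarrow> complex) set \<Rightarrow> ('v list \<Rightarrow> complex) set) \<Rightarrow> nat \<Rightarrow>
   ('v list \<Rightarrow> complex) set set" where
  "factorial_kernel V \<Psi> n =
     {U \<in> tensor_power V n. braided_factorial V \<Psi> n U = \<zero>\<^bsub>tensor_alg V\<^esub>}"

definition nichols_ideal ::
  "(complex, 'v, 'm) module_scheme \<Rightarrow> (('v list \<Rightarrow> complex) set \<Rightarrow> ('v list \<Rightarrow> complex) set) \<Rightarrow>
   ('v list \<Rightarrow> complex) set set" where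
  "nichols_ideal V \<Psi> =
     {\<Oplus>\<^bsub>tensor_alg V\<^esub>n\<in>{..N}. x n | N x. \<forall>n. x n \<in> factorial_kernel V \<Psi> n}"


section \<open>The braided Heisenberg double\<close>

text \<open>
  \<open>A \<rtimes> G\<close> is \<open>A \<otimes> \<complex>G\<close> with \<open>(a \<otimes> g)(b \<otimes> h) = a (g \<triangleright> b) \<otimes> gh\<close>; the element
  \<open>\<Sum>\<^sub>g x\<^sub>g \<otimes> g\<close> is the finitely supported function \<open>x\<close>, extended by zero outside \<open>carrier G\<close>.
\<close>

definition smash ::
  "('g, 'a) monoid_scheme \<Rightarrow> (complex, 'b, 'm) module_scheme \<Rightarrow> ('g \<Rightarrow> 'b \<Rightarrow> 'b) \<Rightarrow>
   (complex, 'g \<Rightarrow> 'b) module" where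
  "smash G A act = \<lparr>
     carrier = {x. (\<forall>g\<in>carrier G. x g \<in> carrier A) \<and> (\<forall>g. g \<notin> carrier G \<longrightarrow> x g = \<zero>\<^bsub>A\<^esub>) \<and>
                   finite {g. x g \<noteq> \<zero>\<^bsub>A\<^esub>}},
     monoid.mult = (\<lambda>x y k. if k \<in> carrier G
               then \<Oplus>\<^bsub>A\<^esub>g\<in>{g. x g \<noteq> \<zero>\<^bsub>A\<^esub>}. x g \<otimes>\<^bsub>A\<^esub> act g (y (inv\<^bsub>G\<^esub> g \<otimes>\<^bsub>G\<^esub> k))
               else \<zero>\<^bsub>A\<^esub>),
     one = (\<lambda>g. if g = \<one>\<^bsub>G\<^esub> then \<one>\<^bsub>A\<^esub> else \<zero>\<^bsub>A\<^esub>),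
     zero = (\<lambda>_. \<zero>\<^bsub>A\<^esub>),
     add = (\<lambda>x y g. x g \<oplus>\<^bsub>A\<^esub> y g),
     module.smult = (\<lambda>c x g. c \<odot>\<^bsub>A\<^esub> x g) \<rparr>"

definition smash_alg ::
  "('g, 'a) monoid_scheme \<Rightarrow> (complex, 'b, 'm) module_scheme \<Rightarrow> 'b \<Rightarrow> 'g \<Rightarrow> 'b" where
  "smash_alg G A a = (\<lambda>g. if g = \<one>\<^bsub>G\<^esub> then a else \<zero>\<^bsub>A\<^esub>)"

definition smash_grp :: "(complex, 'b, 'm) module_scheme \<Rightarrow> 'g \<Rightarrow> 'g \<Rightarrow> 'b" where
  "smash_grp A g = (\<lambda>h. if h = g then \<one>\<^bsub>A\<^esub> else \<zero>\<^bsub>A\<^esub>)"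

type_synonym ('v, 'g) heis_pre =
  "'g \<Rightarrow> (('v \<times> ('v \<Rightarrow> complex)) list \<Rightarrow> complex) set"

definition double_space ::
  "(complex, 'v, 'm) module_scheme \<Rightarrow> (complex, 'v \<times> ('v \<Rightarrow> complex)) module" where
  "double_space Y = direct_sum Y (dual Y)"

definition double_act ::
  "('g, 'a) monoid_scheme \<Rightarrow> (complex, 'v, 'm) module_scheme \<Rightarrow> ('g \<Rightarrow> 'v \<Rightarrow> 'v) \<Rightarrow>
   'g \<Rightarrow> 'v \<times> ('v \<Rightarrow> complex) \<Rightarrow> 'v \<times> ('v \<Rightarrow> complex)" where
  "double_act G Y act g = (\<lambda>(v, f). (act g v, dual_act G Y act g f))"

text \<open>\<open>T(Y \<oplus> Y\<^sup>*) \<rtimes> G\<close>, with the images of \<open>T(Y \<oplus> Y\<^sup>*)\<close>, \<open>Y\<close>, \<open>Y\<^sup>*\<close> and \<open>G\<close> in it\<close>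

definition heis_free ::
  "('g, 'a) monoid_scheme \<Rightarrow> (complex, 'v, 'm) module_scheme \<Rightarrow> ('g \<Rightarrow> 'v \<Rightarrow> 'v) \<Rightarrow>
   (complex, ('v, 'g) heis_pre) module" where
  "heis_free G Y act = smash G (tensor_alg (double_space Y))
     (\<lambda>g. tensor_map (double_space Y) (double_act G Y act g))"

definition pre_tensor ::
  "('g, 'a) monoid_scheme \<Rightarrow> (complex, 'v, 'm) module_scheme \<Rightarrow>
   (('v \<times> ('v \<Rightarrow> complex)) list \<Rightarrow> complex) set \<Rightarrow> ('v, 'g) heis_pre" where
  "pre_tensor G Y = smash_alg G (tensor_alg (double_space Y))"

definition in_vec :: "(complex, 'v, 'm) module_scheme \<Rightarrow> 'v \<Rightarrow> 'v \<times> ('v \<Rightarrow> complex)" where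
  "in_vec Y v = (v, \<zero>\<^bsub>dual Y\<^esub>)"

definition in_cov :: "(complex, 'v, 'm) module_scheme \<Rightarrow> ('v \<Rightarrow> complex) \<Rightarrow> 'v \<times> ('v \<Rightarrow> complex)" where
  "in_cov Y f = (\<zero>\<^bsub>Y\<^esub>, f)"

definition pre_vec ::
  "('g, 'a) monoid_scheme \<Rightarrow> (complex, 'v, 'm) module_scheme \<Rightarrow> 'v \<Rightarrow> ('v, 'g) heis_pre" where
  "pre_vec G Y v = pre_tensor G Y (pure_tensor (double_space Y) [in_vec Y v])"

definition pre_cov ::
  "('g, 'a) monoid_scheme \<Rightarrow> (complex, 'v, 'm) module_scheme \<Rightarrow> ('v \<Rightarrow> complex) \<Rightarrow> ('v, 'g) heis_pre" where
  "pre_cov G Y f = pre_tensor G Y (pure_tensor (double_space Y) [in_cov Y f])"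

definition pre_grp :: "(complex, 'v, 'm) module_scheme \<Rightarrow> 'g \<Rightarrow> ('v, 'g) heis_pre" where
  "pre_grp Y g = smash_grp (tensor_alg (double_space Y)) g"

text \<open>
  The generators of the defining ideal. In the last family \<open>\<langle>f, v\<^sup>(\<^sup>0\<^sup>)\<rangle> v\<^sup>(\<^sup>1\<^sup>)\<close> is
  \<open>\<Sum>\<^sub>g \<langle>f, v\<^sub>g\<rangle> g\<close>, where \<open>v\<^sub>g\<close> are the homogeneous components of \<open>v\<close>.
\<close>

definition heis_relations ::
  "('g, 'a) monoid_scheme \<Rightarrow> (complex, 'v, 'm) module_scheme \<Rightarrow> ('g \<Rightarrow> 'v \<Rightarrow> 'v) \<Rightarrow> ('g \<Rightarrow> 'v set) \<Rightarrow>
   ('v, 'g) heis_pre set" where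
  "heis_relations G Y act gr = (let
       S = heis_free G Y act;
       V = double_space Y;
       \<Psi> = yd_braiding G Y act gr;
       \<Psi>' = yd_braiding G (dual Y) (dual_act G Y act) (dual_grading G Y gr);
       \<tau> = flip (dual Y)
     in
       (\<lambda>U. pre_tensor G Y (tensor_map V (in_vec Y) U)) ` nichols_ideal Y \<Psi> \<union>
       (\<lambda>U. pre_tensor G Y (tensor_map V (in_cov Y) U)) ` nichols_ideal (dual Y) (\<tau> \<circ> \<Psi>' \<circ> \<tau>) \<union>
       {(pre_cov G Y f \<otimes>\<^bsub>S\<^esub> pre_vec G Y v \<ominus>\<^bsub>S\<^esub> pre_vec G Y v \<otimes>\<^bsub>S\<^esub> pre_cov G Y f)
          \<ominus>\<^bsub>S\<^esub> (\<Oplus>\<^bsub>S\<^esub>g\<in>support G Y gr v. f (component G Y gr v g) \<odot>\<^bsub>S\<^esub> pre_grp Y g)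
        | f v. f \<in> carrier (dual Y) \<and> v \<in> carrier Y})"

definition heis_ideal ::
  "('g, 'a) monoid_scheme \<Rightarrow> (complex, 'v, 'm) module_scheme \<Rightarrow> ('g \<Rightarrow> 'v \<Rightarrow> 'v) \<Rightarrow> ('g \<Rightarrow> 'v set) \<Rightarrow>
   ('v, 'g) heis_pre set" where
  "heis_ideal G Y act gr = Idl\<^bsub>heis_free G Y act\<^esub> (heis_relations G Y act gr)"

definition heisenberg_double ::
  "('g, 'a) monoid_scheme \<Rightarrow> (complex, 'v, 'm) module_scheme \<Rightarrow> ('g \<Rightarrow> 'v \<Rightarrow> 'v) \<Rightarrow> ('g \<Rightarrow> 'v set) \<Rightarrow>
   (complex, ('v, 'g) heis_pre set) module" where
  "heisenberg_double G Y act gr = quot_alg (heis_free G Y act) (heis_ideal G Y act gr)"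

definition heis_class ::
  "('g, 'a) monoid_scheme \<Rightarrow> (complex, 'v, 'm) module_scheme \<Rightarrow> ('g \<Rightarrow> 'v \<Rightarrow> 'v) \<Rightarrow> ('g \<Rightarrow> 'v set) \<Rightarrow>
   ('v, 'g) heis_pre \<Rightarrow> ('v, 'g) heis_pre set" where
  "heis_class G Y act gr x = heis_ideal G Y act gr +>\<^bsub>heis_free G Y act\<^esub> x"

definition heis_vec ::
  "('g, 'a) monoid_scheme \<Rightarrow> (complex, 'v, 'm) module_scheme \<Rightarrow> ('g \<Rightarrow> 'v \<Rightarrow> 'v) \<Rightarrow> ('g \<Rightarrow> 'v set) \<Rightarrow>
   'v \<Rightarrow> ('v, 'g) heis_pre set" where
  "heis_vec G Y act gr v = heis_class G Y act gr (pre_vec G Y v)"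

definition heis_cov ::
  "('g, 'a) monoid_scheme \<Rightarrow> (complex, 'v, 'm) module_scheme \<Rightarrow> ('g \<Rightarrow> 'v \<Rightarrow> 'v) \<Rightarrow> ('g \<Rightarrow> 'v set) \<Rightarrow>
   ('v \<Rightarrow> complex) \<Rightarrow> ('v, 'g) heis_pre set" where
  "heis_cov G Y act gr f = heis_class G Y act gr (pre_cov G Y f)"

definition heis_grp ::
  "('g, 'a) monoid_scheme \<Rightarrow> (complex, 'v, 'm) module_scheme \<Rightarrow> ('g \<Rightarrow> 'v \<Rightarrow> 'v) \<Rightarrow> ('g \<Rightarrow> 'v set) \<Rightarrow>
   'g \<Rightarrow> ('v, 'g) heis_pre set" where
  "heis_grp G Y act gr g = heis_class G Y act gr (pre_grp Y g)"

definition heis_conj ::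
  "('g, 'a) monoid_scheme \<Rightarrow> (complex, 'v, 'm) module_scheme \<Rightarrow> ('g \<Rightarrow> 'v \<Rightarrow> 'v) \<Rightarrow> ('g \<Rightarrow> 'v set) \<Rightarrow>
   'g \<Rightarrow> ('v, 'g) heis_pre set \<Rightarrow> ('v, 'g) heis_pre set" where
  "heis_conj G Y act gr g x = (let H = heisenberg_double G Y act gr in
     heis_grp G Y act gr g \<otimes>\<^bsub>H\<^esub> x \<otimes>\<^bsub>H\<^esub> heis_grp G Y act gr (inv\<^bsub>G\<^esub> g))"

text \<open>An algebra grading with \<open>deg g = g\<close> on \<open>G\<close>, \<open>deg v = g\<close> on \<open>Y\<^sub>g\<close> and \<open>deg f = 1\<close> on \<open>Y\<^sup>*\<close>.\<close>

definition heis_grading ::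
  "('g, 'a) monoid_scheme \<Rightarrow> (complex, 'v, 'm) module_scheme \<Rightarrow> ('g \<Rightarrow> 'v \<Rightarrow> 'v) \<Rightarrow> ('g \<Rightarrow> 'v set) \<Rightarrow>
   ('g \<Rightarrow> ('v, 'g) heis_pre set set) \<Rightarrow> bool" where
  "heis_grading G Y act gr D \<longleftrightarrow>
     algebra_grading G (heisenberg_double G Y act gr) D \<and>
     (\<forall>g\<in>carrier G. heis_grp G Y act gr g \<in> D g) \<and>
     (\<forall>g\<in>carrier G. \<forall>v\<in>gr g. heis_vec G Y act gr v \<in> D g) \<and>
     (\<forall>f\<in>carrier (dual Y). heis_cov G Y act gr f \<in> D \<one>\<^bsub>G\<^esub>)"

end

theory Submission
  imports Defs
begin

text \<open>
  The elements of \<open>G\<close> are invertible in the double \<open>H\<close>, so \<open>G\<close> acts on \<open>H\<close> by inner automorphisms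
  (\<open>G_algebra_conjugation\<close>). In an algebra grading in which \<open>g\<close> has degree \<open>g\<close>, the element
  \<open>g x g\<^sup>-\<^sup>1\<close> has degree \<open>g h g\<^sup>-\<^sup>1\<close> whenever \<open>x\<close> has degree \<open>h\<close>. Every grading of the required kind is
  therefore compatible with the action (\<open>yd_algebra_heis_grading\<close>), and the substance of the theorem
  is that such a grading exists: the relations of \<open>H\<close> are homogeneous.

  A \<open>G\<close>-grading of an algebra \<open>A\<close> is the same as a suitable homomorphism \<open>\<delta> : A \<rightarrow> A \<otimes> \<complex>G\<close>, where
  \<open>x\<close> has degree \<open>g\<close> if \<open>\<delta> x = x \<otimes> g\<close> (\<open>algebra_grading_degree_part\<close>). Homomorphisms out of \<open>H\<close> come
  from the universal properties of the tensor algebra (\<open>alg_hom_extension\<close>), of the smash product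
  (\<open>alg_hom_smash_ext\<close>) and of the quotient (\<open>alg_hom_some_rep\<close>). The coaction on \<open>H\<close> is the one with
  \<open>v \<mapsto> \<Sum>\<^sub>g v\<^sub>g \<otimes> g\<close>, \<open>f \<mapsto> f \<otimes> 1\<close> and \<open>g \<mapsto> g \<otimes> g\<close>. It exists for the following reasons.

  \<^item> If \<open>v\<close> has degree \<open>h\<close>, both sides of \<open>g v = (g \<triangleright> v) g\<close> have degree \<open>g h\<close>
    (\<open>grp_coaction_commute\<close>).
  \<^item> The braiding \<open>y \<otimes> z \<mapsto> (h \<triangleright> z) \<otimes> y\<close> turns the degrees \<open>h, k\<close> into \<open>h k h\<^sup>-\<^sup>1, h\<close> and keeps their
    product (\<open>graded_map_braid_at\<close>). The braided factorials therefore preserve the degree of a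
    tensor, and the homogeneous components of an element of \<open>I\<^sub>\<Psi>\<close> are again in \<open>I\<^sub>\<Psi>\<close>
    (\<open>nichols_ideal_part\<close>, \<open>free_coaction_nichols\<close>).
  \<^item> The relations between elements of \<open>Y\<^sup>*\<close> have degree 1 (\<open>free_coaction_nichols_dual\<close>).
  \<^item> If \<open>v\<close> has degree \<open>h\<close>, all terms of \<open>f v - v f - \<langle>f, v\<rangle> h\<close> have degree \<open>h\<close>
    (\<open>free_coaction_commutator\<close>).
\<close>


section \<open>Complex vector spaces and algebras\<close>

lemma CC_simps [simp]:
  "carrier CC = UNIV" "\<zero>\<^bsub>CC\<^esub> = 0" "\<one>\<^bsub>CC\<^esub> = 1" "x \<oplus>\<^bsub>CC\<^esub> y = x + y" "x \<otimes>\<^bsub>CC\<^esub> y = x * y"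
  by (simp_all add: ring_of_type_algebra_def)

locale cspace =
  fixes V :: "(complex, 'v, 'm) module_scheme" (structure)
  assumes is_module: "module CC V"

sublocale cspace \<subseteq> abelian_group V
  using is_module by (simp add: module_def)

context cspace
begin

lemma smult_closed [simp, intro]: "x \<in> carrier V \<Longrightarrow> c \<odot> x \<in> carrier V"
  using module.smult_closed[OF is_module, of c x] by simp

lemma smult_plus_left: "x \<in> carrier V \<Longrightarrow> (a + b) \<odot> x = a \<odot> x \<oplus> b \<odot> x"
  using module.smult_l_distr[OF is_module, of a b x] by simp

lemma smult_plus_right:
  "x \<in> carrier V \<Longrightarrow> y \<in> carrier V \<Longrightarrow> c \<odot> (x \<oplus> y) = c \<odot> x \<oplus> c \<odot> y"
  using module.smult_r_distr[OF is_module, of c x y] by simp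

lemma smult_smult: "x \<in> carrier V \<Longrightarrow> a \<odot> (b \<odot> x) = (a * b) \<odot> x"
  using module.smult_assoc1[OF is_module, of a b x] by simp

lemma one_smult [simp]: "x \<in> carrier V \<Longrightarrow> 1 \<odot> x = x"
  using module.smult_one[OF is_module, of x] by simp

lemma zero_smult [simp]: "x \<in> carrier V \<Longrightarrow> 0 \<odot> x = \<zero>"
  using module.smult_l_null[OF is_module, of x] by simp

lemma smult_zero [simp]: "c \<odot> \<zero> = \<zero>"
  using module.smult_r_null[OF is_module, of c] by simp

lemma a_inv_smult: 
  assumes "x \<in> carrier V" shows "\<ominus> x = (- 1) \<odot> x"
proof -
  have "(- 1) \<odot> x \<oplus> x = (- 1 + 1) \<odot> x"
    using assms smult_plus_left[of x "- 1" 1] by simp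
  then show ?thesis using assms by (simp add: minus_equality)
qed

lemma smult_finsum:
  assumes "finite B" "f \<in> B \<rightarrow> carrier V"
  shows "c \<odot> (\<Oplus>i\<in>B. f i) = (\<Oplus>i\<in>B. c \<odot> f i)"
  using module.finsum_smult_ldistr[OF is_module, of B c f] assms by simp

lemma submodule_memI:
  assumes "H \<subseteq> carrier V" "\<zero> \<in> H" "\<And>x y. x \<in> H \<Longrightarrow> y \<in> H \<Longrightarrow> x \<oplus> y \<in> H"
    "\<And>c x. x \<in> H \<Longrightarrow> c \<odot> x \<in> H"
  shows "submodule H CC V"
proof (rule module.submoduleI[OF is_module])
  fix x assume "x \<in> H" then show "\<ominus> x \<in> H"
    using assms a_inv_smult[of x] by (metis subsetD)
qed (use assms in auto)

end

text \<open>Additive inverses are scalar multiples by \<open>-1\<close>, so they need not be supplied.\<close>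

lemma cspaceI:
  fixes V (structure)
  assumes "\<And>x y. x \<in> carrier V \<Longrightarrow> y \<in> carrier V \<Longrightarrow> x \<oplus> y \<in> carrier V" "\<zero> \<in> carrier V"
    and "\<And>c x. x \<in> carrier V \<Longrightarrow> c \<odot> x \<in> carrier V"
    and "\<And>x y z. x \<in> carrier V \<Longrightarrow> y \<in> carrier V \<Longrightarrow> z \<in> carrier V \<Longrightarrow> x \<oplus> y \<oplus> z = x \<oplus> (y \<oplus> z)"
    and "\<And>x y. x \<in> carrier V \<Longrightarrow> y \<in> carrier V \<Longrightarrow> x \<oplus> y = y \<oplus> x"
    and "\<And>x. x \<in> carrier V \<Longrightarrow> \<zero> \<oplus> x = x"
    and "\<And>a b x. x \<in> carrier V \<Longrightarrow> (a + b) \<odot> x = a \<odot> x \<oplus> b \<odot> x"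
    and "\<And>c x y. x \<in> carrier V \<Longrightarrow> y \<in> carrier V \<Longrightarrow> c \<odot> (x \<oplus> y) = c \<odot> x \<oplus> c \<odot> y"
    and "\<And>a b x. x \<in> carrier V \<Longrightarrow> (a * b) \<odot> x = a \<odot> (b \<odot> x)"
    and "\<And>x. x \<in> carrier V \<Longrightarrow> 1 \<odot> x = x"
    and "\<And>x. x \<in> carrier V \<Longrightarrow> 0 \<odot> x = \<zero>"
  shows "cspace V"
proof -
  have "abelian_group V"
  proof (rule abelian_groupI)
    fix x assume x: "x \<in> carrier V"
    have "(- 1) \<odot> x \<oplus> x = (- 1 + 1) \<odot> x" using assms(7)[of x "- 1" 1] assms(10) x by simp
    then show "\<exists>y\<in>carrier V. y \<oplus> x = \<zero>" using assms x by (intro bexI[of _ "(- 1) \<odot> x"]) auto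
  qed (use assms in auto)
  then have "module CC V"
    by (intro moduleI) (use assms cring_from_type_algebra in auto)
  then show ?thesis by (rule cspace.intro)
qed

locale calgebra =
  fixes A :: "(complex, 'b, 'm) module_scheme" (structure)
  assumes is_complex_algebra: "complex_algebra A"

sublocale calgebra \<subseteq> cspace A
  using is_complex_algebra by (intro cspace.intro) (simp add: complex_algebra_def)

sublocale calgebra \<subseteq> ring A
  using is_complex_algebra by (simp add: complex_algebra_def)

context calgebra
begin

lemma smult_mult [simp]:
  "x \<in> carrier A \<Longrightarrow> y \<in> carrier A \<Longrightarrow> (c \<odot> x) \<otimes> y = c \<odot> (x \<otimes> y)"
  and mult_smult [simp]:
  "x \<in> carrier A \<Longrightarrow> y \<in> carrier A \<Longrightarrow> x \<otimes> (c \<odot> y) = c \<odot> (x \<otimes> y)"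
  using is_complex_algebra by (auto simp: complex_algebra_def)

end

lemma calgebraI:
  fixes A (structure)
  assumes "cspace A"
    and "\<And>x y. x \<in> carrier A \<Longrightarrow> y \<in> carrier A \<Longrightarrow> x \<otimes> y \<in> carrier A" "\<one> \<in> carrier A"
    and "\<And>x y z. x \<in> carrier A \<Longrightarrow> y \<in> carrier A \<Longrightarrow> z \<in> carrier A \<Longrightarrow> x \<otimes> y \<otimes> z = x \<otimes> (y \<otimes> z)"
    and "\<And>x. x \<in> carrier A \<Longrightarrow> \<one> \<otimes> x = x" "\<And>x. x \<in> carrier A \<Longrightarrow> x \<otimes> \<one> = x"
    and "\<And>x y z. x \<in> carrier A \<Longrightarrow> y \<in> carrier A \<Longrightarrow> z \<in> carrier A \<Longrightarrow>
      (x \<oplus> y) \<otimes> z = x \<otimes> z \<oplus> y \<otimes> z"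
    and "\<And>x y z. x \<in> carrier A \<Longrightarrow> y \<in> carrier A \<Longrightarrow> z \<in> carrier A \<Longrightarrow>
      z \<otimes> (x \<oplus> y) = z \<otimes> x \<oplus> z \<otimes> y"
    and "\<And>c x y. x \<in> carrier A \<Longrightarrow> y \<in> carrier A \<Longrightarrow> (c \<odot> x) \<otimes> y = c \<odot> (x \<otimes> y)"
    and "\<And>c x y. x \<in> carrier A \<Longrightarrow> y \<in> carrier A \<Longrightarrow> x \<otimes> (c \<odot> y) = c \<odot> (x \<otimes> y)"
  shows "calgebra A"
proof
  interpret cspace A by fact
  have "ring A"
    by (intro ringI monoidI abelian_group_axioms) (use assms in auto)
  then show "complex_algebra A"
    using assms is_module by (auto simp: complex_algebra_def)
qed


subsection \<open>Linear maps and algebra homomorphisms\<close>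

lemma clinearI:
  assumes "\<And>x. x \<in> carrier V \<Longrightarrow> f x \<in> carrier W"
    and "\<And>x y. x \<in> carrier V \<Longrightarrow> y \<in> carrier V \<Longrightarrow> f (x \<oplus>\<^bsub>V\<^esub> y) = f x \<oplus>\<^bsub>W\<^esub> f y"
    and "\<And>c x. x \<in> carrier V \<Longrightarrow> f (c \<odot>\<^bsub>V\<^esub> x) = c \<odot>\<^bsub>W\<^esub> f x"
  shows "clinear V W f"
  using assms by (auto simp: clinear_def)

lemma clinearD:
  assumes "clinear V W f"
  shows "x \<in> carrier V \<Longrightarrow> f x \<in> carrier W"
    and "x \<in> carrier V \<Longrightarrow> y \<in> carrier V \<Longrightarrow> f (x \<oplus>\<^bsub>V\<^esub> y) = f x \<oplus>\<^bsub>W\<^esub> f y"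
    and "x \<in> carrier V \<Longrightarrow> f (c \<odot>\<^bsub>V\<^esub> x) = c \<odot>\<^bsub>W\<^esub> f x"
  using assms by (auto simp: clinear_def)

lemma clinear_zero:
  assumes "cspace V" "cspace W" "clinear V W f"
  shows "f \<zero>\<^bsub>V\<^esub> = \<zero>\<^bsub>W\<^esub>"
proof -
  interpret V: cspace V by fact
  interpret W: cspace W by fact
  have "f (0 \<odot>\<^bsub>V\<^esub> \<zero>\<^bsub>V\<^esub>) = 0 \<odot>\<^bsub>W\<^esub> f \<zero>\<^bsub>V\<^esub>" using clinearD(3)[OF assms(3)] by blast
  then show ?thesis using clinearD(1)[OF assms(3)] by simp
qed

lemma clinear_minus:
  assumes "cspace V" "cspace W" "clinear V W f" "x \<in> carrier V" "y \<in> carrier V"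
  shows "f (x \<ominus>\<^bsub>V\<^esub> y) = f x \<ominus>\<^bsub>W\<^esub> f y"
proof -
  interpret V: cspace V by fact
  interpret W: cspace W by fact
  show ?thesis using assms(4,5) clinearD[OF assms(3)]
    by (simp add: a_minus_def V.a_inv_smult W.a_inv_smult)
qed

lemma clinear_finsum:
  assumes "cspace V" "cspace W" "clinear V W f" "h \<in> B \<rightarrow> carrier V"
  shows "f (\<Oplus>\<^bsub>V\<^esub>i\<in>B. h i) = (\<Oplus>\<^bsub>W\<^esub>i\<in>B. f (h i))"
proof -
  interpret V: cspace V by fact
  interpret W: cspace W by fact
  show ?thesis using assms(4)
  proof (induction B rule: infinite_finite_induct)
    case (insert i B)
    then have "h \<in> B \<rightarrow> carrier V" "h i \<in> carrier V" by auto
    with insert show ?case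
      using clinearD[OF assms(3)] by (simp add: V.finsum_closed Pi_iff)
  qed (simp_all add: clinear_zero[OF assms(1-3)])
qed

lemma clinear_comp:
  "clinear U V f \<Longrightarrow> clinear V W g \<Longrightarrow> clinear U W (\<lambda>x. g (f x))"
  by (auto simp: clinear_def Pi_iff)

lemma clinear_sum_of:
  assumes "cspace W" "\<And>i. i \<in> B \<Longrightarrow> clinear V W (f i)" "finite B"
  shows "clinear V W (\<lambda>x. \<Oplus>\<^bsub>W\<^esub>i\<in>B. f i x)"
proof -
  interpret W: cspace W by fact
  show ?thesis
  proof (rule clinearI)
    fix x assume x: "x \<in> carrier V"
    then show "(\<Oplus>\<^bsub>W\<^esub>i\<in>B. f i x) \<in> carrier W"
      using assms(2) by (auto intro!: W.finsum_closed dest: clinearD(1))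
    show "(\<Oplus>\<^bsub>W\<^esub>i\<in>B. f i (c \<odot>\<^bsub>V\<^esub> x)) = c \<odot>\<^bsub>W\<^esub> (\<Oplus>\<^bsub>W\<^esub>i\<in>B. f i x)" for c
      using assms(2,3) x
      by (subst W.smult_finsum) (auto intro!: W.finsum_cong' dest: clinearD)
    fix y assume y: "y \<in> carrier V"
    have "(\<Oplus>\<^bsub>W\<^esub>i\<in>B. f i (x \<oplus>\<^bsub>V\<^esub> y)) = (\<Oplus>\<^bsub>W\<^esub>i\<in>B. f i x \<oplus>\<^bsub>W\<^esub> f i y)"
      using x y assms(2) by (intro W.finsum_cong') (auto dest: clinearD)
    then show "(\<Oplus>\<^bsub>W\<^esub>i\<in>B. f i (x \<oplus>\<^bsub>V\<^esub> y)) = (\<Oplus>\<^bsub>W\<^esub>i\<in>B. f i x) \<oplus>\<^bsub>W\<^esub> (\<Oplus>\<^bsub>W\<^esub>i\<in>B. f i y)"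
      using x y assms(2) by (subst (asm) W.finsum_addf) (auto dest: clinearD)
  qed
qed

definition alg_hom ::
  "(complex, 'b, 'm) module_scheme \<Rightarrow> (complex, 'c, 'n) module_scheme \<Rightarrow> ('b \<Rightarrow> 'c) \<Rightarrow> bool" where
  "alg_hom A B f \<longleftrightarrow> clinear A B f \<and> f \<one>\<^bsub>A\<^esub> = \<one>\<^bsub>B\<^esub> \<and>
     (\<forall>x\<in>carrier A. \<forall>y\<in>carrier A. f (x \<otimes>\<^bsub>A\<^esub> y) = f x \<otimes>\<^bsub>B\<^esub> f y)"

lemma alg_homI:
  assumes "clinear A B f" "f \<one>\<^bsub>A\<^esub> = \<one>\<^bsub>B\<^esub>"
    "\<And>x y. x \<in> carrier A \<Longrightarrow> y \<in> carrier A \<Longrightarrow> f (x \<otimes>\<^bsub>A\<^esub> y) = f x \<otimes>\<^bsub>B\<^esub> f y"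
  shows "alg_hom A B f"
  using assms by (auto simp: alg_hom_def)

lemma alg_homD:
  assumes "alg_hom A B f"
  shows "clinear A B f" "x \<in> carrier A \<Longrightarrow> f x \<in> carrier B"
    "x \<in> carrier A \<Longrightarrow> y \<in> carrier A \<Longrightarrow> f (x \<oplus>\<^bsub>A\<^esub> y) = f x \<oplus>\<^bsub>B\<^esub> f y"
    "x \<in> carrier A \<Longrightarrow> f (c \<odot>\<^bsub>A\<^esub> x) = c \<odot>\<^bsub>B\<^esub> f x"
    "f \<one>\<^bsub>A\<^esub> = \<one>\<^bsub>B\<^esub>"
    "x \<in> carrier A \<Longrightarrow> y \<in> carrier A \<Longrightarrow> f (x \<otimes>\<^bsub>A\<^esub> y) = f x \<otimes>\<^bsub>B\<^esub> f y"
  using assms by (auto simp: alg_hom_def clinear_def)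

lemma alg_hom_comp:
  assumes "alg_hom A B f" "alg_hom B C g"
  shows "alg_hom A C (\<lambda>x. g (f x))"
  using assms by (auto simp: alg_hom_def clinear_def Pi_iff)

lemma alg_hom_zero:
  "calgebra A \<Longrightarrow> calgebra B \<Longrightarrow> alg_hom A B f \<Longrightarrow> f \<zero>\<^bsub>A\<^esub> = \<zero>\<^bsub>B\<^esub>"
  by (rule clinear_zero) (auto simp: calgebra_def cspace_def complex_algebra_def alg_hom_def)


subsection \<open>Sums over supports\<close>

context abelian_group
begin

lemma finsum_extend:
  assumes "finite B" "B' \<subseteq> B" "\<And>i. i \<in> B - B' \<Longrightarrow> f i = \<zero>" "f \<in> B \<rightarrow> carrier G"
  shows "finsum G f B' = finsum G f B"
  using assms by (intro add.finprod_mono_neutral_cong_left) auto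

text \<open>
  Sums over the supports of \<open>x\<close> and \<open>y\<close> add up although the three supports differ. The value
  \<open>z\<close> is the zero of the space in which \<open>x\<close> and \<open>y\<close> take their values, which need not be the
  space in which the sum is taken.
\<close>

lemma finsum_support_add:
  assumes fin: "finite {i. x i \<noteq> z}" "finite {i. y i \<noteq> z}"
    and sub: "{i. s i \<noteq> z} \<subseteq> {i. x i \<noteq> z} \<union> {i. y i \<noteq> z}"
    and z: "\<And>i. i \<in> {i. x i \<noteq> z} \<union> {i. y i \<noteq> z} \<Longrightarrow> l i z = \<zero>"
    and x: "\<And>i. i \<in> {i. x i \<noteq> z} \<union> {i. y i \<noteq> z} \<Longrightarrow> l i (x i) \<in> carrier G"
    and y: "\<And>i. i \<in> {i. x i \<noteq> z} \<union> {i. y i \<noteq> z} \<Longrightarrow> l i (y i) \<in> carrier G"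
    and s: "\<And>i. i \<in> {i. x i \<noteq> z} \<union> {i. y i \<noteq> z} \<Longrightarrow> l i (s i) = l i (x i) \<oplus> l i (y i)"
  shows "(\<Oplus>i\<in>{i. s i \<noteq> z}. l i (s i)) =
    (\<Oplus>i\<in>{i. x i \<noteq> z}. l i (x i)) \<oplus> (\<Oplus>i\<in>{i. y i \<noteq> z}. l i (y i))"
proof -
  let ?B = "{i. x i \<noteq> z} \<union> {i. y i \<noteq> z}"
  have "(\<Oplus>i\<in>{i. s i \<noteq> z}. l i (s i)) = (\<Oplus>i\<in>?B. l i (s i))"
    by (rule finsum_extend) (use fin sub z x y s in auto)
  also have "\<dots> = (\<Oplus>i\<in>?B. l i (x i) \<oplus> l i (y i))"
    by (rule finsum_cong') (use x y s in auto)
  also have "\<dots> = (\<Oplus>i\<in>?B. l i (x i)) \<oplus> (\<Oplus>i\<in>?B. l i (y i))"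
    by (rule finsum_addf) (use x y in auto)
  also have "(\<Oplus>i\<in>?B. l i (x i)) = (\<Oplus>i\<in>{i. x i \<noteq> z}. l i (x i))"
    by (rule finsum_extend[symmetric]) (use fin x z in auto)
  also have "(\<Oplus>i\<in>?B. l i (y i)) = (\<Oplus>i\<in>{i. y i \<noteq> z}. l i (y i))"
    by (rule finsum_extend[symmetric]) (use fin y z in auto)
  finally show ?thesis .
qed

lemma finsum_support_single:
  assumes "{i. x i \<noteq> z} \<subseteq> {j}" "l j z = \<zero>" "l j (x j) \<in> carrier G"
  shows "(\<Oplus>i\<in>{i. x i \<noteq> z}. l i (x i)) = l j (x j)"
proof -
  have "(\<Oplus>i\<in>{i. x i \<noteq> z}. l i (x i)) = (\<Oplus>i\<in>{j}. l i (x i))"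
    by (rule finsum_extend) (use assms in auto)
  then show ?thesis using assms by simp
qed

end


lemma (in cspace) finsum_support_smult:
  assumes fin: "finite {i. x i \<noteq> z}" and sub: "{i. s i \<noteq> z} \<subseteq> {i. x i \<noteq> z}"
    and z: "\<And>i. i \<in> {i. x i \<noteq> z} \<Longrightarrow> l i z = \<zero>"
    and x: "\<And>i. i \<in> {i. x i \<noteq> z} \<Longrightarrow> l i (x i) \<in> carrier V"
    and s: "\<And>i. i \<in> {i. x i \<noteq> z} \<Longrightarrow> l i (s i) = c \<odot> l i (x i)"
  shows "(\<Oplus>i\<in>{i. s i \<noteq> z}. l i (s i)) = c \<odot> (\<Oplus>i\<in>{i. x i \<noteq> z}. l i (x i))"
proof -
  have "(\<Oplus>i\<in>{i. s i \<noteq> z}. l i (s i)) = (\<Oplus>i\<in>{i. x i \<noteq> z}. l i (s i))"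
    by (rule finsum_extend) (use fin sub z x s in auto)
  also have "\<dots> = (\<Oplus>i\<in>{i. x i \<noteq> z}. c \<odot> l i (x i))"
    by (rule finsum_cong') (use x s in auto)
  also have "\<dots> = c \<odot> (\<Oplus>i\<in>{i. x i \<noteq> z}. l i (x i))"
    by (rule smult_finsum[symmetric]) (use fin x in auto)
  finally show ?thesis .
qed


subsection \<open>Sums of elements of a set\<close>

text \<open>
  For a set that is closed under scalar multiplication, such as the homogeneous elements of a graded
  space, this is the linear span.
\<close>

inductive_set add_closure :: "('a, 'm) ring_scheme \<Rightarrow> 'a set \<Rightarrow> 'a set" for A and S where
  zero: "\<zero>\<^bsub>A\<^esub> \<in> add_closure A S"
| add: "x \<in> S \<Longrightarrow> s \<in> add_closure A S \<Longrightarrow> x \<oplus>\<^bsub>A\<^esub> s \<in> add_closure A S"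

context abelian_group
begin

lemma add_closure_carrier:
  assumes "S \<subseteq> carrier G" "s \<in> add_closure G S" shows "s \<in> carrier G"
  using assms(2,1) by induction auto

lemma add_closure_base:
  assumes "S \<subseteq> carrier G" "x \<in> S" shows "x \<in> add_closure G S"
  using add_closure.add[OF assms(2) add_closure.zero[of G]] assms by (simp add: subsetD)

lemma add_closure_plus:
  assumes S: "S \<subseteq> carrier G" and s: "s \<in> add_closure G S" and t: "t \<in> add_closure G S"
  shows "s \<oplus> t \<in> add_closure G S"
  using s
proof induction
  case zero
  then show ?case using t add_closure_carrier[OF S t] by simp
next
  case (add x s)
  then have "x \<oplus> s \<oplus> t = x \<oplus> (s \<oplus> t)"
    using S add_closure_carrier[OF S t] add_closure_carrier[OF S] by (simp add: a_assoc subsetD)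
  with add show ?case by (simp add: add_closure.add)
qed

lemma add_closure_finsum:
  assumes "S \<subseteq> carrier G" "finite B" "\<And>i. i \<in> B \<Longrightarrow> f i \<in> add_closure G S"
  shows "(\<Oplus>i\<in>B. f i) \<in> add_closure G S"
  using assms(2,3)
proof (induction B)
  case (insert i B)
  then have "f \<in> B \<rightarrow> carrier G" "f i \<in> carrier G" using add_closure_carrier[OF assms(1)] by auto
  with insert show ?case by (simp add: add_closure_plus[OF assms(1)])
qed (simp add: add_closure.zero)

end

lemma (in cspace) add_closure_smult:
  assumes S: "S \<subseteq> carrier V" and cl: "\<And>c x. x \<in> S \<Longrightarrow> c \<odot> x \<in> S" and s: "s \<in> add_closure V S"
  shows "c \<odot> s \<in> add_closure V S"
  using s
proof induction
  case (add x s)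
  then have "c \<odot> (x \<oplus> s) = c \<odot> x \<oplus> c \<odot> s"
    using S add_closure_carrier[OF S] by (simp add: smult_plus_right subsetD)
  with add show ?case using cl by (simp add: add_closure.add)
qed (simp add: add_closure.zero)

lemma (in ring) add_closure_mult:
  assumes S: "S \<subseteq> carrier R" and cl: "\<And>x y. x \<in> S \<Longrightarrow> y \<in> S \<Longrightarrow> x \<otimes> y \<in> S"
    and s: "s \<in> add_closure R S" and t: "t \<in> add_closure R S"
  shows "s \<otimes> t \<in> add_closure R S"
proof -
  have *: "x \<otimes> t \<in> add_closure R S" if x: "x \<in> S" for x
    using t
  proof induction
    case (add y t)
    then have "x \<otimes> (y \<oplus> t) = x \<otimes> y \<oplus> x \<otimes> t"
      using S x add_closure_carrier[OF S] by (simp add: r_distr subsetD)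
    with add show ?case using cl x by (simp add: add_closure.add)
  qed (use S x in \<open>auto simp: add_closure.zero\<close>)
  show ?thesis using s
  proof induction
    case (add x s)
    then have "(x \<oplus> s) \<otimes> t = x \<otimes> t \<oplus> s \<otimes> t"
      using S t add_closure_carrier[OF S] by (simp add: l_distr subsetD)
    with add show ?case using * add_closure_plus[OF S] by simp
  qed (use add_closure_carrier[OF S t] in \<open>auto simp: add_closure.zero\<close>)
qed

lemma add_closure_image:
  assumes "cspace V" "cspace W" "clinear V W f" "S \<subseteq> carrier V" "s \<in> add_closure V S"
    and "Z \<subseteq> carrier W" "\<And>x. x \<in> S \<Longrightarrow> f x \<in> add_closure W Z"
  shows "f s \<in> add_closure W Z"
proof -
  interpret V: cspace V by fact
  interpret W: cspace W by fact
  show ?thesis using assms(5)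
  proof induction
    case zero
    then show ?case by (simp add: clinear_zero[OF assms(1-3)] add_closure.zero)
  next
    case (add x s)
    then have "f (x \<oplus>\<^bsub>V\<^esub> s) = f x \<oplus>\<^bsub>W\<^esub> f s"
      using assms(4) V.add_closure_carrier[OF assms(4)] by (intro clinearD(2)[OF assms(3)]) auto
    with add show ?case using W.add_closure_plus[OF assms(6)] assms(7) by simp
  qed
qed


section \<open>Quotient algebras\<close>

locale quotient = calgebra +
  fixes I
  assumes is_ideal: "ideal I A"
begin

abbreviation Q where "Q \<equiv> quot_alg A I"
abbreviation proj where "proj x \<equiv> I +> x"

lemma I_sub: "I \<subseteq> carrier A"
  using is_ideal by (meson ideal.Icarr subsetI)

text \<open>Scalars act as \<open>c \<odot> x = (c \<odot> \<one>) \<otimes> x\<close>, so a two-sided ideal is a subspace.\<close>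

lemma I_smult: assumes "x \<in> I" shows "c \<odot> x \<in> I"
proof -
  have "(c \<odot> \<one>) \<otimes> x \<in> I" using assms by (intro ideal.I_l_closed[OF is_ideal]) auto
  then show ?thesis using assms I_sub by (simp add: subsetD)
qed

lemma proj_eq_iff: "x \<in> carrier A \<Longrightarrow> y \<in> carrier A \<Longrightarrow> proj x = proj y \<longleftrightarrow> x \<ominus> y \<in> I"
  using quotient_eq_iff_same_a_r_cos[OF is_ideal] by simp

lemma proj_eq_zero_iff: "x \<in> carrier A \<Longrightarrow> proj x = \<zero>\<^bsub>Q\<^esub> \<longleftrightarrow> x \<in> I"
proof -
  assume x: "x \<in> carrier A"
  have "proj \<zero> = I" using I_sub by simp
  then show ?thesis using proj_eq_iff[OF x, of \<zero>] x
    by (simp add: quot_alg_def FactRing_def a_minus_def)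
qed

lemma mem_proj: 
  assumes "x \<in> carrier A" "y \<in> proj x" 
  shows "y \<in> carrier A" "y \<ominus> x \<in> I" "proj y = proj x"
proof -
  obtain i where i: "i \<in> I" "y = i \<oplus> x" using assms(2) by (auto simp: a_r_coset_def')
  then show y: "y \<in> carrier A" using I_sub assms(1) by auto
  have "y \<ominus> x = i" using i I_sub assms(1) by (simp add: a_minus_def a_assoc r_neg subsetD)
  then show "y \<ominus> x \<in> I" using i by simp
  then show "proj y = proj x" using proj_eq_iff[OF y assms(1)] by simp
qed

lemma self_mem_proj: "x \<in> carrier A \<Longrightarrow> x \<in> proj x"
  using additive_subgroup.zero_closed[OF ideal.axioms(1)[OF is_ideal]]
  by (auto simp: a_r_coset_def' intro!: bexI[of _ \<zero>])

lemma carrier_Q: "carrier Q = proj ` carrier A"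
  by (auto simp: quot_alg_def FactRing_def A_RCOSETS_def')

lemma add_Q: "x \<in> carrier A \<Longrightarrow> y \<in> carrier A \<Longrightarrow> proj x \<oplus>\<^bsub>Q\<^esub> proj y = proj (x \<oplus> y)"
  using ideal.a_rcos_sum[OF is_ideal] by (simp add: quot_alg_def FactRing_def)

lemma mult_Q: "x \<in> carrier A \<Longrightarrow> y \<in> carrier A \<Longrightarrow> proj x \<otimes>\<^bsub>Q\<^esub> proj y = proj (x \<otimes> y)"
  using ideal.rcoset_mult_add[OF is_ideal] by (simp add: quot_alg_def FactRing_def)

lemma one_Q: "\<one>\<^bsub>Q\<^esub> = proj \<one>"
  by (simp add: quot_alg_def FactRing_def)

lemma zero_Q: "\<zero>\<^bsub>Q\<^esub> = proj \<zero>"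
  using I_sub by (simp add: quot_alg_def FactRing_def)

lemma smult_Q: assumes "x \<in> carrier A" shows "c \<odot>\<^bsub>Q\<^esub> proj x = proj (c \<odot> x)"
proof -
  have "proj (c \<odot> y) = proj (c \<odot> x)" if y: "y \<in> proj x" for y
  proof -
    note y' = mem_proj[OF assms y]
    have "c \<odot> y \<ominus> c \<odot> x = c \<odot> (y \<ominus> x)"
      using y' assms by (simp add: a_minus_def smult_plus_right a_inv_smult smult_smult mult.commute)
    then show ?thesis using y' assms I_smult proj_eq_iff[of "c \<odot> y" "c \<odot> x"] by simp
  qed
  then have "(\<Union>y\<in>proj x. proj (c \<odot> y)) = proj (c \<odot> x)"
    using self_mem_proj[OF assms] by blast
  then show ?thesis by (simp add: quot_alg_def)
qed

lemmas Q_simps = add_Q mult_Q smult_Q one_Q zero_Q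

lemma calgebra_Q: "calgebra Q"
proof -
  have "cspace Q"
    by (rule cspaceI; (auto simp: carrier_Q Q_simps a_assoc smult_smult
      smult_plus_left smult_plus_right)?) (auto simp: a_comm)
  then show ?thesis
    by (rule calgebraI) (auto simp: carrier_Q Q_simps m_assoc l_distr r_distr)
qed

lemma alg_hom_proj: "alg_hom A Q proj"
  by (intro alg_homI clinearI) (auto simp: carrier_Q Q_simps)

text \<open>
  Two representatives of a coset differ by an element of the ideal, so the choice that Hilbert's
  operator makes does not affect the value of a linear map that kills the ideal.
\<close>

lemma some_rep:
  assumes "cspace W" "clinear A W f" "\<And>x. x \<in> I \<Longrightarrow> f x = \<zero>\<^bsub>W\<^esub>" "x \<in> carrier A"
  shows "f (SOME y. y \<in> proj x) = f x"
proof -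
  interpret W: cspace W by fact
  define y where "y = (SOME y. y \<in> proj x)"
  have "y \<in> proj x" unfolding y_def using self_mem_proj[OF assms(4)] by (rule someI)
  note y = mem_proj[OF assms(4) this]
  have "y = y \<ominus> x \<oplus> x" using y(1) assms(4) by (simp add: a_minus_def a_assoc l_neg)
  then have "f y = f (y \<ominus> x) \<oplus>\<^bsub>W\<^esub> f x"
    using clinearD(2)[OF assms(2), of "y \<ominus> x" x] y(1) assms(4) by simp
  then show ?thesis unfolding y_def[symmetric]
    using assms(3)[OF y(2)] clinearD(1)[OF assms(2,4)] by simp
qed

lemma clinear_some_rep:
  assumes "cspace W" "clinear A W f" "\<And>x. x \<in> I \<Longrightarrow> f x = \<zero>\<^bsub>W\<^esub>"
  shows "clinear Q W (\<lambda>U. f (SOME y. y \<in> U))"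
  using clinearD[OF assms(2)]
  by (intro clinearI) (auto simp: carrier_Q Q_simps some_rep[OF assms])

lemma alg_hom_some_rep:
  assumes "calgebra B" "alg_hom A B f" "\<And>x. x \<in> I \<Longrightarrow> f x = \<zero>\<^bsub>B\<^esub>"
  shows "alg_hom Q B (\<lambda>U. f (SOME y. y \<in> U))"
proof -
  interpret B: calgebra B by fact
  note rep = some_rep[OF B.cspace_axioms alg_homD(1)[OF assms(2)] assms(3)]
  show ?thesis
    using alg_homD[OF assms(2)]
    by (intro alg_homI clinear_some_rep B.cspace_axioms assms(3)) (auto simp: carrier_Q Q_simps rep)
qed

end


section \<open>The free algebra\<close>

context
  fixes U :: "'x set"
begin

abbreviation (input) F where "F \<equiv> free_alg U"

lemma free_alg_simps:
  "carrier F = {p. finite {w. p w \<noteq> 0} \<and> (\<forall>w. p w \<noteq> 0 \<longrightarrow> set w \<subseteq> U)}"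
  "p \<otimes>\<^bsub>F\<^esub> q = (\<lambda>w. \<Sum>i\<le>length w. p (take i w) * q (drop i w))"
  "\<one>\<^bsub>F\<^esub> = (\<lambda>w. if w = [] then 1 else 0)"
  "\<zero>\<^bsub>F\<^esub> = (\<lambda>_. 0)"
  "p \<oplus>\<^bsub>F\<^esub> q = (\<lambda>w. p w + q w)"
  "c \<odot>\<^bsub>F\<^esub> p = (\<lambda>w. c * p w)"
  by (simp_all add: free_alg_def)

lemma cspace_free_alg: "cspace F"
proof (rule cspaceI)
  fix p q assume "p \<in> carrier F" "q \<in> carrier F"
  then show "p \<oplus>\<^bsub>F\<^esub> q \<in> carrier F"
    by (auto simp: free_alg_simps intro: finite_subset[of _ "{w. p w \<noteq> 0} \<union> {w. q w \<noteq> 0}"])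
      (metis add_0 subsetD)
next
  fix c p assume "p \<in> carrier F"
  then show "c \<odot>\<^bsub>F\<^esub> p \<in> carrier F"
    by (auto simp: free_alg_simps elim!: finite_subset[rotated])
qed (auto simp: free_alg_simps algebra_simps)

lemma free_alg_mult_closed:
  assumes "p \<in> carrier F" "q \<in> carrier F" shows "p \<otimes>\<^bsub>F\<^esub> q \<in> carrier F"
proof -
  have *: "\<exists>a b. w = a @ b \<and> p a \<noteq> 0 \<and> q b \<noteq> 0" if "(p \<otimes>\<^bsub>F\<^esub> q) w \<noteq> 0" for w
  proof -
    have "\<exists>i. p (take i w) * q (drop i w) \<noteq> 0"
    proof (rule ccontr)
      assume "\<not> ?thesis"
      then have "(p \<otimes>\<^bsub>F\<^esub> q) w = 0" unfolding free_alg_simps by (intro sum.neutral) blast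
      then show False using that by contradiction
    qed
    then obtain i where "p (take i w) * q (drop i w) \<noteq> 0" ..
    then show ?thesis by (intro exI[of _ "take i w"] exI[of _ "drop i w"]) auto
  qed
  then have "{w. (p \<otimes>\<^bsub>F\<^esub> q) w \<noteq> 0} \<subseteq> (\<lambda>(a, b). a @ b) ` ({w. p w \<noteq> 0} \<times> {w. q w \<noteq> 0})"
    by fastforce
  moreover have "finite ((\<lambda>(a, b). a @ b) ` ({w. p w \<noteq> 0} \<times> {w. q w \<noteq> 0}))"
    using assms by (intro finite_imageI finite_cartesian_product) (auto simp: free_alg_simps)
  ultimately have fin: "finite {w. (p \<otimes>\<^bsub>F\<^esub> q) w \<noteq> 0}" by (rule finite_subset)
  have sub: "set w \<subseteq> U" if "(p \<otimes>\<^bsub>F\<^esub> q) w \<noteq> 0" for w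
    using *[OF that] assms by (fastforce simp: free_alg_simps(1))
  show ?thesis unfolding free_alg_simps(1) by (intro CollectI conjI allI impI fin sub)
qed

lemma free_alg_mult_assoc: "p \<otimes>\<^bsub>F\<^esub> q \<otimes>\<^bsub>F\<^esub> r = p \<otimes>\<^bsub>F\<^esub> (q \<otimes>\<^bsub>F\<^esub> r)"
proof
  fix w :: "'x list"
  let ?n = "length w"
  \<comment> \<open>Both sides sum over the ways to cut \<open>w\<close> into three pieces, at \<open>j\<close> and at \<open>i \<ge> j\<close>.\<close>
  have "(p \<otimes>\<^bsub>F\<^esub> q \<otimes>\<^bsub>F\<^esub> r) w =
      (\<Sum>i\<le>?n. \<Sum>j\<le>i. p (take j w) * q (take (i - j) (drop j w)) * r (drop i w))"
    by (auto simp: free_alg_simps sum_distrib_right min_def drop_take intro!: sum.cong)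
  also have "\<dots> = (\<Sum>j\<le>?n. \<Sum>i\<in>{j..?n}. p (take j w) * q (take (i - j) (drop j w)) * r (drop i w))"
    unfolding sum.Sigma[OF finite_atMost ballI[OF finite_atMost]]
      sum.Sigma[OF finite_atMost ballI[OF finite_atLeastAtMost]]
    by (intro sum.reindex_bij_witness[of _ "\<lambda>(j, i). (i, j)" "\<lambda>(i, j). (j, i)"]) auto
  also have "\<dots> = (\<Sum>j\<le>?n. \<Sum>i\<le>?n - j. p (take j w) * q (take i (drop j w)) * r (drop (i + j) w))"
  proof (rule sum.cong[OF refl])
    fix j assume "j \<in> {..?n}"
    then show "(\<Sum>i\<in>{j..?n}. p (take j w) * q (take (i - j) (drop j w)) * r (drop i w)) =
        (\<Sum>i\<le>?n - j. p (take j w) * q (take i (drop j w)) * r (drop (i + j) w))"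
      by (intro sum.reindex_bij_witness[of _ "\<lambda>i. i + j" "\<lambda>i. i - j"]) auto
  qed
  also have "\<dots> = (p \<otimes>\<^bsub>F\<^esub> (q \<otimes>\<^bsub>F\<^esub> r)) w"
    by (simp add: free_alg_simps sum_distrib_left mult.assoc)
  finally show "(p \<otimes>\<^bsub>F\<^esub> q \<otimes>\<^bsub>F\<^esub> r) w = (p \<otimes>\<^bsub>F\<^esub> (q \<otimes>\<^bsub>F\<^esub> r)) w" .
qed

lemma calgebra_free_alg: "calgebra F"
proof (rule calgebraI)
  fix p q r :: "'x list \<Rightarrow> complex" and c
  show "(p \<oplus>\<^bsub>F\<^esub> q) \<otimes>\<^bsub>F\<^esub> r = p \<otimes>\<^bsub>F\<^esub> r \<oplus>\<^bsub>F\<^esub> q \<otimes>\<^bsub>F\<^esub> r"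
    "r \<otimes>\<^bsub>F\<^esub> (p \<oplus>\<^bsub>F\<^esub> q) = r \<otimes>\<^bsub>F\<^esub> p \<oplus>\<^bsub>F\<^esub> r \<otimes>\<^bsub>F\<^esub> q"
    by (simp_all add: free_alg_simps distrib_left distrib_right sum.distrib)
  show "(c \<odot>\<^bsub>F\<^esub> p) \<otimes>\<^bsub>F\<^esub> q = c \<odot>\<^bsub>F\<^esub> (p \<otimes>\<^bsub>F\<^esub> q)"
    "p \<otimes>\<^bsub>F\<^esub> (c \<odot>\<^bsub>F\<^esub> q) = c \<odot>\<^bsub>F\<^esub> (p \<otimes>\<^bsub>F\<^esub> q)"
    by (simp_all add: free_alg_simps sum_distrib_left mult.assoc mult.left_commute)
next
  fix p assume p: "p \<in> carrier F"
  show "\<one>\<^bsub>F\<^esub> \<otimes>\<^bsub>F\<^esub> p = p"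
  proof
    fix w :: "'x list"
    have "(\<one>\<^bsub>F\<^esub> \<otimes>\<^bsub>F\<^esub> p) w = (\<Sum>i\<le>length w. if i = 0 then p w else 0)"
      unfolding free_alg_simps by (rule sum.cong) auto
    then show "(\<one>\<^bsub>F\<^esub> \<otimes>\<^bsub>F\<^esub> p) w = p w" by simp
  qed
  show "p \<otimes>\<^bsub>F\<^esub> \<one>\<^bsub>F\<^esub> = p"
  proof
    fix w :: "'x list"
    have "(p \<otimes>\<^bsub>F\<^esub> \<one>\<^bsub>F\<^esub>) w = (\<Sum>i\<le>length w. if i = length w then p w else 0)"
      unfolding free_alg_simps by (rule sum.cong) auto
    then show "(p \<otimes>\<^bsub>F\<^esub> \<one>\<^bsub>F\<^esub>) w = p w" by simp
  qed
next
  show "\<one>\<^bsub>F\<^esub> \<in> carrier F" by (simp add: free_alg_simps)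
qed (simp_all only: cspace_free_alg free_alg_mult_closed free_alg_mult_assoc)

lemma word_closed: "set w \<subseteq> U \<Longrightarrow> word w \<in> carrier F"
  by (auto simp: free_alg_simps word_def split: if_splits)

lemma word_mult: "word a \<otimes>\<^bsub>F\<^esub> word b = word (a @ b)"
proof
  fix w :: "'x list"
  have "(if take i w = a then 1 else 0) * (if drop i w = b then 1 else 0) =
      (if i = length a then if w = a @ b then 1 else 0 else (0 :: complex))"
    if "i \<le> length w" for i
  proof (cases "i = length a")
    case True
    have "w = a @ b \<longleftrightarrow> take i w = a \<and> drop i w = b"
      using True append_eq_conv_conj[of a b w] by auto
    then show ?thesis using True by simp
  next
    case False
    then have "take i w \<noteq> a" using that by auto
    then show ?thesis using False by simp
  qed
  then have "(word a \<otimes>\<^bsub>F\<^esub> word b) w =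
      (\<Sum>i\<le>length w. if i = length a then if w = a @ b then 1 else 0 else 0)"
    unfolding free_alg_simps word_def by (intro sum.cong) auto
  then show "(word a \<otimes>\<^bsub>F\<^esub> word b) w = word (a @ b) w"
    by (auto simp: word_def)
qed

lemma word_Nil: "word [] = \<one>\<^bsub>F\<^esub>"
  by (simp add: word_def free_alg_simps)

text \<open>
  The words of the support are split off one at a time. The set \<open>S\<close> keeps track of which words can
  occur, so that the induction can be restricted to words of a fixed length.
\<close>

lemma free_alg_induct [consumes 1, case_names support zero step]:
  assumes p: "p \<in> carrier F" and S: "\<And>w. p w \<noteq> 0 \<Longrightarrow> w \<in> S"
    and zero: "P \<zero>\<^bsub>F\<^esub>"
    and step: "\<And>c w q. set w \<subseteq> U \<Longrightarrow> w \<in> S \<Longrightarrow> q \<in> carrier F \<Longrightarrow> P q \<Longrightarrow> P (c \<odot>\<^bsub>F\<^esub> word w \<oplus>\<^bsub>F\<^esub> q)"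
  shows "P p"
proof -
  have "finite B \<Longrightarrow> p \<in> carrier F \<Longrightarrow> {w. p w \<noteq> 0} \<subseteq> B \<Longrightarrow> B \<subseteq> S \<Longrightarrow> P p" for B p
  proof (induction B arbitrary: p rule: finite_induct)
    case empty
    then have "p = \<zero>\<^bsub>F\<^esub>" by (auto simp: free_alg_simps)
    then show ?case using zero by simp
  next
    case (insert w B)
    define q where "q = (\<lambda>u. if u = w then 0 else p u)"
    have q: "q \<in> carrier F" using insert.prems(1)
      by (auto simp: free_alg_simps q_def split: if_splits elim!: finite_subset[rotated])
    have "{u. q u \<noteq> 0} \<subseteq> B" using insert.prems(2) by (auto simp: q_def split: if_splits)
    then have Pq: "P q" using insert.IH[OF q] insert.prems by blast
    show ?case
    proof (cases "p w = 0")
      case True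
      then have "p = q" by (auto simp: q_def)
      then show ?thesis using Pq by simp
    next
      case False
      have "p = p w \<odot>\<^bsub>F\<^esub> word w \<oplus>\<^bsub>F\<^esub> q" by (auto simp: free_alg_simps q_def word_def)
      moreover have "set w \<subseteq> U" using insert.prems(1) False by (auto simp: free_alg_simps)
      ultimately show ?thesis using step[OF _ _ q Pq, of w "p w"] insert.prems by auto
    qed
  qed
  from this[of "{w. p w \<noteq> 0}" p] show ?thesis using p S by (auto simp: free_alg_simps)
qed

end

definition word_sum ::
  "(complex, 'w, 'm) module_scheme \<Rightarrow> ('x list \<Rightarrow> 'w) \<Rightarrow> ('x list \<Rightarrow> complex) \<Rightarrow> 'w" where
  "word_sum W \<phi> p = (\<Oplus>\<^bsub>W\<^esub>w\<in>{w. p w \<noteq> 0}. p w \<odot>\<^bsub>W\<^esub> \<phi> w)"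

lemma clinear_word_sum:
  assumes "cspace W" and \<phi>: "\<And>w. set w \<subseteq> U \<Longrightarrow> \<phi> w \<in> carrier W"
  shows "clinear (free_alg U) W (word_sum W \<phi>)"
proof -
  interpret W: cspace W by fact
  show ?thesis
  proof (rule clinearI)
    fix p assume p: "p \<in> carrier (free_alg U)"
    then show "word_sum W \<phi> p \<in> carrier W"
      unfolding word_sum_def by (intro W.finsum_closed) (auto simp: free_alg_simps \<phi>)
    show "word_sum W \<phi> (c \<odot>\<^bsub>free_alg U\<^esub> p) = c \<odot>\<^bsub>W\<^esub> word_sum W \<phi> p" for c
    proof (cases "c = 0")
      case True
      then show ?thesis using \<open>word_sum W \<phi> p \<in> carrier W\<close>
        by (simp add: word_sum_def free_alg_simps)
    next
      case False
      then show ?thesis using p unfolding word_sum_def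
        by (subst W.smult_finsum) (auto simp: free_alg_simps W.smult_smult \<phi> intro!: W.finsum_cong')
    qed
    fix q assume q: "q \<in> carrier (free_alg U)"
    show "word_sum W \<phi> (p \<oplus>\<^bsub>free_alg U\<^esub> q) = word_sum W \<phi> p \<oplus>\<^bsub>W\<^esub> word_sum W \<phi> q"
      unfolding word_sum_def using p q
      by (intro W.finsum_support_add) (auto simp: free_alg_simps W.smult_plus_left \<phi>)
  qed
qed

lemma word_sum_word:
  assumes "cspace W" "\<phi> w \<in> carrier W"
  shows "word_sum W \<phi> (word w) = \<phi> w"
proof -
  interpret W: cspace W by fact
  have "word_sum W \<phi> (word w) = word w w \<odot>\<^bsub>W\<^esub> \<phi> w"
    unfolding word_sum_def by (rule W.finsum_support_single) (auto simp: word_def assms)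
  then show ?thesis using assms by (simp add: word_def)
qed


section \<open>The universal property of the tensor algebra\<close>

definition multilinear ::
  "(complex, 'v, 'm) module_scheme \<Rightarrow> (complex, 'w, 'n) module_scheme \<Rightarrow> ('v list \<Rightarrow> 'w) \<Rightarrow> bool" where
  "multilinear V W \<phi> \<longleftrightarrow>
     (\<forall>w. set w \<subseteq> carrier V \<longrightarrow> \<phi> w \<in> carrier W) \<and>
     (\<forall>a b. set a \<subseteq> carrier V \<longrightarrow> set b \<subseteq> carrier V \<longrightarrow> clinear V W (\<lambda>u. \<phi> (a @ u # b)))"

lemma multilinearI:
  assumes "\<And>w. set w \<subseteq> carrier V \<Longrightarrow> \<phi> w \<in> carrier W"
    and "\<And>a b. set a \<subseteq> carrier V \<Longrightarrow> set b \<subseteq> carrier V \<Longrightarrow> clinear V W (\<lambda>u. \<phi> (a @ u # b))"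
  shows "multilinear V W \<phi>"
  using assms unfolding multilinear_def by blast

lemma multilinear_closed: "multilinear V W \<phi> \<Longrightarrow> set w \<subseteq> carrier V \<Longrightarrow> \<phi> w \<in> carrier W"
  unfolding multilinear_def by blast

lemma multilinear_clinear:
  "multilinear V W \<phi> \<Longrightarrow> set a \<subseteq> carrier V \<Longrightarrow> set b \<subseteq> carrier V \<Longrightarrow>
    clinear V W (\<lambda>u. \<phi> (a @ u # b))"
  unfolding multilinear_def by blast

lemmas multilinearD = multilinear_closed clinearD(2,3)[OF multilinear_clinear]

locale tensor = cspace V for V :: "(complex, 'v, 'm) module_scheme" (structure)
begin

abbreviation FV where "FV \<equiv> free_alg (carrier V)"
abbreviation T where "T \<equiv> tensor_alg V"
abbreviation pure where "pure \<equiv> pure_tensor V"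
abbreviation L where "L \<equiv> linearity_ideal V"

definition linearity_relations :: "('v list \<Rightarrow> complex) set" where
  "linearity_relations =
    {word [u \<oplus> v] \<ominus>\<^bsub>FV\<^esub> (word [u] \<oplus>\<^bsub>FV\<^esub> word [v]) | u v. u \<in> carrier V \<and> v \<in> carrier V} \<union>
    {word [c \<odot> v] \<ominus>\<^bsub>FV\<^esub> (c \<odot>\<^bsub>FV\<^esub> word [v]) | c v. v \<in> carrier V}"

lemma L_eq: "L = Idl\<^bsub>FV\<^esub> linearity_relations"
  by (simp add: linearity_ideal_def linearity_relations_def Let_def)

end

sublocale tensor \<subseteq> FV: calgebra "free_alg (carrier V)"
  by (rule calgebra_free_alg)

lemma (in tensor) linearity_relations_sub: "linearity_relations \<subseteq> carrier FV"
  by (auto simp: linearity_relations_def word_closed)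

sublocale tensor \<subseteq> FV: quotient "free_alg (carrier V)" "linearity_ideal V"
  by (intro quotient.intro quotient_axioms.intro FV.calgebra_axioms)
    (simp add: L_eq FV.genideal_ideal linearity_relations_sub)

lemma (in tensor) T_eq: "quot_alg FV L = T"
  by (simp add: tensor_alg_def)

sublocale tensor \<subseteq> T: calgebra "tensor_alg V"
  using FV.calgebra_Q by (simp add: T_eq)

context tensor
begin

lemma pure_eq: "pure w = FV.proj (word w)"
  by (simp add: pure_tensor_def)

lemma pure_closed [simp]: "set w \<subseteq> carrier V \<Longrightarrow> pure w \<in> carrier T"
  using FV.carrier_Q by (auto simp: pure_eq T_eq word_closed)

lemma pure_append:
  "set a \<subseteq> carrier V \<Longrightarrow> set b \<subseteq> carrier V \<Longrightarrow> pure (a @ b) = pure a \<otimes>\<^bsub>T\<^esub> pure b"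
  using FV.mult_Q[of "word a" "word b"] by (simp add: pure_eq T_eq word_closed word_mult)

lemma pure_Nil: "pure [] = \<one>\<^bsub>T\<^esub>"
  using FV.one_Q by (simp add: pure_eq T_eq word_Nil[of "carrier V"])

lemma pure_Cons:
  "v \<in> carrier V \<Longrightarrow> set b \<subseteq> carrier V \<Longrightarrow> pure (v # b) = pure [v] \<otimes>\<^bsub>T\<^esub> pure b"
  using pure_append[of "[v]" b] by simp

lemma relations_in_L: "r \<in> linearity_relations \<Longrightarrow> r \<in> L"
  unfolding L_eq using FV.genideal_self[OF linearity_relations_sub] by blast

lemma pure_plus1:
  assumes "u \<in> carrier V" "v \<in> carrier V"
  shows "pure [u \<oplus> v] = pure [u] \<oplus>\<^bsub>T\<^esub> pure [v]"
proof -
  have "word [u \<oplus> v] \<ominus>\<^bsub>FV\<^esub> (word [u] \<oplus>\<^bsub>FV\<^esub> word [v]) \<in> L"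
    using assms by (intro relations_in_L) (auto simp: linearity_relations_def)
  then show ?thesis
    using assms FV.add_Q[of "word [u]" "word [v]"]
      FV.proj_eq_iff[of "word [u \<oplus> v]" "word [u] \<oplus>\<^bsub>FV\<^esub> word [v]"]
    by (simp add: pure_eq T_eq word_closed)
qed

lemma pure_smult1:
  assumes "v \<in> carrier V"
  shows "pure [c \<odot> v] = c \<odot>\<^bsub>T\<^esub> pure [v]"
proof -
  have "word [c \<odot> v] \<ominus>\<^bsub>FV\<^esub> (c \<odot>\<^bsub>FV\<^esub> word [v]) \<in> L"
    using assms by (intro relations_in_L) (auto simp: linearity_relations_def)
  then show ?thesis
    using assms FV.smult_Q[of "word [v]" c]
      FV.proj_eq_iff[of "word [c \<odot> v]" "c \<odot>\<^bsub>FV\<^esub> word [v]"]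
    by (simp add: pure_eq T_eq word_closed)
qed

lemma clinear_pure1: "clinear V T (\<lambda>v. pure [v])"
  by (intro clinearI) (simp_all add: pure_plus1 pure_smult1)

text \<open>The value \<open>\<phi> (a @ v # b) = \<phi> a \<otimes> \<phi> [v] \<otimes> \<phi> b\<close> is linear in \<open>v\<close>.\<close>

lemma multilinear_of_mult:
  assumes "calgebra B" and cl: "\<And>w. set w \<subseteq> carrier V \<Longrightarrow> \<phi> w \<in> carrier B"
    and app: "\<And>a b. set a \<subseteq> carrier V \<Longrightarrow> set b \<subseteq> carrier V \<Longrightarrow> \<phi> (a @ b) = \<phi> a \<otimes>\<^bsub>B\<^esub> \<phi> b"
    and lin: "clinear V B (\<lambda>v. \<phi> [v])"
  shows "multilinear V B \<phi>"
proof -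
  interpret B: calgebra B by fact
  have *: "\<phi> (a @ v # b) = \<phi> a \<otimes>\<^bsub>B\<^esub> \<phi> [v] \<otimes>\<^bsub>B\<^esub> \<phi> b"
    if "set a \<subseteq> carrier V" "set b \<subseteq> carrier V" "v \<in> carrier V" for a v b
    using that app[of a "[v] @ b"] app[of "[v]" b] cl by (simp add: B.m_assoc)
  show ?thesis
    by (intro multilinearI clinearI)
      (use cl clinearD[OF lin] in \<open>simp_all add: * B.l_distr B.r_distr\<close>)
qed

lemma multilinear_pure: "multilinear V T pure"
  by (intro multilinear_of_mult clinear_pure1 T.calgebra_axioms) (simp_all add: pure_append)

text \<open>
  The kernel of a word sum need not be an ideal. What is an ideal is the set of the \<open>p\<close> such that
  \<open>a p b\<close> lies in the kernel for all words \<open>a\<close> and \<open>b\<close>, and multilinearity says that this ideal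
  contains the linearity relations.
\<close>

lemma word_sum_L:
  assumes W: "cspace W" and \<phi>: "multilinear V W \<phi>" and p: "p \<in> L"
  shows "word_sum W \<phi> p = \<zero>\<^bsub>W\<^esub>"
proof -
  interpret W: cspace W by fact
  let ?s = "word_sum W \<phi>"
  note lin = clinear_word_sum[OF W, of "carrier V" \<phi>, OF multilinearD(1)[OF \<phi>]]
  note s = clinearD[OF lin] clinear_zero[OF FV.cspace_axioms W lin] clinear_minus[OF FV.cspace_axioms W lin]
  note s_word = word_sum_word[OF W, of \<phi>, OF multilinearD(1)[OF \<phi>]]
  define K where "K = {p \<in> carrier FV. \<forall>a b. set a \<subseteq> carrier V \<longrightarrow> set b \<subseteq> carrier V \<longrightarrow>
    ?s (word a \<otimes>\<^bsub>FV\<^esub> p \<otimes>\<^bsub>FV\<^esub> word b) = \<zero>\<^bsub>W\<^esub>}"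
  have Kcl: "p \<in> K \<Longrightarrow> p \<in> carrier FV" for p by (simp add: K_def)
  have Kadd: "p \<oplus>\<^bsub>FV\<^esub> q \<in> K" if "p \<in> K" "q \<in> K" for p q
    using that by (auto simp: K_def FV.l_distr FV.r_distr s word_closed)
  have Ksm: "c \<odot>\<^bsub>FV\<^esub> p \<in> K" if "p \<in> K" for c p
    using that by (auto simp: K_def s word_closed)
  have Kwl: "word w \<otimes>\<^bsub>FV\<^esub> p \<in> K" if "p \<in> K" "set w \<subseteq> carrier V" for p w
    using that by (auto simp: K_def FV.m_assoc[symmetric] word_mult word_closed)
  have Kwr: "p \<otimes>\<^bsub>FV\<^esub> word w \<in> K" if "p \<in> K" "set w \<subseteq> carrier V" for p w
    using that by (auto simp: K_def FV.m_assoc word_mult word_closed)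
  have Kzero: "\<zero>\<^bsub>FV\<^esub> \<in> K" by (simp add: K_def word_closed s)
  have Kl: "q \<otimes>\<^bsub>FV\<^esub> p \<in> K" if "p \<in> K" "q \<in> carrier FV" for p q
    using that(2)
  proof (induction q rule: free_alg_induct[where S = UNIV])
    case (step c w q)
    then have "(c \<odot>\<^bsub>FV\<^esub> word w \<oplus>\<^bsub>FV\<^esub> q) \<otimes>\<^bsub>FV\<^esub> p = c \<odot>\<^bsub>FV\<^esub> (word w \<otimes>\<^bsub>FV\<^esub> p) \<oplus>\<^bsub>FV\<^esub> q \<otimes>\<^bsub>FV\<^esub> p"
      using Kcl[OF that(1)] by (simp add: FV.l_distr word_closed)
    with step show ?case using Kadd Ksm Kwl that(1) by simp
  qed (use Kcl[OF that(1)] Kzero in auto)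
  have Kr: "p \<otimes>\<^bsub>FV\<^esub> q \<in> K" if "p \<in> K" "q \<in> carrier FV" for p q
    using that(2)
  proof (induction q rule: free_alg_induct[where S = UNIV])
    case (step c w q)
    then have "p \<otimes>\<^bsub>FV\<^esub> (c \<odot>\<^bsub>FV\<^esub> word w \<oplus>\<^bsub>FV\<^esub> q) = c \<odot>\<^bsub>FV\<^esub> (p \<otimes>\<^bsub>FV\<^esub> word w) \<oplus>\<^bsub>FV\<^esub> p \<otimes>\<^bsub>FV\<^esub> q"
      using Kcl[OF that(1)] by (simp add: FV.r_distr word_closed)
    with step show ?case using Kadd Ksm Kwr that(1) by simp
  qed (use Kcl[OF that(1)] Kzero in auto)
  have "submodule K CC FV"
    using Kcl Kzero Kadd Ksm by (intro FV.submodule_memI) auto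
  then have "ideal K FV"
    by (intro idealI FV.ring_axioms) (auto intro: submodule.axioms Kl Kr)
  moreover have "linearity_relations \<subseteq> K"
  proof
    fix r assume r: "r \<in> linearity_relations"
    have "?s (word a \<otimes>\<^bsub>FV\<^esub> r \<otimes>\<^bsub>FV\<^esub> word b) = \<zero>\<^bsub>W\<^esub>"
      if ab: "set a \<subseteq> carrier V" "set b \<subseteq> carrier V" for a b
    proof -
      consider (add) u v where "u \<in> carrier V" "v \<in> carrier V"
          "r = word [u \<oplus> v] \<ominus>\<^bsub>FV\<^esub> (word [u] \<oplus>\<^bsub>FV\<^esub> word [v])"
        | (smult) c v where "v \<in> carrier V" "r = word [c \<odot> v] \<ominus>\<^bsub>FV\<^esub> (c \<odot>\<^bsub>FV\<^esub> word [v])"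
        using r by (auto simp: linearity_relations_def)
      then show ?thesis
      proof cases
        case add
        then have "word a \<otimes>\<^bsub>FV\<^esub> r \<otimes>\<^bsub>FV\<^esub> word b =
            word (a @ (u \<oplus> v) # b) \<ominus>\<^bsub>FV\<^esub> (word (a @ u # b) \<oplus>\<^bsub>FV\<^esub> word (a @ v # b))"
          using ab by (simp add: a_minus_def FV.l_distr FV.r_distr FV.l_minus FV.r_minus
            FV.minus_add word_closed word_mult)
        then show ?thesis
          using add ab by (simp add: s word_closed s_word multilinearD(2)[OF \<phi>] multilinearD(1)[OF \<phi>]
            W.minus_eq W.r_neg)
      next
        case smult
        then have "word a \<otimes>\<^bsub>FV\<^esub> r \<otimes>\<^bsub>FV\<^esub> word b =
            word (a @ (c \<odot> v) # b) \<ominus>\<^bsub>FV\<^esub> (c \<odot>\<^bsub>FV\<^esub> word (a @ v # b))"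
          using ab by (simp add: a_minus_def FV.l_distr FV.r_distr FV.l_minus FV.r_minus
            word_closed word_mult)
        then show ?thesis
          using smult ab by (simp add: s word_closed s_word multilinearD(3)[OF \<phi>] multilinearD(1)[OF \<phi>]
            W.minus_eq W.r_neg)
      qed
    qed
    then show "r \<in> K" using r linearity_relations_sub by (auto simp: K_def)
  qed
  ultimately have "L \<subseteq> K" unfolding L_eq by (rule FV.genideal_minimal)
  with p have "p \<in> K" by blast
  then have "?s (word [] \<otimes>\<^bsub>FV\<^esub> p \<otimes>\<^bsub>FV\<^esub> word []) = \<zero>\<^bsub>W\<^esub>" by (force simp: K_def)
  then show ?thesis using Kcl[OF \<open>p \<in> K\<close>] by (simp add: word_Nil[of "carrier V"])
qed

lemma tensor_lift_eq: "tensor_lift W \<phi> = (\<lambda>U. word_sum W \<phi> (SOME p. p \<in> U))"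
  by (simp add: fun_eq_iff tensor_lift_def word_sum_def Let_def)

lemma clinear_tensor_lift:
  assumes "cspace W" "multilinear V W \<phi>"
  shows "clinear T W (tensor_lift W \<phi>)"
  using FV.clinear_some_rep[OF assms(1) clinear_word_sum[OF assms(1) multilinearD(1)[OF assms(2)]]
      word_sum_L[OF assms]]
  by (simp add: T_eq tensor_lift_eq)

lemma tensor_lift_pure:
  assumes "cspace W" "multilinear V W \<phi>" "set w \<subseteq> carrier V"
  shows "tensor_lift W \<phi> (pure w) = \<phi> w"
  using FV.some_rep[OF assms(1) clinear_word_sum[OF assms(1) multilinearD(1)[OF assms(2)]]
      word_sum_L[OF assms(1,2)], of "word w"]
    word_sum_word[of W \<phi> w] assms multilinearD(1)[OF assms(2)]
  by (simp add: tensor_lift_eq pure_eq word_closed)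

text \<open>
  Expanding the letters one after the other in a spanning set \<open>S\<close> turns a pure tensor into a sum of
  pure tensors of the same length with letters in \<open>S\<close>.
\<close>

lemma pure_spanning_induct:
  assumes S: "S \<subseteq> carrier V" "carrier V \<subseteq> add_closure V S"
    and P0: "P \<zero>\<^bsub>T\<^esub>"
    and Padd: "\<And>x y. x \<in> carrier T \<Longrightarrow> y \<in> carrier T \<Longrightarrow> P x \<Longrightarrow> P y \<Longrightarrow> P (x \<oplus>\<^bsub>T\<^esub> y)"
    and w: "set w \<subseteq> carrier V"
    and Pw: "\<And>u. set u \<subseteq> S \<Longrightarrow> length u = length w \<Longrightarrow> P (pure u)"
  shows "P (pure w)"
proof -
  \<comment> \<open>\<open>a\<close> is the part of the word that has been expanded already.\<close>
  have "set a \<subseteq> S \<Longrightarrow> set b \<subseteq> carrier V \<Longrightarrow> length a + length b = length w \<Longrightarrow> P (pure (a @ b))" for a b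
  proof (induction b arbitrary: a)
    case Nil
    then show ?case using Pw by simp
  next
    case (Cons v b)
    have "v \<in> add_closure V S" using S Cons.prems by auto
    then show ?case
    proof (induction rule: add_closure.induct)
      case zero
      have "pure (a @ (0 \<odot> \<zero>) # b) = 0 \<odot>\<^bsub>T\<^esub> pure (a @ \<zero> # b)"
        using Cons.prems S by (intro multilinearD(3)[OF multilinear_pure]) auto
      then have "pure (a @ \<zero> # b) = \<zero>\<^bsub>T\<^esub>" using Cons.prems S by simp
      then show ?case using P0 by simp
    next
      case (add x s)
      then have xs: "x \<in> carrier V" "s \<in> carrier V" using S add_closure_carrier by auto
      have "pure (a @ (x \<oplus> s) # b) = pure (a @ x # b) \<oplus>\<^bsub>T\<^esub> pure (a @ s # b)"
        using Cons.prems S xs by (intro multilinearD(2)[OF multilinear_pure]) auto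
      moreover have "P (pure (a @ x # b))"
        using Cons.IH[of "a @ [x]"] Cons.prems add.hyps by simp
      ultimately show ?case using Padd add.IH xs Cons.prems S by simp
    qed
  qed
  from this[of "[]" w] w show ?thesis by simp
qed

lemma tensor_induct_lengths:
  assumes p: "p \<in> carrier FV" "\<And>w. p w \<noteq> 0 \<Longrightarrow> length w \<in> N"
    and S: "S \<subseteq> carrier V \<and> carrier V \<subseteq> add_closure V S"
    and P0: "P \<zero>\<^bsub>T\<^esub>"
    and Padd: "\<And>x y. x \<in> carrier T \<Longrightarrow> y \<in> carrier T \<Longrightarrow> P x \<Longrightarrow> P y \<Longrightarrow> P (x \<oplus>\<^bsub>T\<^esub> y)"
    and Psm: "\<And>c x. x \<in> carrier T \<Longrightarrow> P x \<Longrightarrow> P (c \<odot>\<^bsub>T\<^esub> x)"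
    and Pw: "\<And>u. set u \<subseteq> S \<Longrightarrow> length u \<in> N \<Longrightarrow> P (pure u)"
  shows "P (FV.proj p)"
  using p(1)
proof (induction p rule: free_alg_induct[where S = "{w. length w \<in> N}"])
  case zero
  then show ?case using P0 FV.zero_Q by (simp add: T_eq)
next
  case (step c w q)
  have "P (pure w)"
    by (rule pure_spanning_induct[of S]) (use S P0 Padd Pw step in auto)
  moreover have "FV.proj (c \<odot>\<^bsub>FV\<^esub> word w \<oplus>\<^bsub>FV\<^esub> q) = c \<odot>\<^bsub>T\<^esub> pure w \<oplus>\<^bsub>T\<^esub> FV.proj q"
    using step FV.add_Q[of "c \<odot>\<^bsub>FV\<^esub> word w" q] FV.smult_Q[of "word w" c]
    by (simp add: T_eq pure_eq word_closed)
  moreover have "FV.proj q \<in> carrier T" using step FV.carrier_Q by (simp add: T_eq)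
  ultimately show ?case using Padd Psm step by simp
qed (use p(2) in auto)

lemma tensor_power_induct [consumes 1, case_names spanning zero add smult pure]:
  assumes U: "U \<in> tensor_power V n"
    and S: "S \<subseteq> carrier V \<and> carrier V \<subseteq> add_closure V S"
    and P: "P \<zero>\<^bsub>T\<^esub>"
      "\<And>x y. x \<in> carrier T \<Longrightarrow> y \<in> carrier T \<Longrightarrow> P x \<Longrightarrow> P y \<Longrightarrow> P (x \<oplus>\<^bsub>T\<^esub> y)"
      "\<And>c x. x \<in> carrier T \<Longrightarrow> P x \<Longrightarrow> P (c \<odot>\<^bsub>T\<^esub> x)"
      "\<And>u. set u \<subseteq> S \<Longrightarrow> length u = n \<Longrightarrow> P (pure u)"
  shows "P U"
proof -
  obtain p where p: "p \<in> carrier FV" "\<And>w. p w \<noteq> 0 \<Longrightarrow> length w = n" and U: "U = FV.proj p"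
    using U by (auto simp: tensor_power_def)
  show ?thesis unfolding U
    by (rule tensor_induct_lengths[where N = "{n}", OF p(1) _ S P(1-3)]) (use p(2) P(4) in auto)
qed

lemma tensor_induct [consumes 1, case_names spanning zero add smult pure]:
  assumes U: "U \<in> carrier T"
    and S: "S \<subseteq> carrier V \<and> carrier V \<subseteq> add_closure V S"
    and P: "P \<zero>\<^bsub>T\<^esub>"
      "\<And>x y. x \<in> carrier T \<Longrightarrow> y \<in> carrier T \<Longrightarrow> P x \<Longrightarrow> P y \<Longrightarrow> P (x \<oplus>\<^bsub>T\<^esub> y)"
      "\<And>c x. x \<in> carrier T \<Longrightarrow> P x \<Longrightarrow> P (c \<odot>\<^bsub>T\<^esub> x)"
      "\<And>u. set u \<subseteq> S \<Longrightarrow> P (pure u)"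
  shows "P U"
proof -
  obtain p where p: "p \<in> carrier FV" and U: "U = FV.proj p"
    using U FV.carrier_Q by (auto simp: T_eq)
  show ?thesis unfolding U
    by (rule tensor_induct_lengths[where N = UNIV, OF p _ S P(1-3)]) (use P(4) in auto)
qed

lemma pure_in_tensor_power:
  assumes "set w \<subseteq> carrier V" shows "pure w \<in> tensor_power V (length w)"
proof -
  have "\<forall>u. word w u \<noteq> 0 \<longrightarrow> length u = length w" by (simp add: word_def)
  then show ?thesis using word_closed[OF assms] unfolding tensor_power_def pure_eq by blast
qed

lemma tensor_power_sub: "tensor_power V n \<subseteq> carrier T"
  using FV.carrier_Q by (auto simp: tensor_power_def T_eq)

lemma tensor_power_zero: "\<zero>\<^bsub>T\<^esub> \<in> tensor_power V n"
proof -
  have "\<forall>w. \<zero>\<^bsub>FV\<^esub> w \<noteq> 0 \<longrightarrow> length w = n" by (simp add: free_alg_simps)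
  then show ?thesis using FV.zero_closed FV.zero_Q unfolding tensor_power_def T_eq by blast
qed

lemma tensor_power_add:
  assumes "x \<in> tensor_power V n" "y \<in> tensor_power V n"
  shows "x \<oplus>\<^bsub>T\<^esub> y \<in> tensor_power V n"
proof -
  obtain p q where p: "p \<in> carrier FV" "\<And>w. p w \<noteq> 0 \<Longrightarrow> length w = n" "x = FV.proj p"
    and q: "q \<in> carrier FV" "\<And>w. q w \<noteq> 0 \<Longrightarrow> length w = n" "y = FV.proj q"
    using assms unfolding tensor_power_def by blast
  have "(p \<oplus>\<^bsub>FV\<^esub> q) w \<noteq> 0 \<Longrightarrow> length w = n" for w
    using p(2)[of w] q(2)[of w] by (cases "p w = 0") (auto simp: free_alg_simps)
  then show ?thesis unfolding tensor_power_def
    using p q FV.add_Q[of p q] by (auto simp: T_eq intro!: exI[of _ "p \<oplus>\<^bsub>FV\<^esub> q"])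
qed

lemma tensor_power_smult:
  assumes "x \<in> tensor_power V n"
  shows "c \<odot>\<^bsub>T\<^esub> x \<in> tensor_power V n"
proof -
  obtain p where p: "p \<in> carrier FV" "\<And>w. p w \<noteq> 0 \<Longrightarrow> length w = n" "x = FV.proj p"
    using assms unfolding tensor_power_def by blast
  have "(c \<odot>\<^bsub>FV\<^esub> p) w \<noteq> 0 \<Longrightarrow> length w = n" for w
    using p(2)[of w] by (auto simp: free_alg_simps)
  then show ?thesis unfolding tensor_power_def
    using p FV.smult_Q[of p c] by (auto simp: T_eq intro!: exI[of _ "c \<odot>\<^bsub>FV\<^esub> p"])
qed

lemma clinear_eqI:
  assumes "U \<in> carrier T" "S \<subseteq> carrier V" "carrier V \<subseteq> add_closure V S"
    and "cspace W" "clinear T W f" "clinear T W g"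
    and "\<And>w. set w \<subseteq> S \<Longrightarrow> f (pure w) = g (pure w)"
  shows "f U = g U"
  using assms(1)
proof (induction rule: tensor_induct[of _ S])
  case zero
  show ?case using clinear_zero[OF T.cspace_axioms assms(4,5)] clinear_zero[OF T.cspace_axioms assms(4,6)]
    by simp
qed (use assms in \<open>auto simp: clinearD(2,3)[OF assms(5)] clinearD(2,3)[OF assms(6)]\<close>)

lemma carrier_spanning: "carrier V \<subseteq> add_closure V (carrier V)"
  by (auto intro: add_closure_base)

lemma alg_hom_eqI:
  assumes U: "U \<in> carrier T" and S: "S \<subseteq> carrier V" "carrier V \<subseteq> add_closure V S"
    and B: "calgebra B" and f: "alg_hom T B f" and g: "alg_hom T B g"
    and eq: "\<And>v. v \<in> S \<Longrightarrow> f (pure [v]) = g (pure [v])"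
  shows "f U = g U"
proof -
  interpret B: calgebra B by fact
  have "set w \<subseteq> S \<Longrightarrow> f (pure w) = g (pure w)" for w
  proof (induction w)
    case Nil
    then show ?case by (simp add: pure_Nil alg_homD(5)[OF f] alg_homD(5)[OF g])
  next
    case (Cons v w)
    then have "set w \<subseteq> carrier V" "v \<in> carrier V" using S by auto
    with Cons show ?case
      using eq[of v] by (simp add: pure_Cons[of v w] alg_homD(6)[OF f] alg_homD(6)[OF g])
  qed
  then show ?thesis
    using clinear_eqI[OF U S B.cspace_axioms alg_homD(1)[OF f] alg_homD(1)[OF g]] by blast
qed

lemma alg_hom_tensor_lift:
  assumes "calgebra B" and cl: "\<And>w. set w \<subseteq> carrier V \<Longrightarrow> \<phi> w \<in> carrier B"
    and one: "\<phi> [] = \<one>\<^bsub>B\<^esub>"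
    and app: "\<And>a b. set a \<subseteq> carrier V \<Longrightarrow> set b \<subseteq> carrier V \<Longrightarrow> \<phi> (a @ b) = \<phi> a \<otimes>\<^bsub>B\<^esub> \<phi> b"
    and lin: "clinear V B (\<lambda>v. \<phi> [v])"
  shows "alg_hom T B (tensor_lift B \<phi>)" and "multilinear V B \<phi>"
proof -
  interpret B: calgebra B by fact
  show ml: "multilinear V B \<phi>" by (rule multilinear_of_mult) fact+
  let ?f = "tensor_lift B \<phi>"
  note lin = clinear_tensor_lift[OF B.cspace_axioms ml]
  note f = clinearD[OF lin] clinear_zero[OF T.cspace_axioms B.cspace_axioms lin]
    tensor_lift_pure[OF B.cspace_axioms ml]
  note S = conjI[OF subset_refl carrier_spanning]
  have *: "?f (pure a \<otimes>\<^bsub>T\<^esub> y) = \<phi> a \<otimes>\<^bsub>B\<^esub> ?f y" if "y \<in> carrier T" "set a \<subseteq> carrier V" for a y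
    using that(1)
  proof (induction rule: tensor_induct[of _ "carrier V"])
    case (pure u)
    then show ?case using that(2) by (simp add: pure_append[symmetric] f app)
  qed (use S that(2) in \<open>simp_all add: f cl T.r_distr B.r_distr\<close>)
  have "?f (x \<otimes>\<^bsub>T\<^esub> y) = ?f x \<otimes>\<^bsub>B\<^esub> ?f y" if "x \<in> carrier T" "y \<in> carrier T" for x y
    using that(1)
  proof (induction rule: tensor_induct[of _ "carrier V"])
    case (pure u)
    then show ?case using that(2) by (simp add: * f)
  qed (use S that(2) in \<open>simp_all add: f T.l_distr B.l_distr\<close>)
  then show "alg_hom T B ?f"
    using f(5)[of "[]"] by (intro alg_homI lin) (simp_all add: pure_Nil one)
qed

definition extension ::
  "(complex, 'b, 'n) module_scheme \<Rightarrow> ('v \<Rightarrow> 'b) \<Rightarrow> ('v list \<Rightarrow> complex) set \<Rightarrow> 'b" where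
  "extension B \<gamma> = tensor_lift B (\<lambda>w. foldr (\<lambda>v b. \<gamma> v \<otimes>\<^bsub>B\<^esub> b) w \<one>\<^bsub>B\<^esub>)"

lemma
  assumes "calgebra B" and \<gamma>: "clinear V B \<gamma>"
  shows alg_hom_extension: "alg_hom T B (extension B \<gamma>)"
    and extension_letter: "v \<in> carrier V \<Longrightarrow> extension B \<gamma> (pure [v]) = \<gamma> v"
proof -
  interpret B: calgebra B by fact
  note g = clinearD[OF \<gamma>]
  let ?\<phi> = "\<lambda>w. foldr (\<lambda>v b. \<gamma> v \<otimes>\<^bsub>B\<^esub> b) w \<one>\<^bsub>B\<^esub>"
  have cl: "set w \<subseteq> carrier V \<Longrightarrow> ?\<phi> w \<in> carrier B" for w
    by (induction w) (auto simp: g)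
  have app: "set a \<subseteq> carrier V \<Longrightarrow> set b \<subseteq> carrier V \<Longrightarrow> ?\<phi> (a @ b) = ?\<phi> a \<otimes>\<^bsub>B\<^esub> ?\<phi> b" for a b
    using cl[of b]
  proof (induction a)
    case (Cons v a)
    then show ?case using cl[of a] cl[of b] by (simp add: B.m_assoc g del: foldr_append)
  qed simp
  have lin: "clinear V B (\<lambda>v. ?\<phi> [v])" by (rule clinearI) (auto simp: g)
  note f = alg_hom_tensor_lift[OF B.calgebra_axioms, of ?\<phi>, OF cl _ app lin]
  show "alg_hom T B (extension B \<gamma>)" unfolding extension_def by (rule f(1)) auto
  show "extension B \<gamma> (pure [v]) = \<gamma> v" if "v \<in> carrier V"
    unfolding extension_def using that tensor_lift_pure[OF B.cspace_axioms f(2), of "[v]"]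
    by (simp add: g)
qed

end

lemma
  assumes "cspace V" "cspace W" and f: "clinear V W f"
  shows alg_hom_tensor_map: "alg_hom (tensor_alg V) (tensor_alg W) (tensor_map W f)"
    and tensor_map_pure: "set w \<subseteq> carrier V \<Longrightarrow>
      tensor_map W f (pure_tensor V w) = pure_tensor W (map f w)"
proof -
  interpret V: tensor V by (intro tensor.intro assms)
  interpret W: tensor W by (intro tensor.intro assms)
  have cl: "set (map f w) \<subseteq> carrier W" if "set w \<subseteq> carrier V" for w
    using that clinearD(1)[OF f] by auto
  have lin: "clinear V W.T (\<lambda>v. W.pure (map f [v]))"
    using clinear_comp[OF f W.clinear_pure1] by simp
  note h = V.alg_hom_tensor_lift[of W.T "\<lambda>w. W.pure (map f w)", OF W.T.calgebra_axioms _ _ _ lin]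
  show "alg_hom (tensor_alg V) (tensor_alg W) (tensor_map W f)"
    unfolding tensor_map_def by (rule h(1)) (auto simp: cl W.pure_append W.pure_Nil simp del: set_map)
  have "multilinear V W.T (\<lambda>w. W.pure (map f w))"
    by (rule h(2)) (auto simp: cl W.pure_append W.pure_Nil simp del: set_map)
  then show "set w \<subseteq> carrier V \<Longrightarrow> tensor_map W f (pure_tensor V w) = pure_tensor W (map f w)"
    unfolding tensor_map_def by (rule V.tensor_lift_pure[OF W.T.cspace_axioms])
qed


section \<open>Smash products and gradings\<close>

locale smash_product = G: group G + A: calgebra A
  for G :: "('g, 'a) monoid_scheme" and A :: "(complex, 'b, 'm) module_scheme" (structure) +
  fixes act :: "'g \<Rightarrow> 'b \<Rightarrow> 'b"
  assumes act_hom: "g \<in> carrier G \<Longrightarrow> alg_hom A A (act g)"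
    and act_one: "x \<in> carrier A \<Longrightarrow> act \<one>\<^bsub>G\<^esub> x = x"
    and act_mult: "g \<in> carrier G \<Longrightarrow> h \<in> carrier G \<Longrightarrow> x \<in> carrier A \<Longrightarrow>
      act (g \<otimes>\<^bsub>G\<^esub> h) x = act g (act h x)"
begin

abbreviation S where "S \<equiv> smash G A act"
abbreviation supp where "supp x \<equiv> {g. x g \<noteq> \<zero>}"

definition single :: "'b \<Rightarrow> 'g \<Rightarrow> 'g \<Rightarrow> 'b" where
  "single a g = (\<lambda>h. if h = g then a else \<zero>)"

lemma smash_simps:
  "carrier S = {x. (\<forall>g\<in>carrier G. x g \<in> carrier A) \<and> (\<forall>g. g \<notin> carrier G \<longrightarrow> x g = \<zero>) \<and>
                   finite (supp x)}"
  "\<one>\<^bsub>S\<^esub> = single \<one> \<one>\<^bsub>G\<^esub>"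
  "\<zero>\<^bsub>S\<^esub> = (\<lambda>_. \<zero>)"
  "x \<oplus>\<^bsub>S\<^esub> y = (\<lambda>g. x g \<oplus> y g)"
  "c \<odot>\<^bsub>S\<^esub> x = (\<lambda>g. c \<odot> x g)"
  by (simp_all add: smash_def single_def)

lemma smash_grp_eq: "smash_grp A g = single \<one> g"
  by (simp add: smash_grp_def single_def fun_eq_iff)

lemma smash_alg_eq: "smash_alg G A a = single a \<one>\<^bsub>G\<^esub>"
  by (simp add: smash_alg_def single_def fun_eq_iff)

lemma coeff_closed: "x \<in> carrier S \<Longrightarrow> x g \<in> carrier A"
  by (cases "g \<in> carrier G") (auto simp: smash_simps)

lemma supp_props: 
  assumes "x \<in> carrier S" 
  shows "finite (supp x)" "supp x \<subseteq> carrier G" "x g \<noteq> \<zero> \<Longrightarrow> g \<in> carrier G"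
  using assms by (auto simp: smash_simps)

lemma outside: "x \<in> carrier S \<Longrightarrow> g \<notin> carrier G \<Longrightarrow> x g = \<zero>"
  by (auto simp: smash_simps)

lemma smash_eqI:
  assumes "x \<in> carrier S" "y \<in> carrier S" "\<And>g. g \<in> carrier G \<Longrightarrow> x g = y g"
  shows "x = y"
proof
  show "x g = y g" for g
    using assms outside[of x g] outside[of y g] by (cases "g \<in> carrier G") auto
qed

lemma act_closed: "g \<in> carrier G \<Longrightarrow> x \<in> carrier A \<Longrightarrow> act g x \<in> carrier A"
  by (rule alg_homD(2)[OF act_hom])

lemmas act_simps = act_closed alg_homD(3-6)[OF act_hom]
  alg_hom_zero[OF A.calgebra_axioms A.calgebra_axioms act_hom]

lemma single_closed: "a \<in> carrier A \<Longrightarrow> g \<in> carrier G \<Longrightarrow> single a g \<in> carrier S"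
proof -
  assume a: "a \<in> carrier A" "g \<in> carrier G"
  have "finite {h. single a g h \<noteq> \<zero>}"
    by (rule finite_subset[of _ "{g}"]) (auto simp: single_def)
  then show ?thesis using a by (auto simp: smash_simps single_def)
qed

lemma single_same [simp]: "single a g g = a"
  by (simp add: single_def)

lemma single_zero: "single \<zero> g = \<zero>\<^bsub>S\<^esub>"
  by (auto simp: single_def smash_simps)

lemma single_add:
  "a \<in> carrier A \<Longrightarrow> b \<in> carrier A \<Longrightarrow> single (a \<oplus> b) g = single a g \<oplus>\<^bsub>S\<^esub> single b g"
  by (auto simp: single_def smash_simps)

lemma single_smult: "a \<in> carrier A \<Longrightarrow> single (c \<odot> a) g = c \<odot>\<^bsub>S\<^esub> single a g"
  by (auto simp: single_def smash_simps)

lemma cspace_smash: "cspace S"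
proof (rule cspaceI)
  fix x y assume xy: "x \<in> carrier S" "y \<in> carrier S"
  have "finite {g. x g \<oplus> y g \<noteq> \<zero>}"
    by (rule finite_subset[of _ "supp x \<union> supp y"]) (use xy supp_props in auto)
  then show "x \<oplus>\<^bsub>S\<^esub> y \<in> carrier S" using xy by (auto simp: smash_simps)
  show "x \<oplus>\<^bsub>S\<^esub> y = y \<oplus>\<^bsub>S\<^esub> x"
    using xy coeff_closed by (auto simp: smash_simps(4) fun_eq_iff intro: A.a_comm)
next
  fix c x assume x: "x \<in> carrier S"
  have "finite {g. c \<odot> x g \<noteq> \<zero>}"
    by (rule finite_subset[of _ "supp x"]) (use x supp_props in auto)
  then show "c \<odot>\<^bsub>S\<^esub> x \<in> carrier S" using x by (auto simp: smash_simps)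
qed (auto simp: smash_simps(3-5) fun_eq_iff coeff_closed A.a_assoc A.smult_plus_left
      A.smult_plus_right A.smult_smult, simp add: smash_simps)

end

sublocale smash_product \<subseteq> SV: cspace "smash G A act"
  by (rule cspace_smash)

context smash_product
begin

lemma mult_apply:
  assumes x: "x \<in> carrier S" and y: "y \<in> carrier S" and k: "k \<in> carrier G"
    and B: "finite B" "supp x \<subseteq> B" "B \<subseteq> carrier G"
  shows "(x \<otimes>\<^bsub>S\<^esub> y) k = (\<Oplus>g\<in>B. x g \<otimes> act g (y (inv\<^bsub>G\<^esub> g \<otimes>\<^bsub>G\<^esub> k)))"
proof -
  have "(x \<otimes>\<^bsub>S\<^esub> y) k = (\<Oplus>g\<in>supp x. x g \<otimes> act g (y (inv\<^bsub>G\<^esub> g \<otimes>\<^bsub>G\<^esub> k)))"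
    using k by (simp add: smash_def)
  also have "\<dots> = (\<Oplus>g\<in>B. x g \<otimes> act g (y (inv\<^bsub>G\<^esub> g \<otimes>\<^bsub>G\<^esub> k)))"
    by (rule A.finsum_extend)
      (use B k x y in \<open>auto simp: subsetD act_closed coeff_closed\<close>)
  finally show ?thesis .
qed

lemma mult_closed:
  assumes x: "x \<in> carrier S" and y: "y \<in> carrier S"
  shows "x \<otimes>\<^bsub>S\<^esub> y \<in> carrier S"
proof -
  note sx = supp_props[OF x]
  have term_cl: "x g \<otimes> act g (y (inv\<^bsub>G\<^esub> g \<otimes>\<^bsub>G\<^esub> k)) \<in> carrier A" if "g \<in> carrier G" for g k
    using that x y by (simp add: act_closed coeff_closed)
  have cl: "(x \<otimes>\<^bsub>S\<^esub> y) k \<in> carrier A" if "k \<in> carrier G" for k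
    using mult_apply[OF x y that sx(1) subset_refl sx(2)] term_cl sx(2) by (auto intro: A.finsum_closed)
  have "{k. (x \<otimes>\<^bsub>S\<^esub> y) k \<noteq> \<zero>} \<subseteq>
      (\<lambda>(g, h). g \<otimes>\<^bsub>G\<^esub> h) ` (supp x \<times> supp y)"
  proof
    fix k assume k: "k \<in> {k. (x \<otimes>\<^bsub>S\<^esub> y) k \<noteq> \<zero>}"
    then have kG: "k \<in> carrier G" by (auto simp: smash_def split: if_splits)
    obtain g where g: "x g \<noteq> \<zero>" "y (inv\<^bsub>G\<^esub> g \<otimes>\<^bsub>G\<^esub> k) \<noteq> \<zero>"
    proof (rule ccontr)
      assume "\<not> thesis"
      then have "\<And>g. x g \<noteq> \<zero> \<Longrightarrow> y (inv\<^bsub>G\<^esub> g \<otimes>\<^bsub>G\<^esub> k) = \<zero>" using that by blast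
      then have "(\<Oplus>g\<in>supp x. x g \<otimes> act g (y (inv\<^bsub>G\<^esub> g \<otimes>\<^bsub>G\<^esub> k))) = \<zero>"
        using sx(3) x by (intro A.add.finprod_one_eqI) (simp add: act_simps coeff_closed)
      then show False using k mult_apply[OF x y kG sx(1) subset_refl sx(2)] by simp
    qed
    then have "k = g \<otimes>\<^bsub>G\<^esub> (inv\<^bsub>G\<^esub> g \<otimes>\<^bsub>G\<^esub> k)" using sx(3) kG by (simp add: G.m_assoc[symmetric])
    then show "k \<in> (\<lambda>(g, h). g \<otimes>\<^bsub>G\<^esub> h) ` (supp x \<times> supp y)"
      using g by (intro image_eqI[of _ _ "(g, inv\<^bsub>G\<^esub> g \<otimes>\<^bsub>G\<^esub> k)"]) auto
  qed
  then have "finite {k. (x \<otimes>\<^bsub>S\<^esub> y) k \<noteq> \<zero>}"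
    using supp_props(1)[OF x] supp_props(1)[OF y] by (meson finite_SigmaI finite_imageI finite_subset)
  moreover have "(x \<otimes>\<^bsub>S\<^esub> y) k = \<zero>" if "k \<notin> carrier G" for k
    using that by (simp add: smash_def)
  ultimately show ?thesis using cl unfolding smash_simps(1) by blast
qed

lemma single_mult_apply:
  assumes "a \<in> carrier A" "g \<in> carrier G" "y \<in> carrier S" "k \<in> carrier G"
  shows "(single a g \<otimes>\<^bsub>S\<^esub> y) k = a \<otimes> act g (y (inv\<^bsub>G\<^esub> g \<otimes>\<^bsub>G\<^esub> k))"
proof -
  have "{h. single a g h \<noteq> \<zero>} \<subseteq> {g}" by (auto simp: single_def)
  then show ?thesis
    using mult_apply[OF single_closed[OF assms(1,2)] assms(3,4), of "{g}"] assms
    by (simp add: act_closed coeff_closed)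
qed

lemma single_mult_single:
  assumes "a \<in> carrier A" "g \<in> carrier G" "b \<in> carrier A" "h \<in> carrier G"
  shows "single a g \<otimes>\<^bsub>S\<^esub> single b h = single (a \<otimes> act g b) (g \<otimes>\<^bsub>G\<^esub> h)"
proof (rule smash_eqI)
  fix k assume k: "k \<in> carrier G"
  have "inv\<^bsub>G\<^esub> g \<otimes>\<^bsub>G\<^esub> k = h \<longleftrightarrow> k = g \<otimes>\<^bsub>G\<^esub> h"
    using G.inv_solve_left[of h g k] assms k by auto
  then show "(single a g \<otimes>\<^bsub>S\<^esub> single b h) k = single (a \<otimes> act g b) (g \<otimes>\<^bsub>G\<^esub> h) k"
    using single_mult_apply[OF assms(1,2) single_closed[OF assms(3,4)] k] assms
    by (auto simp: single_def act_simps)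
qed (use assms in \<open>simp_all add: mult_closed single_closed act_closed\<close>)

lemma smash_induct [consumes 1, case_names zero add]:
  assumes x: "x \<in> carrier S"
    and P0: "P \<zero>\<^bsub>S\<^esub>"
    and Padd: "\<And>a g x. a \<in> carrier A \<Longrightarrow> g \<in> carrier G \<Longrightarrow> x \<in> carrier S \<Longrightarrow> P x \<Longrightarrow>
      P (single a g \<oplus>\<^bsub>S\<^esub> x)"
  shows "P x"
proof -
  have "finite B \<Longrightarrow> x \<in> carrier S \<Longrightarrow> supp x \<subseteq> B \<Longrightarrow> P x" for B x
  proof (induction B arbitrary: x rule: finite_induct)
    case empty
    then have "x = \<zero>\<^bsub>S\<^esub>" by (auto simp: smash_simps)
    then show ?case using P0 by simp
  next
    case (insert g B)
    define y where "y = (\<lambda>h. if h = g then \<zero> else x h)"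
    have "supp y \<subseteq> {h. x h \<noteq> \<zero>}" by (auto simp: y_def)
    then have y: "y \<in> carrier S" using insert.prems(1)
      by (auto simp: smash_simps y_def intro: finite_subset)
    have "supp y \<subseteq> B" using insert.prems(2) by (auto simp: y_def split: if_splits)
    then have Py: "P y" by (rule insert.IH[OF y])
    show ?case
    proof (cases "x g = \<zero>")
      case True
      then have "x = y" by (auto simp: y_def)
      then show ?thesis using Py by simp
    next
      case False
      then have g: "g \<in> carrier G" using supp_props(3) insert.prems by blast
      have xg: "x g \<in> carrier A" using coeff_closed insert.prems by blast
      have "x = single (x g) g \<oplus>\<^bsub>S\<^esub> y"
        using insert.prems coeff_closed by (auto simp: smash_simps(4) single_def y_def)
      then show ?thesis using Padd[OF xg g y Py] by simp
    qed
  qed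
  from this[OF supp_props(1)[OF x] x] show ?thesis by simp
qed

lemma clinear_mult_right:
  assumes z: "z \<in> carrier S"
  shows "clinear S S (\<lambda>x. x \<otimes>\<^bsub>S\<^esub> z)"
proof (rule clinearI)
  have m: "(x \<otimes>\<^bsub>S\<^esub> z) k = (\<Oplus>g\<in>supp x. x g \<otimes> act g (z (inv\<^bsub>G\<^esub> g \<otimes>\<^bsub>G\<^esub> k)))"
    if "k \<in> carrier G" for x k
    using that by (simp add: smash_def)
  fix x assume x: "x \<in> carrier S"
  show "(c \<odot>\<^bsub>S\<^esub> x) \<otimes>\<^bsub>S\<^esub> z = c \<odot>\<^bsub>S\<^esub> (x \<otimes>\<^bsub>S\<^esub> z)" for c
  proof (rule smash_eqI)
    fix k assume k: "k \<in> carrier G"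
    show "((c \<odot>\<^bsub>S\<^esub> x) \<otimes>\<^bsub>S\<^esub> z) k = (c \<odot>\<^bsub>S\<^esub> (x \<otimes>\<^bsub>S\<^esub> z)) k"
      unfolding smash_simps(5) m[OF k]
      by (rule A.finsum_support_smult)
        (use k x z supp_props[OF x] in \<open>auto simp: act_closed coeff_closed\<close>)
  qed (use x z in \<open>simp_all add: mult_closed\<close>)
  fix y assume y: "y \<in> carrier S"
  show "(x \<oplus>\<^bsub>S\<^esub> y) \<otimes>\<^bsub>S\<^esub> z = x \<otimes>\<^bsub>S\<^esub> z \<oplus>\<^bsub>S\<^esub> y \<otimes>\<^bsub>S\<^esub> z"
  proof (rule smash_eqI)
    fix k assume k: "k \<in> carrier G"
    show "((x \<oplus>\<^bsub>S\<^esub> y) \<otimes>\<^bsub>S\<^esub> z) k = (x \<otimes>\<^bsub>S\<^esub> z \<oplus>\<^bsub>S\<^esub> y \<otimes>\<^bsub>S\<^esub> z) k"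
      unfolding smash_simps(4) m[OF k]
      by (rule A.finsum_support_add)
        (use k x y z supp_props[OF x] supp_props[OF y] in \<open>auto simp: act_closed coeff_closed A.l_distr\<close>)
  qed (use x y z in \<open>simp_all add: mult_closed\<close>)
qed (use z in \<open>simp add: mult_closed\<close>)

lemma clinear_mult_left:
  assumes z: "z \<in> carrier S"
  shows "clinear S S (\<lambda>x. z \<otimes>\<^bsub>S\<^esub> x)"
proof (rule clinearI)
  have m: "clinear S A (\<lambda>x. \<Oplus>g\<in>supp z. z g \<otimes> act g (x (inv\<^bsub>G\<^esub> g \<otimes>\<^bsub>G\<^esub> k)))" for k
    by (intro clinear_sum_of A.cspace_axioms clinearI)
      (use z supp_props[OF z] in \<open>auto simp: act_simps coeff_closed smash_simps(4,5) A.r_distr\<close>)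
  have eq: "(z \<otimes>\<^bsub>S\<^esub> x) k = (\<Oplus>g\<in>supp z. z g \<otimes> act g (x (inv\<^bsub>G\<^esub> g \<otimes>\<^bsub>G\<^esub> k)))"
    if "k \<in> carrier G" for x k
    using that by (simp add: smash_def)
  fix x assume x: "x \<in> carrier S"
  show "z \<otimes>\<^bsub>S\<^esub> (c \<odot>\<^bsub>S\<^esub> x) = c \<odot>\<^bsub>S\<^esub> (z \<otimes>\<^bsub>S\<^esub> x)" for c
  proof (rule smash_eqI)
    fix k assume "k \<in> carrier G"
    then show "(z \<otimes>\<^bsub>S\<^esub> (c \<odot>\<^bsub>S\<^esub> x)) k = (c \<odot>\<^bsub>S\<^esub> (z \<otimes>\<^bsub>S\<^esub> x)) k"
      using clinearD(3)[OF m x, of c k] by (simp add: eq smash_simps(5))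
  qed (use x z in \<open>simp_all add: mult_closed\<close>)
  fix y assume y: "y \<in> carrier S"
  show "z \<otimes>\<^bsub>S\<^esub> (x \<oplus>\<^bsub>S\<^esub> y) = z \<otimes>\<^bsub>S\<^esub> x \<oplus>\<^bsub>S\<^esub> z \<otimes>\<^bsub>S\<^esub> y"
  proof (rule smash_eqI)
    fix k assume "k \<in> carrier G"
    then show "(z \<otimes>\<^bsub>S\<^esub> (x \<oplus>\<^bsub>S\<^esub> y)) k = (z \<otimes>\<^bsub>S\<^esub> x \<oplus>\<^bsub>S\<^esub> z \<otimes>\<^bsub>S\<^esub> y) k"
      using clinearD(2)[OF m x y, of k] by (simp add: eq smash_simps(4))
  qed (use x y z in \<open>simp_all add: mult_closed\<close>)
qed (use z in \<open>simp add: mult_closed\<close>)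

lemmas mult_l_distr = clinearD(2)[OF clinear_mult_right]
lemmas mult_r_distr = clinearD(2)[OF clinear_mult_left]
lemmas mult_smult_left = clinearD(3)[OF clinear_mult_right]
lemmas mult_smult_right = clinearD(3)[OF clinear_mult_left]
lemmas zero_mult = clinear_zero[OF cspace_smash cspace_smash clinear_mult_right]
lemmas mult_zero = clinear_zero[OF cspace_smash cspace_smash clinear_mult_left]

text \<open>
  Both sides are additive in each factor, so associativity is only computed for \<open>x = a g\<close> and
  \<open>y = b h\<close>, where it says that \<open>g\<close> acts multiplicatively and that the action is one of a group.
\<close>

lemma mult_assoc:
  assumes x: "x \<in> carrier S" and y: "y \<in> carrier S" and z: "z \<in> carrier S"
  shows "x \<otimes>\<^bsub>S\<^esub> y \<otimes>\<^bsub>S\<^esub> z = x \<otimes>\<^bsub>S\<^esub> (y \<otimes>\<^bsub>S\<^esub> z)"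
proof -
  have 1: "single a g \<otimes>\<^bsub>S\<^esub> single b h \<otimes>\<^bsub>S\<^esub> z = single a g \<otimes>\<^bsub>S\<^esub> (single b h \<otimes>\<^bsub>S\<^esub> z)"
    if "a \<in> carrier A" "g \<in> carrier G" "b \<in> carrier A" "h \<in> carrier G" for a g b h
  proof (rule smash_eqI)
    fix k assume k: "k \<in> carrier G"
    show "(single a g \<otimes>\<^bsub>S\<^esub> single b h \<otimes>\<^bsub>S\<^esub> z) k = (single a g \<otimes>\<^bsub>S\<^esub> (single b h \<otimes>\<^bsub>S\<^esub> z)) k"
      using that z k
      by (simp add: single_mult_single single_mult_apply mult_closed single_closed act_simps
        coeff_closed A.m_assoc act_mult G.inv_mult_group G.m_assoc)
  qed (use that z in \<open>simp_all add: mult_closed single_closed\<close>)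
  have 2: "single a g \<otimes>\<^bsub>S\<^esub> y \<otimes>\<^bsub>S\<^esub> z = single a g \<otimes>\<^bsub>S\<^esub> (y \<otimes>\<^bsub>S\<^esub> z)"
    if "a \<in> carrier A" "g \<in> carrier G" for a g
    using y
  proof (induction y rule: smash_induct)
    case (add b h y)
    then show ?case using that z
      by (simp add: mult_r_distr mult_l_distr mult_closed single_closed 1)
  qed (use that z in \<open>simp add: mult_closed single_closed zero_mult mult_zero\<close>)
  show ?thesis using x
  proof (induction x rule: smash_induct)
    case (add b h x)
    then show ?case using y z by (simp add: mult_l_distr mult_closed single_closed 2)
  qed (use y z in \<open>simp add: mult_closed zero_mult\<close>)
qed

lemma calgebra_smash: "calgebra S"
proof (rule calgebraI)
  fix x assume x: "x \<in> carrier S"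
  show "\<one>\<^bsub>S\<^esub> \<otimes>\<^bsub>S\<^esub> x = x"
    by (rule smash_eqI)
      (use x in \<open>simp_all add: smash_simps(2) mult_closed single_closed single_mult_apply coeff_closed act_one\<close>)
  show "x \<otimes>\<^bsub>S\<^esub> \<one>\<^bsub>S\<^esub> = x" using x
  proof (induction x rule: smash_induct)
    case (add a g x)
    then show ?case
      by (simp add: smash_simps(2) mult_l_distr mult_closed single_closed single_mult_single act_simps)
  qed (simp add: zero_mult smash_simps(2) single_closed)
qed (simp_all add: cspace_smash mult_closed smash_simps(2) single_closed mult_assoc mult_l_distr
      mult_r_distr mult_smult_left mult_smult_right)

end

sublocale smash_product \<subseteq> S: calgebra "smash G A act"
  by (rule calgebra_smash)

context smash_product
begin

lemma alg_hom_coefficient: "alg_hom A S (\<lambda>a. single a \<one>\<^bsub>G\<^esub>)"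
  by (intro alg_homI clinearI)
    (simp_all add: single_closed single_add single_smult single_mult_single act_one smash_simps(2))

lemma clinear_coeff: "clinear S A (\<lambda>x. x g)"
  by (intro clinearI) (auto simp: coeff_closed smash_simps(4,5))

definition smash_ext ::
  "(complex, 'c, 'n) module_scheme \<Rightarrow> ('b \<Rightarrow> 'c) \<Rightarrow> ('g \<Rightarrow> 'c) \<Rightarrow> ('g \<Rightarrow> 'b) \<Rightarrow> 'c" where
  "smash_ext B \<theta> \<iota> x = (\<Oplus>\<^bsub>B\<^esub>g\<in>supp x. \<theta> (x g) \<otimes>\<^bsub>B\<^esub> \<iota> g)"

text \<open>
  The universal property of the smash product: a homomorphism of \<open>A\<close> and a multiplicative map of
  \<open>G\<close> fit together if they satisfy the commutation rule of \<open>A\<close> and \<open>G\<close>.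
\<close>

lemma
  assumes "calgebra B" and \<theta>: "alg_hom A B \<theta>"
    and \<iota>: "\<And>g. g \<in> carrier G \<Longrightarrow> \<iota> g \<in> carrier B" "\<iota> \<one>\<^bsub>G\<^esub> = \<one>\<^bsub>B\<^esub>"
      "\<And>g h. g \<in> carrier G \<Longrightarrow> h \<in> carrier G \<Longrightarrow> \<iota> (g \<otimes>\<^bsub>G\<^esub> h) = \<iota> g \<otimes>\<^bsub>B\<^esub> \<iota> h"
    and comm: "\<And>g a. g \<in> carrier G \<Longrightarrow> a \<in> carrier A \<Longrightarrow> \<iota> g \<otimes>\<^bsub>B\<^esub> \<theta> a = \<theta> (act g a) \<otimes>\<^bsub>B\<^esub> \<iota> g"
  shows alg_hom_smash_ext: "alg_hom S B (smash_ext B \<theta> \<iota>)"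
    and smash_ext_single: "a \<in> carrier A \<Longrightarrow> g \<in> carrier G \<Longrightarrow>
      smash_ext B \<theta> \<iota> (single a g) = \<theta> a \<otimes>\<^bsub>B\<^esub> \<iota> g"
proof -
  interpret B: calgebra B by fact
  note t = alg_homD[OF \<theta>] alg_hom_zero[OF A.calgebra_axioms B.calgebra_axioms \<theta>]
  let ?f = "smash_ext B \<theta> \<iota>"
  have term_cl: "\<theta> (x g) \<otimes>\<^bsub>B\<^esub> \<iota> g \<in> carrier B" if "x \<in> carrier S" "g \<in> carrier G" for x g
    using that by (simp add: t \<iota> coeff_closed)
  have cl: "?f x \<in> carrier B" if "x \<in> carrier S" for x
    unfolding smash_ext_def using term_cl supp_props that by (intro B.finsum_closed) auto
  show single: "?f (single a g) = \<theta> a \<otimes>\<^bsub>B\<^esub> \<iota> g" if "a \<in> carrier A" "g \<in> carrier G" for a g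
  proof -
    have "?f (single a g) = \<theta> (single a g g) \<otimes>\<^bsub>B\<^esub> \<iota> g"
      unfolding smash_ext_def
      by (rule B.finsum_support_single) (use that in \<open>auto simp: single_def t \<iota>\<close>)
    then show ?thesis by simp
  qed
  have f_add: "?f (x \<oplus>\<^bsub>S\<^esub> y) = ?f x \<oplus>\<^bsub>B\<^esub> ?f y" if x: "x \<in> carrier S" and y: "y \<in> carrier S" for x y
    unfolding smash_ext_def smash_simps(4)
    by (rule B.finsum_support_add)
      (use supp_props[OF x] supp_props[OF y] x y in \<open>auto simp: t \<iota> coeff_closed B.l_distr\<close>)
  have smult: "?f (c \<odot>\<^bsub>S\<^esub> x) = c \<odot>\<^bsub>B\<^esub> ?f x" if x: "x \<in> carrier S" for x c
    using x
  proof (induction x rule: smash_induct)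
    case zero
    have "?f \<zero>\<^bsub>S\<^esub> = \<zero>\<^bsub>B\<^esub>" by (simp add: smash_ext_def smash_simps(3))
    then show ?case by simp
  next
    case (add a g x)
    then show ?case
      by (simp add: SV.smult_plus_right single_closed f_add
        single_smult[symmetric] single t \<iota> B.smult_plus_right cl)
  qed
  have lin: "clinear S B ?f" by (intro clinearI cl f_add smult)
  have f_zero: "?f \<zero>\<^bsub>S\<^esub> = \<zero>\<^bsub>B\<^esub>" by (rule clinear_zero[OF SV.cspace_axioms B.cspace_axioms lin])
  have 1: "?f (single a g \<otimes>\<^bsub>S\<^esub> y) = ?f (single a g) \<otimes>\<^bsub>B\<^esub> ?f y"
    if a: "a \<in> carrier A" "g \<in> carrier G" and y: "y \<in> carrier S" for a g y
    using y
  proof (induction y rule: smash_induct)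
    case zero
    then show ?case using a by (simp add: f_zero cl single_closed)
  next
    case (add b h y)
    \<comment> \<open>On \<open>(a g) (b h) = a (g \<triangleright> b) g h\<close> the commutation rule undoes the action of \<open>g\<close>.\<close>
    have "?f (single a g \<otimes>\<^bsub>S\<^esub> single b h) = \<theta> a \<otimes>\<^bsub>B\<^esub> (\<theta> (act g b) \<otimes>\<^bsub>B\<^esub> \<iota> g) \<otimes>\<^bsub>B\<^esub> \<iota> h"
      using a add.hyps by (simp add: single_mult_single single act_closed t \<iota> B.m_assoc)
    also have "\<dots> = ?f (single a g) \<otimes>\<^bsub>B\<^esub> ?f (single b h)"
      using a add.hyps by (simp add: comm[symmetric] single t \<iota> B.m_assoc)
    finally show ?case
      using a add by (simp add: S.r_distr single_closed clinearD(2)[OF lin] B.r_distr cl)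
  qed
  have "?f (x \<otimes>\<^bsub>S\<^esub> y) = ?f x \<otimes>\<^bsub>B\<^esub> ?f y" if x: "x \<in> carrier S" and y: "y \<in> carrier S" for x y
    using x
  proof (induction x rule: smash_induct)
    case zero
    then show ?case using y by (simp add: f_zero cl)
  next
    case (add b h x)
    then show ?case using y
      by (simp add: S.l_distr single_closed clinearD(2)[OF lin] B.l_distr cl 1)
  qed
  then show "alg_hom S B ?f"
    by (intro alg_homI lin) (auto simp: smash_simps(2) single t \<iota>)
qed

end


subsection \<open>Coactions\<close>

text \<open>With the trivial action of \<open>G\<close>, the smash product is \<open>A \<otimes> \<complex>G\<close>.\<close>

abbreviation group_alg where "group_alg G A \<equiv> smash G A (\<lambda>_ x. x)"

lemma smash_product_trivial: "group G \<Longrightarrow> calgebra A \<Longrightarrow> smash_product G A (\<lambda>_ x. x)"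
  by (intro smash_product.intro smash_product_axioms.intro)
    (auto simp: alg_hom_def clinear_def)

lemma alg_hom_coefficientwise:
  fixes G :: "('g, 'a) monoid_scheme" and A :: "(complex, 'b, 'm) module_scheme"
  assumes "group G" "calgebra A" "calgebra B" and f: "alg_hom A B f"
  shows "alg_hom (group_alg G A) (group_alg G B) (\<lambda>x g. f (x g))"
proof -
  interpret A: smash_product G A "\<lambda>_ x. x" by (intro smash_product_trivial assms)
  interpret B: smash_product G B "\<lambda>_ x. x" by (intro smash_product_trivial assms)
  note f' = alg_homD[OF f] alg_hom_zero[OF A.A.calgebra_axioms B.A.calgebra_axioms f]
  let ?f = "\<lambda>x g. f (x g)"
  have sub: "{g. f (x g) \<noteq> \<zero>\<^bsub>B\<^esub>} \<subseteq> {g. x g \<noteq> \<zero>\<^bsub>A\<^esub>}" for x :: "'g \<Rightarrow> 'b"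
    using f' by auto
  have cl: "?f x \<in> carrier B.S" if "x \<in> carrier A.S" for x
    using that finite_subset[OF sub] by (auto simp: A.smash_simps(1) B.smash_simps(1) f')
  show ?thesis
  proof (intro alg_homI clinearI cl)
    fix x y assume x: "x \<in> carrier A.S" and y: "y \<in> carrier A.S"
    show "?f (x \<otimes>\<^bsub>A.S\<^esub> y) = ?f x \<otimes>\<^bsub>B.S\<^esub> ?f y"
    proof (rule B.smash_eqI)
      fix k assume k: "k \<in> carrier G"
      note s = A.supp_props[OF x]
      have "f ((x \<otimes>\<^bsub>A.S\<^esub> y) k) = f (\<Oplus>\<^bsub>A\<^esub>g\<in>{g. x g \<noteq> \<zero>\<^bsub>A\<^esub>}. x g \<otimes>\<^bsub>A\<^esub> y (inv\<^bsub>G\<^esub> g \<otimes>\<^bsub>G\<^esub> k))"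
        using A.mult_apply[OF x y k s(1) subset_refl s(2)] by simp
      also have "\<dots> = (\<Oplus>\<^bsub>B\<^esub>g\<in>{g. x g \<noteq> \<zero>\<^bsub>A\<^esub>}. f (x g \<otimes>\<^bsub>A\<^esub> y (inv\<^bsub>G\<^esub> g \<otimes>\<^bsub>G\<^esub> k)))"
        by (rule clinear_finsum[OF A.A.cspace_axioms B.A.cspace_axioms f'(1)])
          (use x y in \<open>auto simp: A.coeff_closed\<close>)
      also have "\<dots> = (\<Oplus>\<^bsub>B\<^esub>g\<in>{g. x g \<noteq> \<zero>\<^bsub>A\<^esub>}. f (x g) \<otimes>\<^bsub>B\<^esub> f (y (inv\<^bsub>G\<^esub> g \<otimes>\<^bsub>G\<^esub> k)))"
        by (rule B.A.finsum_cong') (use x y in \<open>auto simp: A.coeff_closed f'\<close>)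
      also have "\<dots> = (?f x \<otimes>\<^bsub>B.S\<^esub> ?f y) k"
        by (rule B.mult_apply[symmetric]) (use x y cl k s sub in auto)
      finally show "f ((x \<otimes>\<^bsub>A.S\<^esub> y) k) = (?f x \<otimes>\<^bsub>B.S\<^esub> ?f y) k" .
    qed (use x y cl in simp_all)
    show "?f (x \<oplus>\<^bsub>A.S\<^esub> y) = ?f x \<oplus>\<^bsub>B.S\<^esub> ?f y"
      using x y by (auto simp: A.smash_simps(4) B.smash_simps(4) A.coeff_closed f')
  next
    fix c x assume x: "x \<in> carrier A.S"
    show "?f (c \<odot>\<^bsub>A.S\<^esub> x) = c \<odot>\<^bsub>B.S\<^esub> ?f x"
      using x by (auto simp: A.smash_simps(5) B.smash_simps(5) A.coeff_closed f')
  next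
    show "?f \<one>\<^bsub>A.S\<^esub> = \<one>\<^bsub>B.S\<^esub>"
      by (auto simp: A.smash_simps(2) B.smash_simps(2) A.single_def B.single_def f')
  qed
qed

locale coaction = A: smash_product G A "\<lambda>_ x. x"
  for G :: "('g, 'a) monoid_scheme" and A :: "(complex, 'b, 'm) module_scheme" (structure) +
  fixes \<delta> :: "'b \<Rightarrow> 'g \<Rightarrow> 'b"
  assumes coact: "alg_hom A (group_alg G A) \<delta>"
begin

definition degree_part :: "'g \<Rightarrow> 'b set" where
  "degree_part g = {x \<in> carrier A. \<delta> x = A.single x g}"

lemma degree_part_sub: "degree_part g \<subseteq> carrier A"
  by (auto simp: degree_part_def)

lemma degree_part_Union_sub: "(\<Union>g\<in>carrier G. degree_part g) \<subseteq> carrier A"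
  by (auto simp: degree_part_def)

lemma degree_part_apply: "x \<in> degree_part g \<Longrightarrow> \<delta> x h = (if h = g then x else \<zero>)"
  by (auto simp: degree_part_def A.single_def)

lemma degree_part_zero: "\<zero> \<in> degree_part g"
  using alg_hom_zero[OF A.A.calgebra_axioms A.calgebra_smash coact]
  by (simp add: degree_part_def A.single_zero)

lemma degree_part_add: "x \<in> degree_part g \<Longrightarrow> y \<in> degree_part g \<Longrightarrow> x \<oplus> y \<in> degree_part g"
  by (auto simp: degree_part_def A.single_add alg_homD[OF coact])

lemma degree_part_smult: "x \<in> degree_part g \<Longrightarrow> c \<odot> x \<in> degree_part g"
  by (auto simp: degree_part_def A.single_smult alg_homD[OF coact])

lemma degree_part_one: "\<one> \<in> degree_part \<one>\<^bsub>G\<^esub>"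
  by (simp add: degree_part_def alg_homD(5)[OF coact] A.smash_simps(2))

lemma degree_part_mult:
  assumes "g \<in> carrier G" "h \<in> carrier G" "x \<in> degree_part g" "y \<in> degree_part h"
  shows "x \<otimes> y \<in> degree_part (g \<otimes>\<^bsub>G\<^esub> h)"
  using assms by (auto simp: degree_part_def A.single_mult_single alg_homD[OF coact])

lemma clinear_part: "clinear A A (\<lambda>x. \<delta> x g)"
  using clinear_comp[OF alg_homD(1)[OF coact] A.clinear_coeff] .

lemmas part_simps = clinearD[OF clinear_part] clinear_zero[OF A.A.cspace_axioms A.A.cspace_axioms clinear_part]

end

text \<open>
  A grading by \<open>G\<close> is the same as a coaction of the group algebra. The \<open>g\<close>-component of \<open>x\<close> is the
  coefficient of \<open>\<delta> x\<close> at \<open>g\<close>, which makes the decomposition unique at once; that there is one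
  only has to be known on a spanning set.
\<close>

locale spanned_coaction = coaction +
  assumes spanned: "carrier A \<subseteq> add_closure A (\<Union>g\<in>carrier G. degree_part g)"
begin

lemma part_decomposition:
  assumes "x \<in> carrier A"
  shows "g \<in> carrier G \<Longrightarrow> \<delta> x g \<in> degree_part g" and "x = (\<Oplus>g\<in>{g. \<delta> x g \<noteq> \<zero>}. \<delta> x g)"
proof -
  have fin: "finite {g. \<delta> x g \<noteq> \<zero>}" if "x \<in> carrier A" for x
    using A.supp_props(1) alg_homD(2)[OF coact] that by blast
  have "(\<forall>g\<in>carrier G. \<delta> x g \<in> degree_part g) \<and> x = (\<Oplus>g\<in>{g. \<delta> x g \<noteq> \<zero>}. \<delta> x g)"
    using subsetD[OF spanned assms]
  proof (induction rule: add_closure.induct)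
    case zero
    then show ?case by (simp add: part_simps degree_part_zero)
  next
    case (add d s)
    then obtain h where h: "h \<in> carrier G" and d: "d \<in> degree_part h" by auto
    have cl: "d \<in> carrier A" "s \<in> carrier A"
      using d degree_part_sub A.A.add_closure_carrier[OF degree_part_Union_sub add.hyps(2)] by auto
    have dd: "(\<Oplus>g\<in>{g. \<delta> d g \<noteq> \<zero>}. \<delta> d g) = \<delta> d h"
      by (rule A.A.finsum_support_single) (use d cl in \<open>auto simp: degree_part_apply\<close>)
    have "(\<Oplus>g\<in>{g. \<delta> (d \<oplus> s) g \<noteq> \<zero>}. \<delta> (d \<oplus> s) g) =
        (\<Oplus>g\<in>{g. \<delta> d g \<noteq> \<zero>}. \<delta> d g) \<oplus> (\<Oplus>g\<in>{g. \<delta> s g \<noteq> \<zero>}. \<delta> s g)"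
      by (rule A.A.finsum_support_add) (use cl fin in \<open>auto simp: part_simps\<close>)
    then have "d \<oplus> s = (\<Oplus>g\<in>{g. \<delta> (d \<oplus> s) g \<noteq> \<zero>}. \<delta> (d \<oplus> s) g)"
      using add.IH dd d by (simp add: degree_part_apply)
    moreover have "\<delta> (d \<oplus> s) g \<in> degree_part g" if "g \<in> carrier G" for g
      using add.IH that d cl by (simp add: part_simps degree_part_add degree_part_apply degree_part_zero)
    ultimately show ?case by blast
  qed
  then show "g \<in> carrier G \<Longrightarrow> \<delta> x g \<in> degree_part g"
    and "x = (\<Oplus>g\<in>{g. \<delta> x g \<noteq> \<zero>}. \<delta> x g)" by blast+
qed

lemma algebra_grading_degree_part: "algebra_grading G A degree_part"
proof -
  have sub: "submodule (degree_part g) CC A" for g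
    by (intro A.A.submodule_memI degree_part_sub degree_part_zero degree_part_add degree_part_smult)
  have "\<exists>!x. homogeneous_decomp G A degree_part v x" if v: "v \<in> carrier A" for v
  proof (rule ex1I)
    have dv: "\<delta> v \<in> carrier A.S" using v alg_homD(2)[OF coact] by blast
    show "homogeneous_decomp G A degree_part v (\<delta> v)"
      unfolding homogeneous_decomp_def
      using part_decomposition[OF v] A.supp_props(1)[OF dv] A.outside[OF dv] by blast
    fix x assume "homogeneous_decomp G A degree_part v x"
    then have x: "\<And>g. g \<in> carrier G \<Longrightarrow> x g \<in> degree_part g" "\<And>g. g \<notin> carrier G \<Longrightarrow> x g = \<zero>"
      "finite {g. x g \<noteq> \<zero>}" "v = (\<Oplus>g\<in>{g. x g \<noteq> \<zero>}. x g)"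
      unfolding homogeneous_decomp_def by blast+
    have x': "x g \<in> degree_part g" for g
      using x(1)[of g] x(2)[of g] degree_part_zero by (cases "g \<in> carrier G") auto
    then have cl: "x g \<in> carrier A" for g using degree_part_sub by blast
    show "x = \<delta> v"
    proof
      fix h
      have "\<delta> v h = (\<Oplus>g\<in>{g. x g \<noteq> \<zero>}. \<delta> (x g) h)"
        unfolding x(4)
        using clinear_finsum[OF A.A.cspace_axioms A.A.cspace_axioms clinear_part[of h], of x] cl by simp
      also have "\<dots> = (\<Oplus>g\<in>{g. x g \<noteq> \<zero>}. if h = g then x g else \<zero>)"
        by (rule A.A.finsum_cong') (use cl in \<open>auto simp: degree_part_apply[OF x']\<close>)
      also have "\<dots> = (\<Oplus>g\<in>insert h {g. x g \<noteq> \<zero>}. if h = g then x g else \<zero>)"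
        by (rule A.A.finsum_extend) (use x(3) cl in auto)
      also have "\<dots> = x h"
        by (rule A.A.finsum_singleton) (use x(3) cl in auto)
      finally show "x h = \<delta> v h" ..
    qed
  qed
  then have "grading G A degree_part" using sub by (simp add: grading_def)
  then show ?thesis
    using A.A.is_complex_algebra degree_part_one degree_part_mult by (simp add: algebra_grading_def)
qed

end


section \<open>Graded vector spaces and their tensor algebras\<close>

lemma (in calgebra) clinear_mult_left:
  "m \<in> carrier A \<Longrightarrow> clinear V A f \<Longrightarrow> clinear V A (\<lambda>x. m \<otimes> f x)"
  by (intro clinearI) (auto simp: clinearD r_distr)

lemma (in calgebra) clinear_mult_right:
  "m \<in> carrier A \<Longrightarrow> clinear V A f \<Longrightarrow> clinear V A (\<lambda>x. f x \<otimes> m)"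
  by (intro clinearI) (auto simp: clinearD l_distr)

lemma (in cspace) clinear_const_zero: "clinear U V (\<lambda>_. \<zero>)"
  by (intro clinearI) auto

locale graded_space = G: group G + V: tensor V
  for G :: "('g, 'a) monoid_scheme" and V :: "(complex, 'v, 'm) module_scheme" +
  fixes gr :: "'g \<Rightarrow> 'v set"
  assumes is_grading: "grading G V gr"
begin

abbreviation T where "T \<equiv> tensor_alg V"
abbreviation pure where "pure \<equiv> pure_tensor V"
abbreviation part where "part \<equiv> component G V gr"
abbreviation homogeneous where "homogeneous \<equiv> (\<Union>g\<in>carrier G. gr g)"

lemma gr_submodule: "g \<in> carrier G \<Longrightarrow> submodule (gr g) CC V"
  using is_grading by (simp add: grading_def)

lemma gr_sub: "g \<in> carrier G \<Longrightarrow> gr g \<subseteq> carrier V"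
  using module.submoduleE(1)[OF V.is_module gr_submodule] .

lemma gr_zero: "g \<in> carrier G \<Longrightarrow> \<zero>\<^bsub>V\<^esub> \<in> gr g"
  using subgroup.one_closed[OF submodule.axioms(1)[OF gr_submodule]] by simp

lemma gr_add: "g \<in> carrier G \<Longrightarrow> u \<in> gr g \<Longrightarrow> v \<in> gr g \<Longrightarrow> u \<oplus>\<^bsub>V\<^esub> v \<in> gr g"
  using module.submoduleE(5)[OF V.is_module gr_submodule] by blast

lemma gr_smult: "g \<in> carrier G \<Longrightarrow> v \<in> gr g \<Longrightarrow> c \<odot>\<^bsub>V\<^esub> v \<in> gr g"
  using module.submoduleE(4)[OF V.is_module gr_submodule] by simp

lemma homogeneous_sub: "homogeneous \<subseteq> carrier V"
  using gr_sub by blast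

lemma ex1_decomp: "v \<in> carrier V \<Longrightarrow> \<exists>!x. homogeneous_decomp G V gr v x"
  using is_grading by (simp add: grading_def)

lemma decomp_part: "v \<in> carrier V \<Longrightarrow> homogeneous_decomp G V gr v (part v)"
  unfolding component_def by (rule theI'[OF ex1_decomp])

lemma part_eqI: "v \<in> carrier V \<Longrightarrow> homogeneous_decomp G V gr v x \<Longrightarrow> part v = x"
  using ex1_decomp[of v] decomp_part[of v] by blast

lemma part_props:
  assumes "v \<in> carrier V"
  shows "g \<in> carrier G \<Longrightarrow> part v g \<in> gr g" "g \<notin> carrier G \<Longrightarrow> part v g = \<zero>\<^bsub>V\<^esub>"
    "finite {g. part v g \<noteq> \<zero>\<^bsub>V\<^esub>}" "v = (\<Oplus>\<^bsub>V\<^esub>g\<in>{g. part v g \<noteq> \<zero>\<^bsub>V\<^esub>}. part v g)"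
  using decomp_part[OF assms] unfolding homogeneous_decomp_def by blast+

lemma part_closed: "v \<in> carrier V \<Longrightarrow> part v g \<in> carrier V"
  using part_props(1,2)[of v g] gr_sub by (cases "g \<in> carrier G") auto

lemma part_add:
  assumes u: "u \<in> carrier V" and v: "v \<in> carrier V"
  shows "part (u \<oplus>\<^bsub>V\<^esub> v) g = part u g \<oplus>\<^bsub>V\<^esub> part v g"
proof -
  let ?s = "\<lambda>g. part u g \<oplus>\<^bsub>V\<^esub> part v g"
  have sub: "{g. ?s g \<noteq> \<zero>\<^bsub>V\<^esub>} \<subseteq> {g. part u g \<noteq> \<zero>\<^bsub>V\<^esub>} \<union> {g. part v g \<noteq> \<zero>\<^bsub>V\<^esub>}" by auto
  have "(\<Oplus>\<^bsub>V\<^esub>g\<in>{g. ?s g \<noteq> \<zero>\<^bsub>V\<^esub>}. ?s g) =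
      (\<Oplus>\<^bsub>V\<^esub>g\<in>{g. part u g \<noteq> \<zero>\<^bsub>V\<^esub>}. part u g) \<oplus>\<^bsub>V\<^esub> (\<Oplus>\<^bsub>V\<^esub>g\<in>{g. part v g \<noteq> \<zero>\<^bsub>V\<^esub>}. part v g)"
    by (rule V.finsum_support_add) (use u v sub part_props(3) part_closed in auto)
  also have "\<dots> = u \<oplus>\<^bsub>V\<^esub> v" using part_props(4)[OF u] part_props(4)[OF v] by simp
  finally have sum: "u \<oplus>\<^bsub>V\<^esub> v = (\<Oplus>\<^bsub>V\<^esub>g\<in>{g. ?s g \<noteq> \<zero>\<^bsub>V\<^esub>}. ?s g)" ..
  have fin: "finite {g. ?s g \<noteq> \<zero>\<^bsub>V\<^esub>}"
    using finite_subset[OF sub] part_props(3) u v by simp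
  have "homogeneous_decomp G V gr (u \<oplus>\<^bsub>V\<^esub> v) ?s"
    unfolding homogeneous_decomp_def
    by (intro conjI ballI allI impI fin sum) (use u v part_props(1,2) gr_add in auto)
  from part_eqI[OF _ this] u v show ?thesis by simp
qed

lemma part_smult:
  assumes v: "v \<in> carrier V"
  shows "part (c \<odot>\<^bsub>V\<^esub> v) g = c \<odot>\<^bsub>V\<^esub> part v g"
proof -
  let ?s = "\<lambda>g. c \<odot>\<^bsub>V\<^esub> part v g"
  have sub: "{g. ?s g \<noteq> \<zero>\<^bsub>V\<^esub>} \<subseteq> {g. part v g \<noteq> \<zero>\<^bsub>V\<^esub>}" by auto
  have "(\<Oplus>\<^bsub>V\<^esub>g\<in>{g. ?s g \<noteq> \<zero>\<^bsub>V\<^esub>}. ?s g) = c \<odot>\<^bsub>V\<^esub> (\<Oplus>\<^bsub>V\<^esub>g\<in>{g. part v g \<noteq> \<zero>\<^bsub>V\<^esub>}. part v g)"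
    by (rule V.finsum_support_smult) (use v sub part_props(3) part_closed in auto)
  then have sum: "c \<odot>\<^bsub>V\<^esub> v = (\<Oplus>\<^bsub>V\<^esub>g\<in>{g. ?s g \<noteq> \<zero>\<^bsub>V\<^esub>}. ?s g)"
    using part_props(4)[OF v] by simp
  have fin: "finite {g. ?s g \<noteq> \<zero>\<^bsub>V\<^esub>}"
    using finite_subset[OF sub] part_props(3) v by simp
  have "homogeneous_decomp G V gr (c \<odot>\<^bsub>V\<^esub> v) ?s"
    unfolding homogeneous_decomp_def
    by (intro conjI ballI allI impI fin sum) (use v part_props(1,2) gr_smult in auto)
  from part_eqI[OF _ this] v show ?thesis by simp
qed

lemma part_homogeneous:
  assumes h: "h \<in> carrier G" and v: "v \<in> gr h"
  shows "part v g = (if g = h then v else \<zero>\<^bsub>V\<^esub>)"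
proof -
  let ?s = "\<lambda>g. if g = h then v else \<zero>\<^bsub>V\<^esub>"
  have v': "v \<in> carrier V" using gr_sub h v by blast
  have sub: "{g. ?s g \<noteq> \<zero>\<^bsub>V\<^esub>} \<subseteq> {h}" by auto
  have "(\<Oplus>\<^bsub>V\<^esub>g\<in>{g. ?s g \<noteq> \<zero>\<^bsub>V\<^esub>}. ?s g) = ?s h"
    by (rule V.finsum_support_single[OF sub, of "\<lambda>_ x. x"]) (use v' in auto)
  then have "homogeneous_decomp G V gr v ?s"
    unfolding homogeneous_decomp_def using sub finite_subset[OF sub] h v gr_zero by auto
  from part_eqI[OF v' this] show ?thesis by simp
qed

lemma clinear_part_at: "clinear V V (\<lambda>v. part v g)"
  by (intro clinearI) (simp_all add: part_closed part_add part_smult)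

lemma part_zero: "part \<zero>\<^bsub>V\<^esub> g = \<zero>\<^bsub>V\<^esub>"
  by (rule clinear_zero[OF V.cspace_axioms V.cspace_axioms clinear_part_at])

lemma homogeneous_spanning: "carrier V \<subseteq> add_closure V homogeneous"
proof
  fix v assume v: "v \<in> carrier V"
  have "(\<Oplus>\<^bsub>V\<^esub>g\<in>{g. part v g \<noteq> \<zero>\<^bsub>V\<^esub>}. part v g) \<in> add_closure V homogeneous"
  proof (rule V.add_closure_finsum[OF homogeneous_sub part_props(3)[OF v]])
    fix g assume "g \<in> {g. part v g \<noteq> \<zero>\<^bsub>V\<^esub>}"
    then have "g \<in> carrier G" using part_props(2)[OF v] by blast
    then show "part v g \<in> add_closure V homogeneous"
      using part_props(1)[OF v] by (intro V.add_closure_base[OF homogeneous_sub]) blast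
  qed
  then show "v \<in> add_closure V homogeneous" using part_props(4)[OF v] by simp
qed

end

sublocale graded_space \<subseteq> GT: smash_product G "tensor_alg V" "\<lambda>_ x. x"
  by (intro smash_product_trivial G.group_axioms V.T.calgebra_axioms)

context graded_space
begin

definition \<delta> :: "('v list \<Rightarrow> complex) set \<Rightarrow> 'g \<Rightarrow> ('v list \<Rightarrow> complex) set" where
  "\<delta> = V.extension (group_alg G T) (\<lambda>v g. pure [part v g])"

lemma pure_zero: "pure [\<zero>\<^bsub>V\<^esub>] = \<zero>\<^bsub>T\<^esub>"
  by (rule clinear_zero[OF V.cspace_axioms V.T.cspace_axioms V.clinear_pure1])

lemma letter_clinear: "clinear V (group_alg G T) (\<lambda>v g. pure [part v g])"
proof (rule clinearI)
  fix v assume v: "v \<in> carrier V"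
  have "finite {g. pure [part v g] \<noteq> \<zero>\<^bsub>T\<^esub>}"
    by (rule finite_subset[OF _ part_props(3)[OF v]]) (auto simp: pure_zero)
  then show "(\<lambda>g. pure [part v g]) \<in> carrier GT.S"
    using v by (auto simp: GT.smash_simps(1) part_closed part_props(2) pure_zero)
  show "(\<lambda>g. pure [part (c \<odot>\<^bsub>V\<^esub> v) g]) = c \<odot>\<^bsub>GT.S\<^esub> (\<lambda>g. pure [part v g])" for c
    using v by (simp add: GT.smash_simps(5) part_smult V.pure_smult1 part_closed)
next
  fix u v assume "u \<in> carrier V" "v \<in> carrier V"
  then show "(\<lambda>g. pure [part (u \<oplus>\<^bsub>V\<^esub> v) g]) = (\<lambda>g. pure [part u g]) \<oplus>\<^bsub>GT.S\<^esub> (\<lambda>g. pure [part v g])"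
    by (simp add: GT.smash_simps(4) part_add V.pure_plus1 part_closed)
qed

lemma alg_hom_\<delta>: "alg_hom T (group_alg G T) \<delta>"
  unfolding \<delta>_def by (rule V.alg_hom_extension[OF GT.calgebra_smash letter_clinear])

end

sublocale graded_space \<subseteq> TC: coaction G "tensor_alg V" \<delta>
  by (intro coaction.intro coaction_axioms.intro GT.smash_product_axioms alg_hom_\<delta>)

context graded_space
begin

lemma letter_degree:
  assumes "g \<in> carrier G" "v \<in> gr g" shows "pure [v] \<in> TC.degree_part g"
proof -
  have v: "v \<in> carrier V" using gr_sub assms by blast
  have "\<delta> (pure [v]) = (\<lambda>h. pure [part v h])"
    unfolding \<delta>_def by (rule V.extension_letter[OF GT.calgebra_smash letter_clinear v])
  also have "\<dots> = GT.single (pure [v]) g"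
    by (auto simp: fun_eq_iff GT.single_def pure_zero part_homogeneous[OF assms])
  finally show ?thesis using v by (simp add: TC.degree_part_def)
qed

lemma word_degree:
  "set w \<subseteq> homogeneous \<Longrightarrow> \<exists>g\<in>carrier G. pure w \<in> TC.degree_part g"
proof (induction w)
  case Nil
  then show ?case using TC.degree_part_one by (auto simp: V.pure_Nil)
next
  case (Cons v w)
  then obtain g h where "g \<in> carrier G" "pure w \<in> TC.degree_part g" "h \<in> carrier G" "v \<in> gr h"
    by auto
  moreover have "v \<in> carrier V" "set w \<subseteq> carrier V" using Cons.prems homogeneous_sub by auto
  ultimately show ?case
    using TC.degree_part_mult[of h g "pure [v]" "pure w"] letter_degree[of h v]
    by (auto simp: V.pure_Cons[of v w] intro!: bexI[of _ "h \<otimes>\<^bsub>G\<^esub> g"])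
qed

lemmas homogeneous_letters = conjI[OF homogeneous_sub homogeneous_spanning]

lemma tensor_power_part:
  assumes "U \<in> tensor_power V n" shows "\<delta> U k \<in> tensor_power V n"
  using assms
proof (induction rule: V.tensor_power_induct[of _ _ homogeneous])
  case (pure w)
  then obtain g where "pure w \<in> TC.degree_part g" using word_degree[of w] by auto
  moreover have "pure w \<in> tensor_power V n"
    using V.pure_in_tensor_power[of w] pure homogeneous_sub by auto
  ultimately show ?case by (simp add: TC.degree_part_apply V.tensor_power_zero)
qed (use homogeneous_letters in \<open>auto simp: TC.part_simps V.tensor_power_zero V.tensor_power_add V.tensor_power_smult\<close>)

text \<open>A linear map preserves degrees if and only if it commutes with the projections to all degrees.\<close>

definition graded_map ::
  "(('v list \<Rightarrow> complex) set \<Rightarrow> ('v list \<Rightarrow> complex) set) \<Rightarrow> bool" where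
  "graded_map f \<longleftrightarrow> clinear T T f \<and> (\<forall>U\<in>carrier T. \<forall>k. \<delta> (f U) k = f (\<delta> U k))"

lemma graded_mapI:
  assumes lin: "clinear T T f"
    and w: "\<And>w. set w \<subseteq> homogeneous \<Longrightarrow>
      \<exists>g\<in>carrier G. pure w \<in> TC.degree_part g \<and> f (pure w) \<in> TC.degree_part g"
  shows "graded_map f"
  unfolding graded_map_def
proof (intro conjI lin ballI allI)
  fix U k assume U: "U \<in> carrier T"
  show "\<delta> (f U) k = f (\<delta> U k)"
  proof (rule V.clinear_eqI[OF U homogeneous_sub homogeneous_spanning V.T.cspace_axioms])
    show "clinear T T (\<lambda>U. \<delta> (f U) k)" by (rule clinear_comp[OF lin TC.clinear_part])
    show "clinear T T (\<lambda>U. f (\<delta> U k))" by (rule clinear_comp[OF TC.clinear_part lin])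
    fix w assume "set w \<subseteq> homogeneous"
    from w[OF this] obtain g where "pure w \<in> TC.degree_part g" "f (pure w) \<in> TC.degree_part g"
      by blast
    then show "\<delta> (f (pure w)) k = f (\<delta> (pure w) k)"
      using clinear_zero[OF V.T.cspace_axioms V.T.cspace_axioms lin] by (simp add: TC.degree_part_apply)
  qed
qed

lemma graded_map_id: "graded_map id"
  by (auto simp: graded_map_def clinear_def)

lemma graded_map_comp: "graded_map f \<Longrightarrow> graded_map g \<Longrightarrow> graded_map (f \<circ> g)"
  unfolding graded_map_def by (auto simp: clinear_def Pi_iff)

lemma graded_map_sum:
  assumes "finite B" "\<And>i. i \<in> B \<Longrightarrow> graded_map (f i)"
  shows "graded_map (\<lambda>U. \<Oplus>\<^bsub>T\<^esub>i\<in>B. f i U)"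
proof -
  have lin: "\<And>i. i \<in> B \<Longrightarrow> clinear T T (f i)" using assms(2) by (auto simp: graded_map_def)
  have "\<delta> (\<Oplus>\<^bsub>T\<^esub>i\<in>B. f i U) k = (\<Oplus>\<^bsub>T\<^esub>i\<in>B. f i (\<delta> U k))" if U: "U \<in> carrier T" for U k
  proof -
    have "\<delta> (\<Oplus>\<^bsub>T\<^esub>i\<in>B. f i U) k = (\<Oplus>\<^bsub>T\<^esub>i\<in>B. \<delta> (f i U) k)"
      by (rule clinear_finsum[OF V.T.cspace_axioms V.T.cspace_axioms TC.clinear_part])
        (use U clinearD(1)[OF lin] in auto)
    also have "\<dots> = (\<Oplus>\<^bsub>T\<^esub>i\<in>B. f i (\<delta> U k))"
      by (rule V.T.finsum_cong')
        (use assms(2) U clinearD(1)[OF lin] TC.part_simps(1) in \<open>auto simp: graded_map_def\<close>)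
    finally show ?thesis .
  qed
  then show ?thesis
    using clinear_sum_of[OF V.T.cspace_axioms lin assms(1)] by (simp add: graded_map_def)
qed

end


section \<open>Braidings and Nichols ideals\<close>

context tensor
begin

lemma nichols_idealE:
  assumes "U \<in> nichols_ideal V \<Phi>"
  obtains N x where "U = (\<Oplus>\<^bsub>T\<^esub>n\<in>{..N}. x n)" "\<And>n. x n \<in> factorial_kernel V \<Phi> n"
    "\<And>n :: nat. x n \<in> carrier T"
proof -
  obtain N x where "U = (\<Oplus>\<^bsub>T\<^esub>n\<in>{..N}. x n)" and x: "\<And>n. x n \<in> factorial_kernel V \<Phi> n"
    using assms by (auto simp: nichols_ideal_def)
  moreover have "x n \<in> carrier T" for n
    using x[of n] tensor_power_sub by (auto simp: factorial_kernel_def)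
  ultimately show thesis using that by blast
qed

lemma nichols_ideal_sub: "nichols_ideal V \<Phi> \<subseteq> carrier T"
  by (auto elim!: nichols_idealE intro!: T.finsum_closed)

lemma
  fixes b :: "'v \<Rightarrow> 'v \<Rightarrow> ('v list \<Rightarrow> complex) set"
  assumes cl: "\<And>y z. y \<in> carrier V \<Longrightarrow> z \<in> carrier V \<Longrightarrow> b y z \<in> carrier T"
    and lin1: "\<And>z. z \<in> carrier V \<Longrightarrow> clinear V T (\<lambda>y. b y z)"
    and lin2: "\<And>y. y \<in> carrier V \<Longrightarrow> clinear V T (\<lambda>z. b y z)"
  shows clinear_tensor2_map: "clinear T T (tensor2_map V b)"
    and tensor2_map_pure: "y \<in> carrier V \<Longrightarrow> z \<in> carrier V \<Longrightarrow> tensor2_map V b (pure [y, z]) = b y z"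
proof -
  let ?\<phi> = "\<lambda>w. if length w = 2 then b (w ! 0) (w ! 1) else \<zero>\<^bsub>T\<^esub>"
  have ml: "multilinear V T ?\<phi>"
  proof (rule multilinearI)
    fix w assume w: "set w \<subseteq> carrier V"
    show "?\<phi> w \<in> carrier T" using w nth_mem[of 0 w] nth_mem[of 1 w] by (auto intro!: cl)
  next
    fix a c :: "'v list" assume ac: "set a \<subseteq> carrier V" "set c \<subseteq> carrier V"
    consider (fst) z where "a = []" "c = [z]" | (snd) y where "a = [y]" "c = []"
      | (other) "length a + length c \<noteq> 1"
      by (cases a; cases c; auto)
    then show "clinear V T (\<lambda>u. ?\<phi> (a @ u # c))"
    proof cases
      case fst
      then show ?thesis using lin1[of z] ac by (simp add: numeral_2_eq_2)
    next
      case snd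
      then show ?thesis using lin2[of y] ac by (simp add: numeral_2_eq_2)
    next
      case other
      then have "(\<lambda>u. ?\<phi> (a @ u # c)) = (\<lambda>_. \<zero>\<^bsub>T\<^esub>)" by auto
      then show ?thesis using T.clinear_const_zero[of V] by simp
    qed
  qed
  show "clinear T T (tensor2_map V b)"
    unfolding tensor2_map_def by (rule clinear_tensor_lift[OF T.cspace_axioms ml])
  show "tensor2_map V b (pure [y, z]) = b y z" if "y \<in> carrier V" "z \<in> carrier V"
    unfolding tensor2_map_def using tensor_lift_pure[OF T.cspace_axioms ml, of "[y, z]"] that by simp
qed

text \<open>
  Multilinearity is checked by the position of the varying letter relative to the braided pair: it
  lies in one of the two outer factors, or it is one of the letters to which \<open>\<Psi>\<close> is applied.
\<close>

lemma
  assumes \<Psi>: "clinear T T \<Psi>"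
  shows clinear_braid_at: "clinear T T (braid_at V \<Psi> i)"
    and braid_at_pure: "set w \<subseteq> carrier V \<Longrightarrow> braid_at V \<Psi> i (pure w) =
      (if Suc i < length w
       then pure (take i w) \<otimes>\<^bsub>T\<^esub> \<Psi> (pure [w ! i, w ! Suc i]) \<otimes>\<^bsub>T\<^esub> pure (drop (i + 2) w)
       else \<zero>\<^bsub>T\<^esub>)"
proof -
  let ?\<phi> = "\<lambda>w. if Suc i < length w
    then pure (take i w) \<otimes>\<^bsub>T\<^esub> \<Psi> (pure [w ! i, w ! Suc i]) \<otimes>\<^bsub>T\<^esub> pure (drop (i + 2) w)
    else \<zero>\<^bsub>T\<^esub>"
  note P = clinearD(1)[OF \<Psi>]
  have sub: "set (take j w) \<subseteq> carrier V" "set (drop j w) \<subseteq> carrier V"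
    "j < length w \<Longrightarrow> w ! j \<in> carrier V" if "set w \<subseteq> carrier V" for w :: "'v list" and j
    using that set_take_subset[of j w] set_drop_subset[of j w] nth_mem[of j w] by blast+
  have ctx: "clinear V T (\<lambda>u. pure (a @ u # c))" if "set a \<subseteq> carrier V" "set c \<subseteq> carrier V" for a c
    using multilinear_clinear[OF multilinear_pure that] .
  have ml: "multilinear V T ?\<phi>"
  proof (rule multilinearI)
    fix w assume "set w \<subseteq> carrier V"
    then show "?\<phi> w \<in> carrier T" by (auto intro!: T.m_closed P pure_closed simp: sub(3) dest: in_set_takeD in_set_dropD)
  next
    fix a c :: "'v list" assume ac: "set a \<subseteq> carrier V" "set c \<subseteq> carrier V"
    let ?n = "length a"
    consider (outside) "length c + ?n \<le> i" | (before) "?n < i" "i < length c + ?n" | (first) "?n = i" "c \<noteq> []"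
      | (second) "?n = Suc i" | (after) "Suc i < ?n"
      by (cases "c = []") (auto simp: not_less_eq_eq not_le, linarith+)
    then show "clinear V T (\<lambda>u. ?\<phi> (a @ u # c))"
    proof cases
      case outside
      then have "(\<lambda>u. ?\<phi> (a @ u # c)) = (\<lambda>_. \<zero>\<^bsub>T\<^esub>)" by auto
      then show ?thesis using T.clinear_const_zero[of V] by simp
    next
      case before
      define j where "j = i - Suc ?n"
      have i: "i = Suc (?n + j)" and j: "Suc j < Suc (length c)" using before by (auto simp: j_def)
      have "(\<lambda>u. ?\<phi> (a @ u # c)) = (\<lambda>u. pure (a @ u # take j c) \<otimes>\<^bsub>T\<^esub>
          \<Psi> (pure [c ! j, c ! Suc j]) \<otimes>\<^bsub>T\<^esub> pure (drop (j + 2) c))" if "Suc j < length c"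
        using that by (simp add: i nth_append eval_nat_numeral)
      moreover have "clinear V T (\<lambda>u. pure (a @ u # take j c) \<otimes>\<^bsub>T\<^esub>
          \<Psi> (pure [c ! j, c ! Suc j]) \<otimes>\<^bsub>T\<^esub> pure (drop (j + 2) c))" if "Suc j < length c"
        using that ac by (intro T.clinear_mult_right ctx pure_closed P) (auto simp: sub)
      moreover have "(\<lambda>u. ?\<phi> (a @ u # c)) = (\<lambda>_. \<zero>\<^bsub>T\<^esub>)" if "\<not> Suc j < length c"
        using that by (auto simp: i)
      ultimately show ?thesis using T.clinear_const_zero[of V] by (cases "Suc j < length c") simp_all
    next
      case first
      then obtain z d where c: "c = z # d" by (cases c) auto
      have "(\<lambda>u. ?\<phi> (a @ u # c)) = (\<lambda>u. pure a \<otimes>\<^bsub>T\<^esub> \<Psi> (pure [u, z]) \<otimes>\<^bsub>T\<^esub> pure d)"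
        using first(1)[symmetric] by (simp add: c nth_append)
      moreover have "clinear V T (\<lambda>u. pure a \<otimes>\<^bsub>T\<^esub> \<Psi> (pure [u, z]) \<otimes>\<^bsub>T\<^esub> pure d)"
        using ac c ctx[of "[]" "[z]"]
        by (intro T.clinear_mult_right T.clinear_mult_left clinear_comp[OF _ \<Psi>]) auto
      ultimately show ?thesis by simp
    next
      case second
      then obtain e y where a: "a = e @ [y]" by (cases a rule: rev_cases) auto
      then have e: "length e = i" using second by simp
      have "(\<lambda>u. ?\<phi> (a @ u # c)) = (\<lambda>u. pure e \<otimes>\<^bsub>T\<^esub> \<Psi> (pure [y, u]) \<otimes>\<^bsub>T\<^esub> pure c)"
        by (simp add: a e[symmetric] nth_append)
      moreover have "clinear V T (\<lambda>u. pure e \<otimes>\<^bsub>T\<^esub> \<Psi> (pure [y, u]) \<otimes>\<^bsub>T\<^esub> pure c)"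
        using ac a ctx[of "[y]" "[]"]
        by (intro T.clinear_mult_right T.clinear_mult_left clinear_comp[OF _ \<Psi>]) auto
      ultimately show ?thesis by simp
    next
      case after
      have "(\<lambda>u. ?\<phi> (a @ u # c)) = (\<lambda>u. pure (take i a) \<otimes>\<^bsub>T\<^esub>
          \<Psi> (pure [a ! i, a ! Suc i]) \<otimes>\<^bsub>T\<^esub> pure (drop (i + 2) a @ u # c))"
        using after by (simp add: nth_append)
      moreover have "clinear V T (\<lambda>u. pure (take i a) \<otimes>\<^bsub>T\<^esub>
          \<Psi> (pure [a ! i, a ! Suc i]) \<otimes>\<^bsub>T\<^esub> pure (drop (i + 2) a @ u # c))"
        using after ac by (intro T.clinear_mult_left ctx pure_closed P T.m_closed) (auto simp: sub)
      ultimately show ?thesis by simp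
    qed
  qed
  show "clinear T T (braid_at V \<Psi> i)"
    unfolding braid_at_def by (rule clinear_tensor_lift[OF T.cspace_axioms ml])
  show "set w \<subseteq> carrier V \<Longrightarrow> braid_at V \<Psi> i (pure w) = ?\<phi> w"
    unfolding braid_at_def by (rule tensor_lift_pure[OF T.cspace_axioms ml])
qed

end

locale yd = graded_space G V gr
  for G :: "('g, 'a) monoid_scheme" and V :: "(complex, 'v, 'm) module_scheme" and gr +
  fixes act :: "'g \<Rightarrow> 'v \<Rightarrow> 'v"
  assumes is_representation: "representation G V act"
    and act_gr: "g \<in> carrier G \<Longrightarrow> h \<in> carrier G \<Longrightarrow>
      act g ` gr h = gr (g \<otimes>\<^bsub>G\<^esub> h \<otimes>\<^bsub>G\<^esub> inv\<^bsub>G\<^esub> g)"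
begin

lemma act_clinear: "g \<in> carrier G \<Longrightarrow> clinear V V (act g)"
  using is_representation by (simp add: representation_def)

lemmas act_lin = clinearD[OF act_clinear] clinear_zero[OF V.cspace_axioms V.cspace_axioms act_clinear]

abbreviation \<Psi> where "\<Psi> \<equiv> yd_braiding G V act gr"

text \<open>
  The sum that defines \<open>y \<otimes> z \<mapsto> \<Psi> (y \<otimes> z)\<close> runs over the support of \<open>y\<close>, so its linearity in \<open>y\<close>
  compares sums over different supports. For homogeneous \<open>y\<close> only one summand is left.
\<close>

lemma
  shows clinear_\<Psi>: "clinear T T \<Psi>"
    and \<Psi>_pure: "h \<in> carrier G \<Longrightarrow> y \<in> gr h \<Longrightarrow> z \<in> carrier V \<Longrightarrow>
      \<Psi> (pure [y, z]) = pure [act h z, y]"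
proof -
  let ?b = "\<lambda>y z. \<Oplus>\<^bsub>T\<^esub>g\<in>support G V gr y. pure [act g z, part y g]"
  have suppG: "g \<in> carrier G" if "y \<in> carrier V" "part y g \<noteq> \<zero>\<^bsub>V\<^esub>" for y g
    using part_props(2)[OF that(1), of g] that(2) by blast
  note S = support_def[of G V gr]
  have cl: "?b y z \<in> carrier T" if "y \<in> carrier V" "z \<in> carrier V" for y z
    using that suppG by (intro V.T.finsum_closed) (auto simp: S act_lin part_closed)
  have pl1: "clinear V T (\<lambda>u. pure [u, x])" and pl2: "clinear V T (\<lambda>u. pure [x, u])"
    if "x \<in> carrier V" for x
    using multilinear_clinear[OF V.multilinear_pure, of "[]" "[x]"]
      multilinear_clinear[OF V.multilinear_pure, of "[x]" "[]"] that by simp_all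
  note pz = clinear_zero[OF V.cspace_axioms V.T.cspace_axioms pl2]
  have lin2: "clinear V T (?b y)" if y: "y \<in> carrier V" for y
  proof (rule clinear_sum_of[OF V.T.cspace_axioms])
    show "finite (support G V gr y)" using part_props(3)[OF y] by (simp add: S)
    fix g assume "g \<in> support G V gr y"
    then have "g \<in> carrier G" using suppG y by (auto simp: S)
    then show "clinear V T (\<lambda>z. pure [act g z, part y g])"
      by (rule clinear_comp[OF act_clinear pl1[OF part_closed[OF y]]])
  qed
  have lin1: "clinear V T (\<lambda>y. ?b y z)" if z: "z \<in> carrier V" for z
  proof (rule clinearI)
    fix x y assume x: "x \<in> carrier V" and y: "y \<in> carrier V"
    show "?b (x \<oplus>\<^bsub>V\<^esub> y) z = ?b x z \<oplus>\<^bsub>T\<^esub> ?b y z"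
      unfolding S
      by (rule V.T.finsum_support_add)
        (use x y z part_props(3) suppG in \<open>auto simp: part_add part_closed act_lin pz clinearD(2)[OF pl2]\<close>)
  next
    fix c y assume y: "y \<in> carrier V"
    show "?b (c \<odot>\<^bsub>V\<^esub> y) z = c \<odot>\<^bsub>T\<^esub> ?b y z"
      unfolding S
      by (rule V.T.finsum_support_smult)
        (use y z part_props(3) suppG in \<open>auto simp: part_smult part_closed act_lin pz clinearD(3)[OF pl2]\<close>)
  qed (use z cl in blast)
  show "clinear T T \<Psi>"
    unfolding yd_braiding_def by (rule V.clinear_tensor2_map[OF cl lin1 lin2])
  assume h: "h \<in> carrier G" and y: "y \<in> gr h" and z: "z \<in> carrier V"
  have y': "y \<in> carrier V" using gr_sub h y by blast
  have "\<Psi> (pure [y, z]) = ?b y z"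
    unfolding yd_braiding_def by (rule V.tensor2_map_pure[OF cl lin1 lin2 y' z])
  also have "\<dots> = pure [act h z, part y h]"
    unfolding S
    by (rule V.T.finsum_support_single[where l = "\<lambda>g v. pure [act g z, v]"])
      (use h y y' z in \<open>auto simp: part_homogeneous pz act_lin split: if_splits\<close>)
  finally show "\<Psi> (pure [y, z]) = pure [act h z, y]"
    using part_homogeneous[OF h y] by simp
qed

text \<open>
  The braiding moves a letter \<open>z\<close> of degree \<open>k\<close> to the left of a letter \<open>y\<close> of degree \<open>h\<close> and turns
  its degree into \<open>h k h\<^sup>-\<^sup>1\<close>. The product of the degrees is \<open>h k\<close> both before and after.
\<close>

lemma graded_map_braid_at: "graded_map (braid_at V \<Psi> i)"
proof (rule graded_mapI[OF V.clinear_braid_at[OF clinear_\<Psi>]])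
  fix w assume w: "set w \<subseteq> homogeneous"
  then have w': "set w \<subseteq> carrier V" using homogeneous_sub by blast
  show "\<exists>g\<in>carrier G. pure w \<in> TC.degree_part g \<and> braid_at V \<Psi> i (pure w) \<in> TC.degree_part g"
  proof (cases "Suc i < length w")
    case False
    then show ?thesis
      using word_degree[OF w] TC.degree_part_zero V.braid_at_pure[OF clinear_\<Psi> w'] by simp
  next
    case True
    define a y z c where "a = take i w" and "y = w ! i" and "z = w ! Suc i" and "c = drop (i + 2) w"
    have weq: "w = a @ y # z # c"
      using True id_take_nth_drop[of i w] Cons_nth_drop_Suc[of "Suc i" w]
      by (simp add: a_def y_def z_def c_def)
    have ac: "set a \<subseteq> homogeneous" "set c \<subseteq> homogeneous" using w by (auto simp: weq)
    then have ac': "set a \<subseteq> carrier V" "set c \<subseteq> carrier V" using homogeneous_sub by auto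
    obtain h k where h: "h \<in> carrier G" "y \<in> gr h" and k: "k \<in> carrier G" "z \<in> gr k"
      using w by (auto simp: weq)
    have yz: "y \<in> carrier V" "z \<in> carrier V" using h k gr_sub by auto
    obtain p q where p: "p \<in> carrier G" "pure a \<in> TC.degree_part p"
      and q: "q \<in> carrier G" "pure c \<in> TC.degree_part q"
      using word_degree ac by metis
    have hz: "act h z \<in> gr (h \<otimes>\<^bsub>G\<^esub> k \<otimes>\<^bsub>G\<^esub> inv\<^bsub>G\<^esub> h)" using act_gr[OF h(1) k(1)] k(2) by blast
    have hz': "act h z \<in> carrier V" using act_lin(1) h yz by blast
    have conj: "h \<otimes>\<^bsub>G\<^esub> k \<otimes>\<^bsub>G\<^esub> inv\<^bsub>G\<^esub> h \<otimes>\<^bsub>G\<^esub> h = h \<otimes>\<^bsub>G\<^esub> k" using h k by (simp add: G.m_assoc)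
    have "pure [y] \<otimes>\<^bsub>T\<^esub> pure [z] \<in> TC.degree_part (h \<otimes>\<^bsub>G\<^esub> k)"
      using h k by (intro TC.degree_part_mult letter_degree)
    then have yz_deg: "pure [y, z] \<in> TC.degree_part (h \<otimes>\<^bsub>G\<^esub> k)" using yz by (simp add: V.pure_Cons[of y "[z]"])
    have "pure [act h z] \<otimes>\<^bsub>T\<^esub> pure [y] \<in> TC.degree_part (h \<otimes>\<^bsub>G\<^esub> k \<otimes>\<^bsub>G\<^esub> inv\<^bsub>G\<^esub> h \<otimes>\<^bsub>G\<^esub> h)"
      using h k hz by (intro TC.degree_part_mult letter_degree) auto
    then have zy_deg: "pure [act h z, y] \<in> TC.degree_part (h \<otimes>\<^bsub>G\<^esub> k)"
      using yz hz' by (simp add: V.pure_Cons[of "act h z" "[y]"] conj)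
    have "pure w = pure a \<otimes>\<^bsub>T\<^esub> pure [y, z] \<otimes>\<^bsub>T\<^esub> pure c"
      using V.pure_append[of "a @ [y, z]" c] V.pure_append[of a "[y, z]"] ac' yz by (simp add: weq)
    then have "pure w \<in> TC.degree_part (p \<otimes>\<^bsub>G\<^esub> (h \<otimes>\<^bsub>G\<^esub> k) \<otimes>\<^bsub>G\<^esub> q)"
      using p q h k yz_deg by (auto intro!: TC.degree_part_mult)
    moreover have "braid_at V \<Psi> i (pure w) = pure a \<otimes>\<^bsub>T\<^esub> pure [act h z, y] \<otimes>\<^bsub>T\<^esub> pure c"
      using V.braid_at_pure[OF clinear_\<Psi> w', of i] True \<Psi>_pure[OF h yz(2)]
      by (simp add: a_def y_def z_def c_def)
    then have "braid_at V \<Psi> i (pure w) \<in> TC.degree_part (p \<otimes>\<^bsub>G\<^esub> (h \<otimes>\<^bsub>G\<^esub> k) \<otimes>\<^bsub>G\<^esub> q)"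
      using p q h k zy_deg by (auto intro!: TC.degree_part_mult)
    ultimately show ?thesis using p q h k by (intro bexI[of _ "p \<otimes>\<^bsub>G\<^esub> (h \<otimes>\<^bsub>G\<^esub> k) \<otimes>\<^bsub>G\<^esub> q"]) auto
  qed
qed

lemma graded_map_factorial: "graded_map (braided_factorial V \<Psi> n)"
proof -
  have "graded_map (foldr (\<lambda>i F. braid_at V \<Psi> i \<circ> F) is id)" for "is"
  proof (induction "is")
    case Nil
    then show ?case by (use graded_map_id in \<open>simp add: id_def\<close>)
  next
    case (Cons i "is")
    from graded_map_comp[OF graded_map_braid_at this] show ?case by (simp add: o_def)
  qed
  then have "graded_map (braid_perm V \<Psi> n \<sigma>)" for \<sigma>
    unfolding braid_perm_def .
  then have "graded_map (\<lambda>U. \<Oplus>\<^bsub>T\<^esub>\<sigma>\<in>{\<sigma>. \<sigma> permutes {..<n}}. braid_perm V \<Psi> n \<sigma> U)"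
    by (intro graded_map_sum finite_permutations) auto
  moreover have "braided_factorial V \<Psi> n =
      (\<lambda>U. \<Oplus>\<^bsub>T\<^esub>\<sigma>\<in>{\<sigma>. \<sigma> permutes {..<n}}. braid_perm V \<Psi> n \<sigma> U)"
    by (simp add: fun_eq_iff braided_factorial_def)
  ultimately show ?thesis by simp
qed

lemma factorial_kernel_part:
  assumes "U \<in> factorial_kernel V \<Psi> n" shows "\<delta> U k \<in> factorial_kernel V \<Psi> n"
proof -
  have U: "U \<in> tensor_power V n" "braided_factorial V \<Psi> n U = \<zero>\<^bsub>T\<^esub>"
    using assms by (auto simp: factorial_kernel_def)
  then have "U \<in> carrier T" using V.tensor_power_sub by blast
  then have "braided_factorial V \<Psi> n (\<delta> U k) = \<delta> (braided_factorial V \<Psi> n U) k"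
    using graded_map_factorial[of n] by (simp add: graded_map_def)
  also have "\<dots> = \<zero>\<^bsub>T\<^esub>" using U(2) by (simp add: TC.part_simps)
  finally show ?thesis using tensor_power_part[OF U(1)] by (simp add: factorial_kernel_def)
qed

text \<open>The Nichols ideal is graded because the braided factorials that define it preserve degrees.\<close>

lemma nichols_ideal_part:
  assumes "U \<in> nichols_ideal V \<Psi>" shows "\<delta> U k \<in> nichols_ideal V \<Psi>"
proof -
  obtain N x where U: "U = (\<Oplus>\<^bsub>T\<^esub>n\<in>{..N}. x n)" and x: "\<And>n. x n \<in> factorial_kernel V \<Psi> n"
    and "\<And>n. x n \<in> carrier T"
    using V.nichols_idealE[OF assms] by metis
  then have "\<delta> U k = (\<Oplus>\<^bsub>T\<^esub>n\<in>{..N}. \<delta> (x n) k)"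
    unfolding U by (intro clinear_finsum[OF V.T.cspace_axioms V.T.cspace_axioms TC.clinear_part]) auto
  then show ?thesis
    using factorial_kernel_part[OF x] unfolding nichols_ideal_def by blast
qed

end


section \<open>Duals and direct sums\<close>

lemma clinear_diff:
  assumes "cspace W" "clinear V W f" "clinear V W g"
  shows "clinear V W (\<lambda>x. f x \<ominus>\<^bsub>W\<^esub> g x)"
proof -
  interpret W: cspace W by fact
  note f = clinearD[OF assms(2)] and g = clinearD[OF assms(3)]
  show ?thesis
  proof (rule clinearI)
    fix x y assume "x \<in> carrier V" "y \<in> carrier V"
    then show "f (x \<oplus>\<^bsub>V\<^esub> y) \<ominus>\<^bsub>W\<^esub> g (x \<oplus>\<^bsub>V\<^esub> y) = (f x \<ominus>\<^bsub>W\<^esub> g x) \<oplus>\<^bsub>W\<^esub> (f y \<ominus>\<^bsub>W\<^esub> g y)"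
      using f(1)[of x] f(1)[of y] g(1)[of x] g(1)[of y]
      by (simp add: f(2) g(2) W.minus_eq W.minus_add W.a_ac)
  next
    fix c x assume "x \<in> carrier V"
    then show "f (c \<odot>\<^bsub>V\<^esub> x) \<ominus>\<^bsub>W\<^esub> g (c \<odot>\<^bsub>V\<^esub> x) = c \<odot>\<^bsub>W\<^esub> (f x \<ominus>\<^bsub>W\<^esub> g x)"
      using f(1)[of x] g(1)[of x]
      by (simp add: f(3) g(3) W.minus_eq W.a_inv_smult W.smult_plus_right W.smult_smult mult.commute)
  qed (use f(1) g(1) in simp)
qed

context cspace
begin

lemma dual_simps:
  "carrier (dual V) = {f. (\<forall>u\<in>carrier V. \<forall>v\<in>carrier V. f (u \<oplus> v) = f u + f v) \<and>
     (\<forall>c. \<forall>v\<in>carrier V. f (c \<odot> v) = c * f v) \<and> (\<forall>v. v \<notin> carrier V \<longrightarrow> f v = 0)}"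
  "\<zero>\<^bsub>dual V\<^esub> = (\<lambda>_. 0)"
  "f \<oplus>\<^bsub>dual V\<^esub> g = (\<lambda>v. f v + g v)"
  "c \<odot>\<^bsub>dual V\<^esub> f = (\<lambda>v. c * f v)"
  by (simp_all add: dual_def)

lemma cspace_dual: "cspace (dual V)"
  by (rule cspaceI) (auto simp: dual_simps algebra_simps)

lemma dual_zero: "f \<in> carrier (dual V) \<Longrightarrow> f \<zero> = 0"
proof -
  assume "f \<in> carrier (dual V)"
  then have "f (0 \<odot> \<zero>) = 0 * f \<zero>" unfolding dual_simps(1) by blast
  then show "f \<zero> = 0" by simp
qed

end

lemma direct_sum_simps:
  "carrier (direct_sum V W) = carrier V \<times> carrier W"
  "\<zero>\<^bsub>direct_sum V W\<^esub> = (\<zero>\<^bsub>V\<^esub>, \<zero>\<^bsub>W\<^esub>)"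
  "x \<oplus>\<^bsub>direct_sum V W\<^esub> y = (fst x \<oplus>\<^bsub>V\<^esub> fst y, snd x \<oplus>\<^bsub>W\<^esub> snd y)"
  "c \<odot>\<^bsub>direct_sum V W\<^esub> x = (c \<odot>\<^bsub>V\<^esub> fst x, c \<odot>\<^bsub>W\<^esub> snd x)"
  by (simp_all add: direct_sum_def)

lemma cspace_direct_sum:
  assumes "cspace V" "cspace W" shows "cspace (direct_sum V W)"
proof -
  interpret V: cspace V by fact
  interpret W: cspace W by fact
  show ?thesis
    by (rule cspaceI)
      (auto simp: direct_sum_simps V.a_assoc W.a_assoc V.smult_plus_left W.smult_plus_left
        V.smult_plus_right W.smult_plus_right V.smult_smult W.smult_smult intro: V.a_comm W.a_comm)
qed

text \<open>
  Multiplicativity makes \<open>u g\<^sup>-\<^sup>1\<close> the inverse of \<open>u g\<close>, so that the inner factors of a product of two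
  conjugates cancel and conjugation by \<open>g\<^sup>-\<^sup>1\<close> undoes conjugation by \<open>g\<close>.
\<close>

lemma G_algebra_conjugation:
  assumes "group G" "calgebra A"
    and u: "\<And>g. g \<in> carrier G \<Longrightarrow> u g \<in> carrier A" "u \<one>\<^bsub>G\<^esub> = \<one>\<^bsub>A\<^esub>"
      "\<And>g h. g \<in> carrier G \<Longrightarrow> h \<in> carrier G \<Longrightarrow> u (g \<otimes>\<^bsub>G\<^esub> h) = u g \<otimes>\<^bsub>A\<^esub> u h"
  shows "G_algebra G A (\<lambda>g x. u g \<otimes>\<^bsub>A\<^esub> x \<otimes>\<^bsub>A\<^esub> u (inv\<^bsub>G\<^esub> g))"
proof -
  interpret G: group G by fact
  interpret A: calgebra A by fact
  let ?c = "\<lambda>g x. u g \<otimes>\<^bsub>A\<^esub> x \<otimes>\<^bsub>A\<^esub> u (inv\<^bsub>G\<^esub> g)"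
  have inv: "u (inv\<^bsub>G\<^esub> g) \<otimes>\<^bsub>A\<^esub> u g = \<one>\<^bsub>A\<^esub>" "u g \<otimes>\<^bsub>A\<^esub> u (inv\<^bsub>G\<^esub> g) = \<one>\<^bsub>A\<^esub>" if "g \<in> carrier G" for g
    using that u(2) u(3)[of "inv\<^bsub>G\<^esub> g" g] u(3)[of g "inv\<^bsub>G\<^esub> g"] by simp_all
  have lin: "clinear A A (?c g)" if "g \<in> carrier G" for g
    using that by (intro clinearI) (simp_all add: u(1) A.l_distr A.r_distr)
  have one: "?c \<one>\<^bsub>G\<^esub> x = x" if "x \<in> carrier A" for x using that by (simp add: u(2))
  have mult: "?c (g \<otimes>\<^bsub>G\<^esub> h) x = ?c g (?c h x)"
    if "g \<in> carrier G" "h \<in> carrier G" "x \<in> carrier A" for g h x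
    using that by (simp add: u G.inv_mult_group A.m_assoc)
  have rep: "representation G A ?c"
    using lin one mult A.is_module G.group_axioms by (simp add: representation_def)
  have "?c g \<in> ring_iso A A" if g: "g \<in> carrier G" for g
  proof (rule ring_iso_memI)
    fix x y assume x: "x \<in> carrier A" and y: "y \<in> carrier A"
    show "?c g x \<in> carrier A" using g x u(1) by simp
    show "?c g (x \<oplus>\<^bsub>A\<^esub> y) = ?c g x \<oplus>\<^bsub>A\<^esub> ?c g y" using clinearD(2)[OF lin[OF g] x y] .
    have "u (inv\<^bsub>G\<^esub> g) \<otimes>\<^bsub>A\<^esub> (u g \<otimes>\<^bsub>A\<^esub> z) = z" if "z \<in> carrier A" for z
      using g that u(1) inv(1)[OF g] by (simp add: A.m_assoc[symmetric])
    then show "?c g (x \<otimes>\<^bsub>A\<^esub> y) = ?c g x \<otimes>\<^bsub>A\<^esub> ?c g y"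
      using g x y u(1) by (simp add: A.m_assoc)
  next
    show "?c g \<one>\<^bsub>A\<^esub> = \<one>\<^bsub>A\<^esub>" using g inv u(1) by simp
    show "bij_betw (?c g) (carrier A) (carrier A)"
    proof (rule bij_betw_byWitness[where f' = "?c (inv\<^bsub>G\<^esub> g)"])
      show "\<forall>x\<in>carrier A. ?c (inv\<^bsub>G\<^esub> g) (?c g x) = x"
        using g mult[of "inv\<^bsub>G\<^esub> g" g] one by simp
      show "\<forall>x\<in>carrier A. ?c g (?c (inv\<^bsub>G\<^esub> g) x) = x"
        using g mult[of g "inv\<^bsub>G\<^esub> g"] one by simp
    qed (use g u(1) in auto)
  qed
  then show ?thesis using rep A.is_complex_algebra by (simp add: G_algebra_def)
qed


section \<open>The braided Heisenberg double\<close>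

locale heisenberg = yd G Y gr act
  for G :: "('g, 'a) monoid_scheme" and Y :: "(complex, 'v, 'm) module_scheme" and gr act
begin

lemma act_one: "v \<in> carrier Y \<Longrightarrow> act \<one>\<^bsub>G\<^esub> v = v"
  and act_mult: "g \<in> carrier G \<Longrightarrow> h \<in> carrier G \<Longrightarrow> v \<in> carrier Y \<Longrightarrow>
    act (g \<otimes>\<^bsub>G\<^esub> h) v = act g (act h v)"
  using is_representation by (auto simp: representation_def)

abbreviation Yd where "Yd \<equiv> dual Y"
abbreviation W where "W \<equiv> double_space Y"
abbreviation TW where "TW \<equiv> tensor_alg W"
abbreviation pureW where "pureW \<equiv> pure_tensor W"

lemmas dual_simps = V.dual_simps

lemma cspace_Yd: "cspace Yd"
  by (rule V.cspace_dual)

lemma cspace_W: "cspace W"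
  unfolding double_space_def by (rule cspace_direct_sum[OF V.cspace_axioms cspace_Yd])

end

sublocale heisenberg \<subseteq> Yd: tensor "dual Y"
  by (intro tensor.intro cspace_Yd)

sublocale heisenberg \<subseteq> W: tensor "double_space Y"
  by (intro tensor.intro cspace_W)

context heisenberg
begin

lemma W_simps:
  "carrier W = carrier Y \<times> carrier Yd"
  "\<zero>\<^bsub>W\<^esub> = (\<zero>\<^bsub>Y\<^esub>, \<zero>\<^bsub>Yd\<^esub>)"
  "x \<oplus>\<^bsub>W\<^esub> y = (fst x \<oplus>\<^bsub>Y\<^esub> fst y, snd x \<oplus>\<^bsub>Yd\<^esub> snd y)"
  "c \<odot>\<^bsub>W\<^esub> x = (c \<odot>\<^bsub>Y\<^esub> fst x, c \<odot>\<^bsub>Yd\<^esub> snd x)"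
  by (simp_all add: double_space_def direct_sum_simps)

lemma clinear_in_vec: "clinear Y W (in_vec Y)"
  by (intro clinearI) (simp_all add: in_vec_def W_simps)

lemma clinear_in_cov: "clinear Yd W (in_cov Y)"
  by (intro clinearI) (simp_all add: in_cov_def W_simps)

lemmas in_vec_closed = clinearD(1)[OF clinear_in_vec]
lemmas in_cov_closed = clinearD(1)[OF clinear_in_cov]

abbreviation "letters \<equiv> in_vec Y ` homogeneous \<union> in_cov Y ` carrier Yd"

lemma letters_sub: "letters \<subseteq> carrier W"
  using homogeneous_sub in_vec_closed in_cov_closed by blast

lemma letters_spanning: "carrier W \<subseteq> add_closure W letters"
proof
  fix x assume x: "x \<in> carrier W"
  then have v: "fst x \<in> carrier Y" and f: "snd x \<in> carrier Yd" by (auto simp: W_simps)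
  have "in_vec Y (fst x) \<in> add_closure W letters"
    by (rule add_closure_image[OF V.cspace_axioms W.cspace_axioms clinear_in_vec homogeneous_sub
          subsetD[OF homogeneous_spanning v] letters_sub])
      (auto intro: W.add_closure_base[OF letters_sub])
  moreover have "in_cov Y (snd x) \<in> add_closure W letters"
    using f by (intro W.add_closure_base[OF letters_sub]) auto
  moreover have "x = in_vec Y (fst x) \<oplus>\<^bsub>W\<^esub> in_cov Y (snd x)"
    using v f by (simp add: W_simps in_vec_def in_cov_def)
  ultimately show "x \<in> add_closure W letters"
    using W.add_closure_plus[OF letters_sub] by metis
qed

lemma dual_act_closed: 
  assumes "g \<in> carrier G" "f \<in> carrier Yd" shows "dual_act G Y act g f \<in> carrier Yd"
  using assms act_lin[of "inv\<^bsub>G\<^esub> g"] by (auto simp: dual_simps dual_act_def)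

lemma dual_act_one: "f \<in> carrier Yd \<Longrightarrow> dual_act G Y act \<one>\<^bsub>G\<^esub> f = f"
  by (auto simp: dual_simps dual_act_def act_one)

lemma dual_act_mult:
  assumes "g \<in> carrier G" "h \<in> carrier G"
  shows "dual_act G Y act (g \<otimes>\<^bsub>G\<^esub> h) f = dual_act G Y act g (dual_act G Y act h f)"
  using assms act_lin(1)[of "inv\<^bsub>G\<^esub> g"]
  by (auto simp: dual_act_def G.inv_mult_group act_mult fun_eq_iff)

lemma clinear_dual_act: "g \<in> carrier G \<Longrightarrow> clinear Yd Yd (dual_act G Y act g)"
  using dual_act_closed by (intro clinearI) (auto simp: dual_simps(3,4) dual_act_def)

abbreviation actW where "actW \<equiv> double_act G Y act"

lemma clinear_actW: "g \<in> carrier G \<Longrightarrow> clinear W W (actW g)"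
  using clinearD[OF clinear_dual_act[of g]]
  by (intro clinearI) (auto simp: W_simps double_act_def act_lin)

lemma actW_in_vec: "g \<in> carrier G \<Longrightarrow> actW g (in_vec Y v) = in_vec Y (act g v)"
  using clinear_zero[OF cspace_Yd cspace_Yd clinear_dual_act] by (simp add: double_act_def in_vec_def)

lemma actW_in_cov: "g \<in> carrier G \<Longrightarrow> actW g (in_cov Y f) = in_cov Y (dual_act G Y act g f)"
  by (simp add: double_act_def in_cov_def act_lin)

abbreviation actT where "actT \<equiv> \<lambda>g. tensor_map W (actW g)"

lemmas alg_hom_actT = alg_hom_tensor_map[OF cspace_W cspace_W clinear_actW]
lemmas actT_pure = tensor_map_pure[OF cspace_W cspace_W clinear_actW]

lemma smash_product_TW: "smash_product G TW actT"
proof (intro smash_product.intro smash_product_axioms.intro G.group_axioms W.T.calgebra_axioms alg_hom_actT)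
  have id: "alg_hom TW TW (\<lambda>x. x)" by (auto simp: alg_hom_def clinear_def)
  fix x assume x: "x \<in> carrier TW"
  show "actT \<one>\<^bsub>G\<^esub> x = x"
  proof (rule W.alg_hom_eqI[OF x subset_refl W.carrier_spanning W.T.calgebra_axioms alg_hom_actT id])
    fix v assume v: "v \<in> carrier W"
    then have "actW \<one>\<^bsub>G\<^esub> v = v" by (auto simp: W_simps double_act_def act_one dual_act_one)
    then show "actT \<one>\<^bsub>G\<^esub> (pureW [v]) = pureW [v]" using v by (simp add: actT_pure)
  qed simp
  fix g h assume g: "g \<in> carrier G" and h: "h \<in> carrier G"
  show "actT (g \<otimes>\<^bsub>G\<^esub> h) x = actT g (actT h x)"
  proof (rule W.alg_hom_eqI[OF x subset_refl W.carrier_spanning W.T.calgebra_axioms alg_hom_actT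
        alg_hom_comp[OF alg_hom_actT alg_hom_actT]])
    fix v assume v: "v \<in> carrier W"
    then have hv: "actW h v \<in> carrier W" using clinearD(1)[OF clinear_actW[OF h]] by blast
    have "actW (g \<otimes>\<^bsub>G\<^esub> h) v = actW g (actW h v)"
      using g h v by (auto simp: W_simps double_act_def act_mult dual_act_mult)
    then show "actT (g \<otimes>\<^bsub>G\<^esub> h) (pureW [v]) = actT g (actT h (pureW [v]))"
      using g h v hv by (simp add: actT_pure)
  qed (use g h in auto)
qed auto

end

sublocale heisenberg \<subseteq> S: smash_product G "tensor_alg (double_space Y)" "\<lambda>g. tensor_map (double_space Y) (double_act G Y act g)"
  by (rule smash_product_TW)

context heisenberg
begin

abbreviation HF where "HF \<equiv> heis_free G Y act"

lemma HF_eq: "S.S = HF"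
  by (simp add: heis_free_def)

end

sublocale heisenberg \<subseteq> HF: calgebra "heis_free G Y act"
  using S.calgebra_smash by (simp add: HF_eq)

context heisenberg
begin

lemma pre_tensor_eq: "pre_tensor G Y U = S.single U \<one>\<^bsub>G\<^esub>"
  by (simp add: pre_tensor_def S.smash_alg_eq)

lemma pre_grp_eq: "pre_grp Y g = S.single \<one>\<^bsub>TW\<^esub> g"
  by (simp add: pre_grp_def S.smash_grp_eq)

lemma alg_hom_pre_tensor: "alg_hom TW HF (pre_tensor G Y)"
proof -
  have "pre_tensor G Y = (\<lambda>U. S.single U \<one>\<^bsub>G\<^esub>)" by (simp add: fun_eq_iff pre_tensor_eq)
  then show ?thesis using S.alg_hom_coefficient by (simp add: HF_eq)
qed

lemma pre_grp_closed: "g \<in> carrier G \<Longrightarrow> pre_grp Y g \<in> carrier HF"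
  using S.single_closed[of "\<one>\<^bsub>TW\<^esub>" g] by (simp add: pre_grp_eq HF_eq)

lemma pre_grp_one: "pre_grp Y \<one>\<^bsub>G\<^esub> = \<one>\<^bsub>HF\<^esub>"
  using S.smash_simps(2) by (simp add: pre_grp_eq HF_eq)

lemma pre_grp_mult:
  "g \<in> carrier G \<Longrightarrow> h \<in> carrier G \<Longrightarrow> pre_grp Y (g \<otimes>\<^bsub>G\<^esub> h) = pre_grp Y g \<otimes>\<^bsub>HF\<^esub> pre_grp Y h"
  using S.single_mult_single[of "\<one>\<^bsub>TW\<^esub>" g "\<one>\<^bsub>TW\<^esub>" h] alg_homD(5)[OF alg_hom_actT]
  by (simp add: pre_grp_eq HF_eq)

lemma pre_grp_tensor:
  "g \<in> carrier G \<Longrightarrow> U \<in> carrier TW \<Longrightarrow>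
    pre_grp Y g \<otimes>\<^bsub>HF\<^esub> pre_tensor G Y U = pre_tensor G Y (actT g U) \<otimes>\<^bsub>HF\<^esub> pre_grp Y g"
  using S.single_mult_single[of "\<one>\<^bsub>TW\<^esub>" g U "\<one>\<^bsub>G\<^esub>"]
    S.single_mult_single[of "actT g U" "\<one>\<^bsub>G\<^esub>" "\<one>\<^bsub>TW\<^esub>" g]
    S.act_closed[of g U] S.act_one[of "\<one>\<^bsub>TW\<^esub>"]
  by (simp add: pre_grp_eq pre_tensor_eq HF_eq)

lemma single_eq: "U \<in> carrier TW \<Longrightarrow> g \<in> carrier G \<Longrightarrow>
    S.single U g = pre_tensor G Y U \<otimes>\<^bsub>HF\<^esub> pre_grp Y g"
  using S.single_mult_single[of U "\<one>\<^bsub>G\<^esub>" "\<one>\<^bsub>TW\<^esub>" g] S.act_one[of "\<one>\<^bsub>TW\<^esub>"]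
  by (simp add: pre_grp_eq pre_tensor_eq HF_eq)

lemma pre_vec_linear: "clinear Y HF (pre_vec G Y)"
proof -
  have "clinear Y HF (\<lambda>v. pre_tensor G Y (pureW [in_vec Y v]))"
    by (intro clinear_comp[OF _ alg_homD(1)[OF alg_hom_pre_tensor]]
        clinear_comp[OF clinear_in_vec W.clinear_pure1])
  then show ?thesis by (simp add: pre_vec_def[abs_def])
qed

lemma pre_cov_linear: "clinear Yd HF (pre_cov G Y)"
proof -
  have "clinear Yd HF (\<lambda>v. pre_tensor G Y (pureW [in_cov Y v]))"
    by (intro clinear_comp[OF _ alg_homD(1)[OF alg_hom_pre_tensor]]
        clinear_comp[OF clinear_in_cov W.clinear_pure1])
  then show ?thesis by (simp add: pre_cov_def[abs_def])
qed

text \<open>\<open>\<langle>f, v\<^sup>(\<^sup>0\<^sup>)\<rangle> v\<^sup>(\<^sup>1\<^sup>)\<close>, and the relation in which it occurs\<close>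

definition pairing :: "('v \<Rightarrow> complex) \<Rightarrow> 'v \<Rightarrow> ('v, 'g) heis_pre" where
  "pairing f v = (\<Oplus>\<^bsub>HF\<^esub>g\<in>{g. part v g \<noteq> \<zero>\<^bsub>Y\<^esub>}. f (part v g) \<odot>\<^bsub>HF\<^esub> pre_grp Y g)"

definition commutator :: "('v \<Rightarrow> complex) \<Rightarrow> 'v \<Rightarrow> ('v, 'g) heis_pre" where
  "commutator f v = (pre_cov G Y f \<otimes>\<^bsub>HF\<^esub> pre_vec G Y v \<ominus>\<^bsub>HF\<^esub> pre_vec G Y v \<otimes>\<^bsub>HF\<^esub> pre_cov G Y f)
     \<ominus>\<^bsub>HF\<^esub> pairing f v"

lemma supp_G: "v \<in> carrier Y \<Longrightarrow> part v g \<noteq> \<zero>\<^bsub>Y\<^esub> \<Longrightarrow> g \<in> carrier G"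
  using part_props(2) by blast

lemma clinear_pairing:
  assumes f: "f \<in> carrier Yd" shows "clinear Y HF (pairing f)"
proof (rule clinearI)
  have f': "\<And>u v. u \<in> carrier Y \<Longrightarrow> v \<in> carrier Y \<Longrightarrow> f (u \<oplus>\<^bsub>Y\<^esub> v) = f u + f v"
    "\<And>c v. v \<in> carrier Y \<Longrightarrow> f (c \<odot>\<^bsub>Y\<^esub> v) = c * f v"
    using f unfolding dual_simps(1) by blast+
  note f0 = V.dual_zero[OF f]
  fix v assume v: "v \<in> carrier Y"
  show "pairing f v \<in> carrier HF"
    unfolding pairing_def using supp_G[OF v] by (intro HF.finsum_closed) (auto simp: pre_grp_closed)
  show "pairing f (c \<odot>\<^bsub>Y\<^esub> v) = c \<odot>\<^bsub>HF\<^esub> pairing f v" for c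
    unfolding pairing_def
    by (rule HF.finsum_support_smult) (use v part_props(3) supp_G f0 in
      \<open>auto simp: part_smult part_closed f' pre_grp_closed HF.smult_smult\<close>)
  fix u assume u: "u \<in> carrier Y"
  show "pairing f (v \<oplus>\<^bsub>Y\<^esub> u) = pairing f v \<oplus>\<^bsub>HF\<^esub> pairing f u"
    unfolding pairing_def
    by (rule HF.finsum_support_add) (use u v part_props(3) supp_G f0 in
      \<open>auto simp: part_add part_closed f' pre_grp_closed HF.smult_plus_left\<close>)
qed

lemma pairing_homogeneous:
  assumes "f \<in> carrier Yd" "h \<in> carrier G" "v \<in> gr h"
  shows "pairing f v = f v \<odot>\<^bsub>HF\<^esub> pre_grp Y h"
proof -
  have "pairing f v = f (part v h) \<odot>\<^bsub>HF\<^esub> pre_grp Y h"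
    unfolding pairing_def
    by (rule HF.finsum_support_single[where l = "\<lambda>g u. f u \<odot>\<^bsub>HF\<^esub> pre_grp Y g"])
      (use assms in \<open>auto simp: part_homogeneous pre_grp_closed V.dual_zero[OF assms(1)] split: if_splits\<close>)
  then show ?thesis using assms by (simp add: part_homogeneous)
qed

lemma clinear_commutator:
  assumes f: "f \<in> carrier Yd" shows "clinear Y HF (commutator f)"
proof -
  have c: "pre_cov G Y f \<in> carrier HF" using clinearD(1)[OF pre_cov_linear f] .
  have "clinear Y HF (\<lambda>v. (pre_cov G Y f \<otimes>\<^bsub>HF\<^esub> pre_vec G Y v \<ominus>\<^bsub>HF\<^esub> pre_vec G Y v \<otimes>\<^bsub>HF\<^esub> pre_cov G Y f)
     \<ominus>\<^bsub>HF\<^esub> pairing f v)"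
    by (intro clinear_diff HF.cspace_axioms HF.clinear_mult_left HF.clinear_mult_right pre_vec_linear c
        clinear_pairing f)
  then show ?thesis by (simp add: commutator_def[abs_def])
qed

abbreviation \<Psi>d where
  "\<Psi>d \<equiv> flip Yd \<circ> yd_braiding G Yd (dual_act G Y act) (dual_grading G Y gr) \<circ> flip Yd"

abbreviation "vec_tensor U \<equiv> tensor_map W (in_vec Y) U"
abbreviation "cov_tensor U \<equiv> tensor_map W (in_cov Y) U"

lemmas alg_hom_vec_tensor = alg_hom_tensor_map[OF V.cspace_axioms cspace_W clinear_in_vec]
lemmas alg_hom_cov_tensor = alg_hom_tensor_map[OF cspace_Yd cspace_W clinear_in_cov]
lemmas vec_tensor_pure = tensor_map_pure[OF V.cspace_axioms cspace_W clinear_in_vec]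
lemmas cov_tensor_pure = tensor_map_pure[OF cspace_Yd cspace_W clinear_in_cov]

lemma relations_eq: "heis_relations G Y act gr =
    (\<lambda>U. pre_tensor G Y (vec_tensor U)) ` nichols_ideal Y \<Psi> \<union>
    (\<lambda>U. pre_tensor G Y (cov_tensor U)) ` nichols_ideal Yd \<Psi>d \<union>
    {commutator f v | f v. f \<in> carrier Yd \<and> v \<in> carrier Y}"
  unfolding heis_relations_def Let_def commutator_def pairing_def support_def ..

lemma relations_sub: "heis_relations G Y act gr \<subseteq> carrier HF"
  unfolding relations_eq
  using V.nichols_ideal_sub[of \<Psi>] Yd.nichols_ideal_sub[of \<Psi>d] clinearD(1)[OF clinear_commutator]
    alg_homD(2)[OF alg_hom_pre_tensor] alg_homD(2)[OF alg_hom_vec_tensor]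
    alg_homD(2)[OF alg_hom_cov_tensor]
  by auto

abbreviation I where "I \<equiv> heis_ideal G Y act gr"

lemma ideal_I: "ideal I HF"
  unfolding heis_ideal_def by (rule HF.genideal_ideal[OF relations_sub])

lemma relations_in_I: "r \<in> heis_relations G Y act gr \<Longrightarrow> r \<in> I"
  unfolding heis_ideal_def using HF.genideal_self[OF relations_sub] by blast

end

sublocale heisenberg \<subseteq> Q: quotient "heis_free G Y act" "heis_ideal G Y act gr"
  by (intro quotient.intro quotient_axioms.intro HF.calgebra_axioms ideal_I)

context heisenberg
begin

abbreviation H where "H \<equiv> heisenberg_double G Y act gr"

lemma H_eq: "quot_alg HF I = H"
  by (simp add: heisenberg_double_def)

end

sublocale heisenberg \<subseteq> H: calgebra "heisenberg_double G Y act gr"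
  using Q.calgebra_Q by (simp add: H_eq)

sublocale heisenberg \<subseteq> HG: smash_product G "heisenberg_double G Y act gr" "\<lambda>_ x. x"
  by (intro smash_product_trivial G.group_axioms H.calgebra_axioms)

context heisenberg
begin

abbreviation cls where "cls \<equiv> heis_class G Y act gr"
abbreviation vec where "vec \<equiv> heis_vec G Y act gr"
abbreviation cov where "cov \<equiv> heis_cov G Y act gr"
abbreviation grp where "grp \<equiv> heis_grp G Y act gr"
abbreviation "HGA \<equiv> group_alg G H"

lemma cls_eq: "cls = Q.proj"
  by (simp add: heis_class_def fun_eq_iff)

lemma alg_hom_cls: "alg_hom HF H cls"
  using Q.alg_hom_proj by (simp add: cls_eq H_eq)

lemma carrier_H: "carrier H = cls ` carrier HF"
  using Q.carrier_Q by (simp add: cls_eq H_eq)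

lemma cls_relation: "r \<in> heis_relations G Y act gr \<Longrightarrow> cls r = \<zero>\<^bsub>H\<^esub>"
  using Q.proj_eq_zero_iff[of r] relations_in_I relations_sub by (auto simp: cls_eq H_eq)

text \<open>The canonical homomorphism \<open>T(Y \<oplus> Y\<^sup>*) \<rightarrow> H\<close>\<close>

definition tensor_class :: "(('v \<times> ('v \<Rightarrow> complex)) list \<Rightarrow> complex) set \<Rightarrow> ('v, 'g) heis_pre set" where
  "tensor_class U = cls (pre_tensor G Y U)"

lemma alg_hom_tensor_class: "alg_hom TW H tensor_class"
  unfolding tensor_class_def[abs_def] by (rule alg_hom_comp[OF alg_hom_pre_tensor alg_hom_cls])

lemma vec_eq: "vec v = tensor_class (pureW [in_vec Y v])"
  by (simp add: heis_vec_def pre_vec_def tensor_class_def)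

lemma cov_eq: "cov f = tensor_class (pureW [in_cov Y f])"
  by (simp add: heis_cov_def pre_cov_def tensor_class_def)

lemma clinear_vec: "clinear Y H vec"
  unfolding heis_vec_def[abs_def] by (rule clinear_comp[OF pre_vec_linear alg_homD(1)[OF alg_hom_cls]])

lemma clinear_cov: "clinear Yd H cov"
  unfolding heis_cov_def[abs_def] by (rule clinear_comp[OF pre_cov_linear alg_homD(1)[OF alg_hom_cls]])

lemmas vec_closed = clinearD(1)[OF clinear_vec]
lemmas cov_closed = clinearD(1)[OF clinear_cov]

lemma grp_closed: "g \<in> carrier G \<Longrightarrow> grp g \<in> carrier H"
  unfolding heis_grp_def by (intro alg_homD(2)[OF alg_hom_cls] pre_grp_closed)

lemma grp_one: "grp \<one>\<^bsub>G\<^esub> = \<one>\<^bsub>H\<^esub>"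
  by (simp add: heis_grp_def pre_grp_one alg_homD(5)[OF alg_hom_cls])

lemma grp_mult:
  "g \<in> carrier G \<Longrightarrow> h \<in> carrier G \<Longrightarrow> grp (g \<otimes>\<^bsub>G\<^esub> h) = grp g \<otimes>\<^bsub>H\<^esub> grp h"
  by (simp add: heis_grp_def pre_grp_mult alg_homD(6)[OF alg_hom_cls] pre_grp_closed)

lemma grp_tensor:
  assumes "g \<in> carrier G" "U \<in> carrier TW"
  shows "grp g \<otimes>\<^bsub>H\<^esub> tensor_class U = tensor_class (actT g U) \<otimes>\<^bsub>H\<^esub> grp g"
proof -
  have p: "pre_tensor G Y U \<in> carrier HF" "pre_tensor G Y (actT g U) \<in> carrier HF"
    using assms alg_homD(2)[OF alg_hom_pre_tensor] S.act_closed by auto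
  have "cls (pre_grp Y g \<otimes>\<^bsub>HF\<^esub> pre_tensor G Y U) = cls (pre_tensor G Y (actT g U) \<otimes>\<^bsub>HF\<^esub> pre_grp Y g)"
    using pre_grp_tensor[OF assms] by simp
  then show ?thesis
    using assms p by (simp add: heis_grp_def tensor_class_def alg_homD(6)[OF alg_hom_cls] pre_grp_closed)
qed

lemma grp_vec:
  assumes "g \<in> carrier G" "v \<in> carrier Y"
  shows "grp g \<otimes>\<^bsub>H\<^esub> vec v = vec (act g v) \<otimes>\<^bsub>H\<^esub> grp g"
  using grp_tensor[OF assms(1), of "pureW [in_vec Y v]"] assms
  by (simp add: vec_eq in_vec_closed actT_pure actW_in_vec)

lemma grp_cov:
  assumes "g \<in> carrier G" "f \<in> carrier Yd"
  shows "grp g \<otimes>\<^bsub>H\<^esub> cov f = cov (dual_act G Y act g f) \<otimes>\<^bsub>H\<^esub> grp g"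
  using grp_tensor[OF assms(1), of "pureW [in_cov Y f]"] assms
  by (simp add: cov_eq in_cov_closed actT_pure actW_in_cov)


subsection \<open>The coaction on the double\<close>

text \<open>\<open>(v, f) \<mapsto> \<Sum>\<^sub>g v\<^sub>g \<otimes> g + f \<otimes> 1\<close>, which puts \<open>Y\<^sub>g\<close> into degree \<open>g\<close> and \<open>Y\<^sup>*\<close> into degree 1\<close>

definition letter_coaction :: "'v \<times> ('v \<Rightarrow> complex) \<Rightarrow> 'g \<Rightarrow> ('v, 'g) heis_pre set" where
  "letter_coaction x = (\<lambda>g. vec (part (fst x) g)) \<oplus>\<^bsub>HGA\<^esub> HG.single (cov (snd x)) \<one>\<^bsub>G\<^esub>"

lemma vec_zero: "vec \<zero>\<^bsub>Y\<^esub> = \<zero>\<^bsub>H\<^esub>"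
  by (rule clinear_zero[OF V.cspace_axioms H.cspace_axioms clinear_vec])

lemma clinear_vec_coaction: "clinear Y HGA (\<lambda>v g. vec (part v g))"
proof (rule clinearI)
  fix v assume v: "v \<in> carrier Y"
  have "finite {g. vec (part v g) \<noteq> \<zero>\<^bsub>H\<^esub>}"
    by (rule finite_subset[OF _ part_props(3)[OF v]]) (auto simp: vec_zero)
  then show "(\<lambda>g. vec (part v g)) \<in> carrier HGA"
    using v by (auto simp: HG.smash_simps(1) vec_closed part_closed part_props(2) vec_zero)
  show "(\<lambda>g. vec (part (c \<odot>\<^bsub>Y\<^esub> v) g)) = c \<odot>\<^bsub>HGA\<^esub> (\<lambda>g. vec (part v g))" for c
    using v by (simp add: HG.smash_simps(5) part_smult clinearD(3)[OF clinear_vec] part_closed)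
next
  fix u v assume "u \<in> carrier Y" "v \<in> carrier Y"
  then show "(\<lambda>g. vec (part (u \<oplus>\<^bsub>Y\<^esub> v) g)) = (\<lambda>g. vec (part u g)) \<oplus>\<^bsub>HGA\<^esub> (\<lambda>g. vec (part v g))"
    by (simp add: HG.smash_simps(4) part_add clinearD(2)[OF clinear_vec] part_closed)
qed

lemma clinear_single: "g \<in> carrier G \<Longrightarrow> clinear H HGA (\<lambda>a. HG.single a g)"
  by (intro clinearI) (simp_all add: HG.single_closed HG.single_add HG.single_smult)

lemma clinear_letter_coaction: "clinear W HGA letter_coaction"
proof -
  note 1 = clinearD[OF clinear_vec_coaction]
  note 2 = clinearD[OF clinear_comp[OF clinear_cov clinear_single[OF G.one_closed]]]
  show ?thesis
  proof (rule clinearI)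
    fix x y assume "x \<in> carrier W" "y \<in> carrier W"
    then obtain u f v f' where xy: "x = (u, f)" "y = (v, f')"
      and cl: "u \<in> carrier Y" "v \<in> carrier Y" "f \<in> carrier Yd" "f' \<in> carrier Yd"
      by (auto simp: W_simps)
    show "letter_coaction x \<in> carrier HGA"
      using 1(1)[OF cl(1)] 2(1)[OF cl(3)] by (simp add: letter_coaction_def xy)
    show "letter_coaction (x \<oplus>\<^bsub>W\<^esub> y) = letter_coaction x \<oplus>\<^bsub>HGA\<^esub> letter_coaction y"
      using 1(1)[OF cl(1)] 2(1)[OF cl(3)] 1(1)[OF cl(2)] 2(1)[OF cl(4)]
      by (simp add: letter_coaction_def xy W_simps 1(2)[OF cl(1,2)] 2(2)[OF cl(3,4)] HG.SV.a_ac)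
  next
    fix c x assume "x \<in> carrier W"
    then obtain u f where x: "x = (u, f)" and cl: "u \<in> carrier Y" "f \<in> carrier Yd"
      by (auto simp: W_simps)
    show "letter_coaction (c \<odot>\<^bsub>W\<^esub> x) = c \<odot>\<^bsub>HGA\<^esub> letter_coaction x"
      using 1(1)[OF cl(1)] 2(1)[OF cl(2)]
      by (simp add: letter_coaction_def x W_simps 1(3)[OF cl(1)] 2(3)[OF cl(2)] HG.SV.smult_plus_right)
  qed
qed

definition tensor_coaction where "tensor_coaction = W.extension HGA letter_coaction"

lemma alg_hom_tensor_coaction: "alg_hom TW HGA tensor_coaction"
  unfolding tensor_coaction_def
  by (rule W.alg_hom_extension[OF HG.calgebra_smash clinear_letter_coaction])

lemma tensor_coaction_letter:
  "x \<in> carrier W \<Longrightarrow> tensor_coaction (pureW [x]) = letter_coaction x"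
  unfolding tensor_coaction_def
  by (rule W.extension_letter[OF HG.calgebra_smash clinear_letter_coaction])

lemma tensor_coaction_vec:
  assumes h: "h \<in> carrier G" and v: "v \<in> gr h"
  shows "tensor_coaction (pureW [in_vec Y v]) = HG.single (vec v) h"
proof -
  have v': "v \<in> carrier Y" using gr_sub h v by blast
  have "cov \<zero>\<^bsub>Yd\<^esub> = \<zero>\<^bsub>H\<^esub>" by (rule clinear_zero[OF cspace_Yd H.cspace_axioms clinear_cov])
  moreover have "(\<lambda>g. vec (part v g)) = HG.single (vec v) h"
    by (auto simp: fun_eq_iff HG.single_def part_homogeneous[OF h v] vec_zero)
  ultimately show ?thesis
    unfolding tensor_coaction_letter[OF in_vec_closed[OF v']]
    using HG.single_closed[OF vec_closed[OF v'] h]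
    by (simp add: letter_coaction_def in_vec_def HG.single_zero)
qed

lemma tensor_coaction_cov:
  assumes f: "f \<in> carrier Yd"
  shows "tensor_coaction (pureW [in_cov Y f]) = HG.single (cov f) \<one>\<^bsub>G\<^esub>"
proof -
  have "(\<lambda>g. vec (part \<zero>\<^bsub>Y\<^esub> g)) = \<zero>\<^bsub>HGA\<^esub>" by (simp add: part_zero vec_zero HG.smash_simps(3))
  then show ?thesis
    unfolding tensor_coaction_letter[OF in_cov_closed[OF f]]
    using HG.single_closed[OF cov_closed[OF f] G.one_closed]
    by (simp add: letter_coaction_def in_cov_def)
qed

abbreviation grp_coaction where "grp_coaction g \<equiv> HG.single (grp g) g"

text \<open>
  For \<open>v\<close> of degree \<open>h\<close>, the two sides of \<open>g v = (g \<triangleright> v) g\<close> have the degrees \<open>g h\<close> and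
  \<open>(g h g\<^sup>-\<^sup>1) g\<close>, which agree. This lets the coaction extend from the tensor algebra to its smash
  product with \<open>G\<close>.
\<close>

lemma grp_coaction_commute:
  assumes g: "g \<in> carrier G" and U: "U \<in> carrier TW"
  shows "grp_coaction g \<otimes>\<^bsub>HGA\<^esub> tensor_coaction U = tensor_coaction (actT g U) \<otimes>\<^bsub>HGA\<^esub> grp_coaction g"
proof -
  note t = alg_homD[OF alg_hom_tensor_coaction]
  note a = alg_homD[OF alg_hom_actT[OF g]]
  have gc: "grp_coaction g \<in> carrier HGA" using g by (simp add: HG.single_closed grp_closed)
  have letter: "grp_coaction g \<otimes>\<^bsub>HGA\<^esub> tensor_coaction (pureW [x]) =
      tensor_coaction (actT g (pureW [x])) \<otimes>\<^bsub>HGA\<^esub> grp_coaction g" if "x \<in> letters" for x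
    using that
  proof
    assume "x \<in> in_vec Y ` homogeneous"
    then obtain h v where h: "h \<in> carrier G" and v: "v \<in> gr h" and x: "x = in_vec Y v" by auto
    have v': "v \<in> carrier Y" using gr_sub h v by blast
    have gv: "act g v \<in> gr (g \<otimes>\<^bsub>G\<^esub> h \<otimes>\<^bsub>G\<^esub> inv\<^bsub>G\<^esub> g)" using act_gr[OF g h] v by blast
    have gv': "act g v \<in> carrier Y" using act_lin(1) g v' by blast
    have "tensor_coaction (actT g (pureW [x])) = HG.single (vec (act g v)) (g \<otimes>\<^bsub>G\<^esub> h \<otimes>\<^bsub>G\<^esub> inv\<^bsub>G\<^esub> g)"
      using tensor_coaction_vec[OF _ gv] g h v'
      by (simp add: x actT_pure in_vec_closed actW_in_vec)
    then show ?thesis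
      using g h v' gv'
      by (simp add: x tensor_coaction_vec[OF h v] HG.single_mult_single vec_closed grp_closed grp_vec
        G.m_assoc)
  next
    assume "x \<in> in_cov Y ` carrier Yd"
    then obtain f where f: "f \<in> carrier Yd" and x: "x = in_cov Y f" by auto
    show ?thesis
      using g f dual_act_closed[OF g f]
      by (simp add: x actT_pure in_cov_closed actW_in_cov tensor_coaction_cov HG.single_mult_single
        cov_closed grp_closed grp_cov)
  qed
  have mult: "grp_coaction g \<otimes>\<^bsub>HGA\<^esub> tensor_coaction (x \<otimes>\<^bsub>TW\<^esub> y) =
      tensor_coaction (actT g (x \<otimes>\<^bsub>TW\<^esub> y)) \<otimes>\<^bsub>HGA\<^esub> grp_coaction g"
    if x: "x \<in> carrier TW" and y: "y \<in> carrier TW"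
      and ex: "grp_coaction g \<otimes>\<^bsub>HGA\<^esub> tensor_coaction x = tensor_coaction (actT g x) \<otimes>\<^bsub>HGA\<^esub> grp_coaction g"
      and ey: "grp_coaction g \<otimes>\<^bsub>HGA\<^esub> tensor_coaction y = tensor_coaction (actT g y) \<otimes>\<^bsub>HGA\<^esub> grp_coaction g"
    for x y
  proof -
    have "grp_coaction g \<otimes>\<^bsub>HGA\<^esub> tensor_coaction (x \<otimes>\<^bsub>TW\<^esub> y) =
        grp_coaction g \<otimes>\<^bsub>HGA\<^esub> tensor_coaction x \<otimes>\<^bsub>HGA\<^esub> tensor_coaction y"
      using x y gc by (simp add: t HG.S.m_assoc)
    also have "\<dots> = tensor_coaction (actT g x) \<otimes>\<^bsub>HGA\<^esub> (grp_coaction g \<otimes>\<^bsub>HGA\<^esub> tensor_coaction y)"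
      unfolding ex using x y gc by (simp add: t a HG.S.m_assoc)
    also have "\<dots> = tensor_coaction (actT g (x \<otimes>\<^bsub>TW\<^esub> y)) \<otimes>\<^bsub>HGA\<^esub> grp_coaction g"
      unfolding ey using x y gc by (simp add: t a HG.S.m_assoc)
    finally show ?thesis .
  qed
  show ?thesis using U
  proof (induction rule: W.tensor_induct[of _ letters])
    case (pure w)
    then show ?case
    proof (induction w)
      case Nil
      then show ?case using gc by (simp add: W.pure_Nil t a)
    next
      case (Cons x w)
      have "set (x # w) \<subseteq> carrier W" using Cons.prems letters_sub by (rule subset_trans)
      then have "x \<in> carrier W" "set w \<subseteq> carrier W" by simp_all
      then show ?case using mult[of "pureW [x]" "pureW w"] letter[of x] Cons
        by (simp add: W.pure_Cons[of x w])
    qed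
  next
    case zero
    have "grp_coaction g \<otimes>\<^bsub>HGA\<^esub> tensor_coaction \<zero>\<^bsub>TW\<^esub> = \<zero>\<^bsub>HGA\<^esub>"
      "tensor_coaction (actT g \<zero>\<^bsub>TW\<^esub>) \<otimes>\<^bsub>HGA\<^esub> grp_coaction g = \<zero>\<^bsub>HGA\<^esub>"
      using gc clinear_zero[OF W.T.cspace_axioms HG.SV.cspace_axioms t(1)]
        clinear_zero[OF W.T.cspace_axioms W.T.cspace_axioms a(1)] by simp_all
    then show ?case by simp
  next
    case (add x y)
    then show ?case using gc by (simp add: t a HG.S.l_distr HG.S.r_distr)
  next
    case (smult c x)
    then show ?case using gc by (simp add: t a)
  qed (use letters_sub letters_spanning in auto)
qed

definition free_coaction where
  "free_coaction = S.smash_ext HGA tensor_coaction grp_coaction"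

lemma
  shows alg_hom_free_coaction: "alg_hom HF HGA free_coaction"
    and free_coaction_single: "U \<in> carrier TW \<Longrightarrow> g \<in> carrier G \<Longrightarrow>
      free_coaction (S.single U g) = tensor_coaction U \<otimes>\<^bsub>HGA\<^esub> grp_coaction g"
proof -
  have 1: "grp_coaction g \<in> carrier HGA" if "g \<in> carrier G" for g
    using that by (simp add: HG.single_closed grp_closed)
  have 2: "grp_coaction \<one>\<^bsub>G\<^esub> = \<one>\<^bsub>HGA\<^esub>" by (simp add: grp_one HG.smash_simps(2))
  have 3: "grp_coaction (g \<otimes>\<^bsub>G\<^esub> h) = grp_coaction g \<otimes>\<^bsub>HGA\<^esub> grp_coaction h"
    if "g \<in> carrier G" "h \<in> carrier G" for g h
    using that by (simp add: HG.single_mult_single grp_closed grp_mult)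
  note E = S.alg_hom_smash_ext[OF HG.calgebra_smash alg_hom_tensor_coaction, of grp_coaction, OF 1 2 3 grp_coaction_commute]
    S.smash_ext_single[OF HG.calgebra_smash alg_hom_tensor_coaction, of grp_coaction, OF 1 2 3 grp_coaction_commute]
  show "alg_hom HF HGA free_coaction" unfolding free_coaction_def HF_eq[symmetric] by (rule E(1))
  show "U \<in> carrier TW \<Longrightarrow> g \<in> carrier G \<Longrightarrow>
      free_coaction (S.single U g) = tensor_coaction U \<otimes>\<^bsub>HGA\<^esub> grp_coaction g"
    unfolding free_coaction_def by (rule E(2))
qed

lemma free_coaction_tensor: "U \<in> carrier TW \<Longrightarrow> free_coaction (pre_tensor G Y U) = tensor_coaction U"
  using free_coaction_single[of U "\<one>\<^bsub>G\<^esub>"] alg_homD(2)[OF alg_hom_tensor_coaction, of U]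
  by (simp add: pre_tensor_eq grp_one HG.smash_simps(2)[symmetric])

lemma free_coaction_grp: "g \<in> carrier G \<Longrightarrow> free_coaction (pre_grp Y g) = grp_coaction g"
  using free_coaction_single[of "\<one>\<^bsub>TW\<^esub>" g]
  by (simp add: pre_grp_eq alg_homD(5)[OF alg_hom_tensor_coaction] HG.single_closed grp_closed)

text \<open>
  The coefficient at \<open>g\<close> of the coaction of \<open>U\<close> is the class of the component of \<open>U\<close> of degree \<open>g\<close>,
  and this component is again a relation because the Nichols ideal is graded.
\<close>

lemma free_coaction_nichols:
  assumes "U \<in> nichols_ideal Y \<Psi>"
  shows "free_coaction (pre_tensor G Y (vec_tensor U)) = \<zero>\<^bsub>HGA\<^esub>"
proof -
  have U: "U \<in> carrier T" using assms V.nichols_ideal_sub by blast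
  let ?j = "\<lambda>U. tensor_class (vec_tensor U)"
  have j: "alg_hom T H ?j" by (rule alg_hom_comp[OF alg_hom_vec_tensor alg_hom_tensor_class])
  have "tensor_coaction (vec_tensor U) = (\<lambda>g. ?j (\<delta> U g))"
  proof (rule V.alg_hom_eqI[OF U homogeneous_sub homogeneous_spanning HG.calgebra_smash])
    show "alg_hom T HGA (\<lambda>U. tensor_coaction (vec_tensor U))"
      by (rule alg_hom_comp[OF alg_hom_vec_tensor alg_hom_tensor_coaction])
    show "alg_hom T HGA (\<lambda>U g. ?j (\<delta> U g))"
      by (rule alg_hom_comp[OF alg_hom_\<delta>
        alg_hom_coefficientwise[OF G.group_axioms V.T.calgebra_axioms H.calgebra_axioms j]])
    fix v assume "v \<in> homogeneous"
    then obtain h where h: "h \<in> carrier G" and v: "v \<in> gr h" by auto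
    then have v': "v \<in> carrier Y" using gr_sub by blast
    show "tensor_coaction (vec_tensor (pure [v])) = (\<lambda>g. ?j (\<delta> (pure [v]) g))"
      using TC.degree_part_apply[OF letter_degree[OF h v]]
        alg_hom_zero[OF V.T.calgebra_axioms H.calgebra_axioms j]
      by (simp add: fun_eq_iff vec_tensor_pure v' tensor_coaction_vec[OF h v] HG.single_def vec_eq)
  qed
  moreover have "?j (\<delta> U g) = \<zero>\<^bsub>H\<^esub>" for g
    unfolding tensor_class_def
    by (rule cls_relation) (use nichols_ideal_part[OF assms] in \<open>auto simp: relations_eq\<close>)
  ultimately show ?thesis
    using U by (simp add: free_coaction_tensor alg_homD(2)[OF alg_hom_vec_tensor] HG.smash_simps(3))
qed

text \<open>All of \<open>T(Y\<^sup>*)\<close> has degree 1, so the coaction sends \<open>U\<close> to its class, which is zero, at 1.\<close>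

lemma free_coaction_nichols_dual:
  assumes "U \<in> nichols_ideal Yd \<Psi>d"
  shows "free_coaction (pre_tensor G Y (cov_tensor U)) = \<zero>\<^bsub>HGA\<^esub>"
proof -
  have U: "U \<in> carrier (tensor_alg Yd)" using assms Yd.nichols_ideal_sub by blast
  let ?j = "\<lambda>U. tensor_class (cov_tensor U)"
  have j: "alg_hom (tensor_alg Yd) H ?j" by (rule alg_hom_comp[OF alg_hom_cov_tensor alg_hom_tensor_class])
  have "tensor_coaction (cov_tensor U) = HG.single (?j U) \<one>\<^bsub>G\<^esub>"
  proof (rule Yd.alg_hom_eqI[OF U subset_refl Yd.carrier_spanning HG.calgebra_smash])
    show "alg_hom (tensor_alg Yd) HGA (\<lambda>U. tensor_coaction (cov_tensor U))"
      by (rule alg_hom_comp[OF alg_hom_cov_tensor alg_hom_tensor_coaction])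
    show "alg_hom (tensor_alg Yd) HGA (\<lambda>U. HG.single (?j U) \<one>\<^bsub>G\<^esub>)"
      by (rule alg_hom_comp[OF j HG.alg_hom_coefficient])
    fix f assume f: "f \<in> carrier Yd"
    then show "tensor_coaction (cov_tensor (pure_tensor Yd [f])) =
        HG.single (?j (pure_tensor Yd [f])) \<one>\<^bsub>G\<^esub>"
      by (simp add: cov_tensor_pure tensor_coaction_cov cov_eq)
  qed
  moreover have "?j U = \<zero>\<^bsub>H\<^esub>"
    unfolding tensor_class_def by (rule cls_relation) (use assms in \<open>auto simp: relations_eq\<close>)
  ultimately show ?thesis
    using U by (simp add: free_coaction_tensor alg_homD(2)[OF alg_hom_cov_tensor] HG.single_zero)
qed

text \<open>
  By linearity \<open>v\<close> may be taken homogeneous, say of degree \<open>h\<close>. Then \<open>f v\<close>, \<open>v f\<close> and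
  \<open>\<langle>f, v\<rangle> h\<close> all have degree \<open>h\<close>, so the coaction only attaches \<open>h\<close> to the relation.
\<close>

lemma free_coaction_commutator:
  assumes f: "f \<in> carrier Yd" and v: "v \<in> carrier Y"
  shows "free_coaction (commutator f v) = \<zero>\<^bsub>HGA\<^esub>"
proof -
  note F = alg_homD[OF alg_hom_free_coaction]
  note F_minus = clinear_minus[OF HF.cspace_axioms HG.SV.cspace_axioms F(1)]
  note c = alg_homD[OF alg_hom_cls] clinear_minus[OF HF.cspace_axioms H.cspace_axioms alg_homD(1)[OF alg_hom_cls]]
  have lin: "clinear Y HGA (\<lambda>v. free_coaction (commutator f v))"
    by (rule clinear_comp[OF clinear_commutator[OF f] F(1)])
  have cf: "pre_cov G Y f \<in> carrier HF" using clinearD(1)[OF pre_cov_linear f] .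
  have hom: "free_coaction (commutator f u) = \<zero>\<^bsub>HGA\<^esub>" if h: "h \<in> carrier G" and u: "u \<in> gr h" for h u
  proof -
    have u': "u \<in> carrier Y" using gr_sub h u by blast
    have cu: "pre_vec G Y u \<in> carrier HF" using clinearD(1)[OF pre_vec_linear u'] .
    have eq: "commutator f u = (pre_cov G Y f \<otimes>\<^bsub>HF\<^esub> pre_vec G Y u \<ominus>\<^bsub>HF\<^esub> pre_vec G Y u \<otimes>\<^bsub>HF\<^esub> pre_cov G Y f)
        \<ominus>\<^bsub>HF\<^esub> f u \<odot>\<^bsub>HF\<^esub> pre_grp Y h"
      by (simp add: commutator_def pairing_homogeneous[OF f h u])
    note s_minus = clinear_minus[OF H.cspace_axioms HG.SV.cspace_axioms clinear_single[OF h]]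
    have F_cov: "free_coaction (pre_cov G Y f) = HG.single (cov f) \<one>\<^bsub>G\<^esub>"
      using f by (simp add: pre_cov_def free_coaction_tensor in_cov_closed tensor_coaction_cov)
    have F_vec: "free_coaction (pre_vec G Y u) = HG.single (vec u) h"
      using u' by (simp add: pre_vec_def free_coaction_tensor in_vec_closed tensor_coaction_vec[OF h u])
    have "free_coaction (commutator f u) =
        HG.single ((cov f \<otimes>\<^bsub>H\<^esub> vec u \<ominus>\<^bsub>H\<^esub> vec u \<otimes>\<^bsub>H\<^esub> cov f) \<ominus>\<^bsub>H\<^esub> f u \<odot>\<^bsub>H\<^esub> grp h) h"
      using f u' h cf cu
      by (simp add: eq F F_minus F_cov F_vec pre_grp_closed free_coaction_grp HG.single_mult_single
        cov_closed vec_closed s_minus grp_closed HG.single_smult)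
    also have "(cov f \<otimes>\<^bsub>H\<^esub> vec u \<ominus>\<^bsub>H\<^esub> vec u \<otimes>\<^bsub>H\<^esub> cov f) \<ominus>\<^bsub>H\<^esub> f u \<odot>\<^bsub>H\<^esub> grp h = cls (commutator f u)"
      using cf cu h by (simp add: eq c heis_cov_def heis_vec_def heis_grp_def pre_grp_closed)
    also have "\<dots> = \<zero>\<^bsub>H\<^esub>"
      by (rule cls_relation) (use f u' in \<open>auto simp: relations_eq\<close>)
    finally show ?thesis by (simp add: HG.single_zero)
  qed
  have "v \<in> add_closure Y homogeneous" using homogeneous_spanning v by blast
  then show ?thesis
  proof (induction rule: add_closure.induct)
    case zero
    then show ?case by (rule clinear_zero[OF V.cspace_axioms HG.SV.cspace_axioms lin])
  next
    case (add u s)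
    then have "u \<in> carrier Y" "s \<in> carrier Y"
      using homogeneous_sub V.add_closure_carrier[OF homogeneous_sub] by auto
    with add show ?case using hom clinearD(2)[OF lin, of u s] by auto
  qed
qed

lemma free_coaction_I: "x \<in> I \<Longrightarrow> free_coaction x = \<zero>\<^bsub>HGA\<^esub>"
proof -
  note F = alg_homD[OF alg_hom_free_coaction] clinear_zero[OF HF.cspace_axioms HG.SV.cspace_axioms alg_homD(1)[OF alg_hom_free_coaction]]
  let ?K = "{x \<in> carrier HF. free_coaction x = \<zero>\<^bsub>HGA\<^esub>}"
  have "submodule ?K CC HF"
    by (intro HF.submodule_memI) (auto simp: F)
  then have "ideal ?K HF"
    by (intro idealI HF.ring_axioms) (auto intro: submodule.axioms simp: F)
  moreover have "heis_relations G Y act gr \<subseteq> ?K"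
    using relations_sub free_coaction_nichols free_coaction_nichols_dual free_coaction_commutator
    unfolding relations_eq by blast
  ultimately have "I \<subseteq> ?K" unfolding heis_ideal_def by (rule HF.genideal_minimal)
  then show "x \<in> I \<Longrightarrow> free_coaction x = \<zero>\<^bsub>HGA\<^esub>" by blast
qed

definition \<Delta> :: "('v, 'g) heis_pre set \<Rightarrow> 'g \<Rightarrow> ('v, 'g) heis_pre set" where
  "\<Delta> x = free_coaction (SOME y. y \<in> x)"

lemma alg_hom_\<Delta>: "alg_hom H HGA \<Delta>"
  using Q.alg_hom_some_rep[OF HG.calgebra_smash alg_hom_free_coaction free_coaction_I]
  by (simp add: \<Delta>_def[abs_def] H_eq)

lemma \<Delta>_cls: "x \<in> carrier HF \<Longrightarrow> \<Delta> (cls x) = free_coaction x"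
  using Q.some_rep[OF HG.SV.cspace_axioms alg_homD(1)[OF alg_hom_free_coaction] free_coaction_I]
  by (simp add: \<Delta>_def cls_eq)

end

sublocale heisenberg \<subseteq> HC: coaction G "heisenberg_double G Y act gr" \<Delta>
  by (intro coaction.intro coaction_axioms.intro HG.smash_product_axioms alg_hom_\<Delta>)

context heisenberg
begin

lemma vec_degree:
  assumes h: "h \<in> carrier G" and v: "v \<in> gr h" shows "vec v \<in> HC.degree_part h"
proof -
  have v': "v \<in> carrier Y" using gr_sub h v by blast
  have "\<Delta> (vec v) = tensor_coaction (pureW [in_vec Y v])"
    using v' clinearD(1)[OF pre_vec_linear v']
    by (simp add: heis_vec_def \<Delta>_cls pre_vec_def free_coaction_tensor in_vec_closed)
  then show ?thesis using v' by (simp add: HC.degree_part_def tensor_coaction_vec[OF h v] vec_closed)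
qed

lemma cov_degree:
  assumes f: "f \<in> carrier Yd" shows "cov f \<in> HC.degree_part \<one>\<^bsub>G\<^esub>"
proof -
  have "\<Delta> (cov f) = tensor_coaction (pureW [in_cov Y f])"
    using f clinearD(1)[OF pre_cov_linear f]
    by (simp add: heis_cov_def \<Delta>_cls pre_cov_def free_coaction_tensor in_cov_closed)
  then show ?thesis using f by (simp add: HC.degree_part_def tensor_coaction_cov cov_closed)
qed

lemma grp_degree:
  assumes g: "g \<in> carrier G" shows "grp g \<in> HC.degree_part g"
proof -
  have "\<Delta> (grp g) = grp_coaction g"
    using g by (simp add: heis_grp_def \<Delta>_cls pre_grp_closed free_coaction_grp)
  then show ?thesis using g by (simp add: HC.degree_part_def grp_closed)
qed

text \<open>
  The generators are sums of homogeneous elements, and products of homogeneous elements are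
  homogeneous.
\<close>

lemma H_spanned: "carrier H \<subseteq> add_closure H (\<Union>g\<in>carrier G. HC.degree_part g)"
proof -
  let ?D = "\<Union>g\<in>carrier G. HC.degree_part g"
  let ?A = "add_closure H ?D"
  note sub = HC.degree_part_Union_sub
  have mult: "x \<otimes>\<^bsub>H\<^esub> y \<in> ?D" if "x \<in> ?D" "y \<in> ?D" for x y
    using that HC.degree_part_mult by (auto intro!: bexI[OF _ G.m_closed])
  have t: "tensor_class U \<in> ?A" if "U \<in> carrier TW" for U
    using that
  proof (induction rule: W.tensor_induct[of _ letters])
    case (pure w)
    have "tensor_class (pureW w) \<in> ?D" using pure
    proof (induction w)
      case Nil
      then show ?case
        using HC.degree_part_one by (auto simp: W.pure_Nil alg_homD(5)[OF alg_hom_tensor_class])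
    next
      case (Cons x w)
      have "set (x # w) \<subseteq> carrier W" using Cons.prems letters_sub by (rule subset_trans)
      then have "x \<in> carrier W" "set w \<subseteq> carrier W" by simp_all
      then have "tensor_class (pureW (x # w)) = tensor_class (pureW [x]) \<otimes>\<^bsub>H\<^esub> tensor_class (pureW w)"
        by (simp add: W.pure_Cons[of x w] alg_homD(6)[OF alg_hom_tensor_class])
      moreover have "tensor_class (pureW [x]) \<in> ?D"
        using Cons.prems vec_degree cov_degree by (auto simp: vec_eq cov_eq)
      ultimately show ?case using Cons mult by simp
    qed
    then show ?case by (rule H.add_closure_base[OF sub])
  next
    case zero
    show ?case
      by (simp add: clinear_zero[OF W.T.cspace_axioms H.cspace_axioms alg_homD(1)[OF alg_hom_tensor_class]]
        add_closure.zero)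
  next
    case (add x y)
    then show ?case by (simp add: alg_homD(3)[OF alg_hom_tensor_class] H.add_closure_plus[OF sub])
  next
    case (smult c x)
    have "c \<odot>\<^bsub>H\<^esub> tensor_class x \<in> ?A"
      by (rule H.add_closure_smult[OF sub _ smult.IH]) (auto intro: HC.degree_part_smult)
    with smult show ?case by (simp add: alg_homD(4)[OF alg_hom_tensor_class])
  qed (use letters_sub letters_spanning in auto)
  show ?thesis
  proof
    fix y assume "y \<in> carrier H"
    then obtain x where x: "x \<in> carrier HF" and y: "y = cls x" by (auto simp: carrier_H)
    have "x \<in> carrier S.S" using x by (simp add: HF_eq)
    then have "cls x \<in> ?A"
    proof (induction x rule: S.smash_induct)
      case zero
      then show ?case
        using clinear_zero[OF HF.cspace_axioms H.cspace_axioms alg_homD(1)[OF alg_hom_cls]]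
        by (simp add: HF_eq add_closure.zero)
    next
      case (add a g x)
      have cl: "pre_tensor G Y a \<in> carrier HF" "pre_grp Y g \<in> carrier HF" "x \<in> carrier HF"
        using add alg_homD(2)[OF alg_hom_pre_tensor] pre_grp_closed by (auto simp: HF_eq)
      have "cls (S.single a g \<oplus>\<^bsub>S.S\<^esub> x) = tensor_class a \<otimes>\<^bsub>H\<^esub> grp g \<oplus>\<^bsub>H\<^esub> cls x"
        using add cl
        by (simp add: HF_eq single_eq alg_homD[OF alg_hom_cls] tensor_class_def heis_grp_def)
      moreover have "grp g \<in> ?A"
        using grp_degree add by (intro H.add_closure_base[OF sub]) auto
      ultimately show ?case
        using t[OF add.hyps(1)] add.IH H.add_closure_mult[OF sub mult] H.add_closure_plus[OF sub] by simp
    qed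
    then show "y \<in> ?A" using y by simp
  qed
qed

lemma G_algebra_conj: "G_algebra G H (heis_conj G Y act gr)"
proof -
  have "heis_conj G Y act gr = (\<lambda>g x. grp g \<otimes>\<^bsub>H\<^esub> x \<otimes>\<^bsub>H\<^esub> grp (inv\<^bsub>G\<^esub> g))"
    by (simp add: fun_eq_iff heis_conj_def Let_def)
  then show ?thesis
    using G_algebra_conjugation[OF G.group_axioms H.calgebra_axioms, of grp, OF grp_closed grp_one grp_mult]
    by simp
qed

lemma heis_grading_degree_part: "heis_grading G Y act gr HC.degree_part"
proof -
  interpret spanned_coaction G H \<Delta>
    by (intro spanned_coaction.intro HC.coaction_axioms spanned_coaction_axioms.intro H_spanned)
  show ?thesis
    unfolding heis_grading_def
    using algebra_grading_degree_part grp_degree vec_degree cov_degree by blast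
qed

text \<open>Since \<open>g\<close> has degree \<open>g\<close>, conjugation by it conjugates degrees.\<close>

lemma yd_algebra_heis_grading:
  assumes D: "heis_grading G Y act gr D"
  shows "yd_algebra G H (heis_conj G Y act gr) D"
proof -
  let ?c = "heis_conj G Y act gr"
  have ag: "algebra_grading G H D" and grpD: "\<And>g. g \<in> carrier G \<Longrightarrow> grp g \<in> D g"
    using D by (auto simp: heis_grading_def)
  then have gH: "grading G H D"
    and Dm: "\<And>g h x y. g \<in> carrier G \<Longrightarrow> h \<in> carrier G \<Longrightarrow> x \<in> D g \<Longrightarrow> y \<in> D h \<Longrightarrow>
      x \<otimes>\<^bsub>H\<^esub> y \<in> D (g \<otimes>\<^bsub>G\<^esub> h)"
    by (auto simp: algebra_grading_def)
  have rep: "representation G H ?c" using G_algebra_conj by (simp add: G_algebra_def)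
  have sub: "D g \<subseteq> carrier H" if "g \<in> carrier G" for g
    using gH that module.submoduleE(1)[OF H.is_module] by (simp add: grading_def)
  have into: "?c g x \<in> D (g \<otimes>\<^bsub>G\<^esub> h \<otimes>\<^bsub>G\<^esub> inv\<^bsub>G\<^esub> g)"
    if "g \<in> carrier G" "h \<in> carrier G" "x \<in> D h" for g h x
    using that by (auto simp: heis_conj_def Let_def intro!: Dm grpD)
  have "?c g ` D h = D (g \<otimes>\<^bsub>G\<^esub> h \<otimes>\<^bsub>G\<^esub> inv\<^bsub>G\<^esub> g)" if g: "g \<in> carrier G" and h: "h \<in> carrier G" for g h
  proof
    show "?c g ` D h \<subseteq> D (g \<otimes>\<^bsub>G\<^esub> h \<otimes>\<^bsub>G\<^esub> inv\<^bsub>G\<^esub> g)" using into g h by blast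
    show "D (g \<otimes>\<^bsub>G\<^esub> h \<otimes>\<^bsub>G\<^esub> inv\<^bsub>G\<^esub> g) \<subseteq> ?c g ` D h"
    proof
      fix x assume x: "x \<in> D (g \<otimes>\<^bsub>G\<^esub> h \<otimes>\<^bsub>G\<^esub> inv\<^bsub>G\<^esub> g)"
      have "?c (inv\<^bsub>G\<^esub> g) x \<in> D (inv\<^bsub>G\<^esub> g \<otimes>\<^bsub>G\<^esub> (g \<otimes>\<^bsub>G\<^esub> h \<otimes>\<^bsub>G\<^esub> inv\<^bsub>G\<^esub> g) \<otimes>\<^bsub>G\<^esub> inv\<^bsub>G\<^esub> (inv\<^bsub>G\<^esub> g))"
        using g h x by (intro into) auto
      moreover have "inv\<^bsub>G\<^esub> g \<otimes>\<^bsub>G\<^esub> (g \<otimes>\<^bsub>G\<^esub> h \<otimes>\<^bsub>G\<^esub> inv\<^bsub>G\<^esub> g) \<otimes>\<^bsub>G\<^esub> inv\<^bsub>G\<^esub> (inv\<^bsub>G\<^esub> g) = h"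
        using g h by (simp add: G.m_assoc) (simp add: G.m_assoc[symmetric])
      moreover have "x = ?c g (?c (inv\<^bsub>G\<^esub> g) x)"
      proof -
        have x': "x \<in> carrier H" using sub[of "g \<otimes>\<^bsub>G\<^esub> h \<otimes>\<^bsub>G\<^esub> inv\<^bsub>G\<^esub> g"] g h x by auto
        have "?c (g \<otimes>\<^bsub>G\<^esub> inv\<^bsub>G\<^esub> g) x = ?c g (?c (inv\<^bsub>G\<^esub> g) x)"
          using rep g x' unfolding representation_def by (meson G.inv_closed)
        moreover have "?c (g \<otimes>\<^bsub>G\<^esub> inv\<^bsub>G\<^esub> g) x = x"
          using rep g x' by (simp add: representation_def)
        ultimately show ?thesis by simp
      qed
      ultimately show "x \<in> ?c g ` D h" by (metis imageI)
    qed
  qed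
  then have "yd_module G H ?c D" using rep gH by (simp add: yd_module_def)
  then show ?thesis using G_algebra_conj ag by (simp add: yd_algebra_def)
qed

end

theorem proposition8p10:
  fixes G :: "('g, 'a) monoid_scheme"
    and Y :: "(complex, 'v, 'm) module_scheme"
    and act :: "'g \<Rightarrow> 'v \<Rightarrow> 'v"
    and gr :: "'g \<Rightarrow> 'v set"
  assumes "group G"
    and "yd_module G Y act gr"
    and "finite_dim Y"
  shows "G_algebra G (heisenberg_double G Y act gr) (heis_conj G Y act gr) \<and>
         (\<exists>D. heis_grading G Y act gr D) \<and>
         (\<forall>D. heis_grading G Y act gr D \<longrightarrow>
            yd_algebra G (heisenberg_double G Y act gr) (heis_conj G Y act gr) D)"
proof -
  have "module CC Y" using assms(2) by (simp add: yd_module_def representation_def)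
  then interpret heisenberg G Y gr act
    using assms(1,2)
    by (intro heisenberg.intro yd.intro yd_axioms.intro graded_space.intro
        graded_space_axioms.intro tensor.intro cspace.intro) (auto simp: yd_module_def)
  show ?thesis using G_algebra_conj heis_grading_degree_part yd_algebra_heis_grading by blast
qed

end
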